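(* Let $H$ be a Hilbert space and let $\mathcal{A},\mathcal{N}\subset\mathbb{B}(H)$ be two unital operator subalgebras. Suppose that $\mathcal{A}$ is amenable, with a virtual diagonal $u\in(\mathcal{A}\widehat{\otimes}\mathcal{A})^{**}$. Assume that $\mathcal{N}$ is $w^*$-closed and that there is a bounded projection $P$ from $\mathbb{B}(H)$ onto $\mathcal{N}$. Let $\gamma>0$. If $\mathcal{A}\subseteq^{\gamma}\mathcal{N}$ with $$\gamma<\frac{1}{F(\Vert P\Vert,\Vert u\Vert)},\qquad\text{where } F(x,y)=(1+x)\bigl(y+4(x+2)y^2+8(x+2)x^2y^3\bigr),$$ then there exists an invertible operator $S$ in the $w^*$-closed algebra generated by $\mathcal{A}\cup\mathcal{N}$ such that $S\mathcal{A}S^{-1}\subset\mathcal{N}$. Moreover, $$\Vert S-I_H\Vert\leq F(\Vert P\Vert,\Vert u\Vert)\,\gamma.$$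
   Context: $\mathbb{B}(H)$ is the algebra of bounded operators on the Hilbert space $H$, with identity $I_H$; its $w^*$-topology is the one given by its predual, the trace class operators. A unital operator subalgebra of $\mathbb{B}(H)$ is a norm-closed (not necessarily selfadjoint) subalgebra of $\mathbb{B}(H)$ containing $I_H$. The $w^*$-closed algebra generated by a subset of $\mathbb{B}(H)$ is the smallest $w^*$-closed subalgebra of $\mathbb{B}(H)$ containing it. A bounded projection from $\mathbb{B}(H)$ onto $\mathcal{N}$ is a bounded linear idempotent map $P:\mathbb{B}(H)\to\mathbb{B}(H)$ with range $\mathcal{N}$ (not assumed contractive). Near inclusion: for $\gamma>0$ and subspaces $\mathcal{E},\mathcal{F}\subset\mathbb{B}(H)$, we write $\mathcal{E}\subseteq^{\gamma}\mathcal{F}$ if for any $x$ in the unit ball of $\mathcal{E}$ there exists $y\in\mathcal{F}$ such that $\Vert x-y\Vert\leq\gamma$. Virtual diagonal: for a unital Banach algebra $\mathcal{A}$, the projective tensor product $\mathcal{A}\widehat{\otimes}\mathcal{A}$ is a Banach $\mathcal{A}$-bimodule via $a\cdot(x\otimes y)\cdot b=ax\otimes yb$, and its bidual $(\mathcal{A}\widehat{\otimes}\mathcal{A})^{**}$ is canonically a Banach $\mathcal{A}$-bimodule by duality. A virtual diagonal for $\mathcal{A}$ is an element $u\in(\mathcal{A}\widehat{\otimes}\mathcal{A})^{**}$ such that (1) $a\cdot u=u\cdot a$ for all $a\in\mathcal{A}$, and (2) $\mathrm{m}_{\mathcal{A}}^{**}(u)=1$, where $\mathrm{m}_{\mathcal{A}}:\mathcal{A}\widehat{\otimes}\mathcal{A}\to\mathcal{A}$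 is the multiplication map. $\Vert u\Vert$ is the norm in $(\mathcal{A}\widehat{\otimes}\mathcal{A})^{**}$. A unital Banach algebra is amenable if and only if it admits a virtual diagonal. *)

theory Defs
  imports "HOL-Analysis.Analysis" "HOL-Library.Function_Algebras"
begin

section \<open>Complex vector spaces and Hilbert spaces\<close>

class complex_vector = real_vector +
  fixes scaleC :: "complex \<Rightarrow> 'a \<Rightarrow> 'a"  (infixr \<open>*\<^sub>C\<close> 75)
  assumes scaleC_add_right: "a *\<^sub>C (x + y) = a *\<^sub>C x + a *\<^sub>C y"
    and scaleC_add_left: "(a + b) *\<^sub>C x = a *\<^sub>C x + b *\<^sub>C x"
    and scaleC_scaleC: "a *\<^sub>C (b *\<^sub>C x) = (a * b) *\<^sub>C x"
    and scaleR_scaleC: "r *\<^sub>R x = complex_of_real r *\<^sub>C x"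

class complex_normed_vector = complex_vector + real_normed_vector +
  assumes norm_scaleC: "norm (a *\<^sub>C x) = cmod a * norm x"

class complex_normed_algebra = complex_normed_vector + real_normed_algebra +
  assumes mult_scaleC_left: "(a *\<^sub>C x) * y = a *\<^sub>C (x * y)"
    and mult_scaleC_right: "x * (a *\<^sub>C y) = a *\<^sub>C (x * y)"

text \<open>The inner product is linear in the second argument.  Positive definiteness is contained
  in \<open>cinner_norm\<close>.\<close>

class complex_hilbert_space = complex_normed_vector + complete_space +
  fixes cinner :: "'a \<Rightarrow> 'a \<Rightarrow> complex"
  assumes cinner_commute: "cinner x y = cnj (cinner y x)"
    and cinner_add_right: "cinner x (y + z) = cinner x y + cinner x z"
    and cinner_scaleC_right: "cinner x (c *\<^sub>C y) = c * cinner x y"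
    and cinner_norm: "cinner x x = complex_of_real ((norm x)\<^sup>2)"

instantiation complex :: complex_hilbert_space
begin

definition scaleC_complex :: "complex \<Rightarrow> complex \<Rightarrow> complex"
  where "scaleC_complex a x = a * x"

definition cinner_complex :: "complex \<Rightarrow> complex \<Rightarrow> complex"
  where "cinner_complex x y = cnj x * y"

instance
proof
  fix a b c x y z :: complex and r :: real
  show "a *\<^sub>C (x + y) = a *\<^sub>C x + a *\<^sub>C y" "(a + b) *\<^sub>C x = a *\<^sub>C x + b *\<^sub>C x"
    "a *\<^sub>C b *\<^sub>C x = (a * b) *\<^sub>C x" "r *\<^sub>R x = complex_of_real r *\<^sub>C x"
    "norm (a *\<^sub>C x) = cmod a * norm x"
    by (simp_all add: scaleC_complex_def algebra_simps scaleR_conv_of_real norm_mult)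
  show "cinner x y = cnj (cinner y x)" "cinner x (y + z) = cinner x y + cinner x z"
    "cinner x (c *\<^sub>C y) = c * cinner x y"
    by (simp_all add: scaleC_complex_def cinner_complex_def algebra_simps)
  show "cinner x x = complex_of_real ((norm x)\<^sup>2)"
    by (simp only: cinner_complex_def complex_norm_square mult.commute)
qed

end

instance complex :: complex_normed_algebra
  by standard (auto simp: scaleC_complex_def)

instantiation "fun" :: (type, real_vector) real_vector
begin

definition scaleR_fun :: "real \<Rightarrow> ('a \<Rightarrow> 'b) \<Rightarrow> 'a \<Rightarrow> 'b"
  where "scaleR_fun r f = (\<lambda>x. r *\<^sub>R f x)"

instance
  by standard (auto simp: scaleR_fun_def fun_eq_iff algebra_simps)

end

instantiation "fun" :: (type, complex_vector) complex_vector
begin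

definition scaleC_fun :: "complex \<Rightarrow> ('a \<Rightarrow> 'b) \<Rightarrow> 'a \<Rightarrow> 'b"
  where "scaleC_fun c f = (\<lambda>x. c *\<^sub>C f x)"

instance
  by standard
    (auto simp: scaleC_fun_def scaleR_fun_def fun_eq_iff scaleC_add_right scaleC_add_left
        scaleC_scaleC scaleR_scaleC)

end

definition csubspace :: "'a::complex_vector set \<Rightarrow> bool"
  where "csubspace V \<longleftrightarrow> 0 \<in> V \<and> (\<forall>x\<in>V. \<forall>y\<in>V. x + y \<in> V) \<and> (\<forall>c. \<forall>x\<in>V. c *\<^sub>C x \<in> V)"

definition cspan :: "'a::complex_vector set \<Rightarrow> 'a set"
  where "cspan S = csubspace hull S"

definition clinear_on :: "'a::complex_vector set \<Rightarrow> ('a \<Rightarrow> 'b::complex_vector) \<Rightarrow> bool"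
  where "clinear_on V f \<longleftrightarrow>
    (\<forall>x\<in>V. \<forall>y\<in>V. f (x + y) = f x + f y) \<and> (\<forall>c. \<forall>x\<in>V. f (c *\<^sub>C x) = c *\<^sub>C f x)"

definition bounded_clinear ::
    "('a::complex_normed_vector \<Rightarrow> 'b::complex_normed_vector) \<Rightarrow> bool"
  where "bounded_clinear f \<longleftrightarrow> bounded_linear f \<and> clinear_on UNIV f"


section \<open>Bounded operators on a complex normed space\<close>

typedef (overloaded) 'h bop =
    "{T :: 'h::complex_normed_vector \<Rightarrow>\<^sub>L 'h. clinear_on UNIV (blinfun_apply T)}"
  morphisms blinfun_of_bop Bop
  by (rule exI[of _ 0]) (auto simp: clinear_on_def scaleC_add_right[of _ 0 0, simplified])

setup_lifting type_definition_bop

lift_definition bop_apply :: "'h::complex_normed_vector bop \<Rightarrow> 'h \<Rightarrow> 'h"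
  is blinfun_apply .

lemma bop_eqI: "(\<And>x. bop_apply S x = bop_apply T x) \<Longrightarrow> S = T"
  by transfer (rule blinfun_eqI)

lemma scaleC_diff_right: "c *\<^sub>C (x - y) = c *\<^sub>C x - c *\<^sub>C (y::'a::complex_vector)"
  by (metis add_diff_cancel diff_add_cancel scaleC_add_right)

lemma scaleC_zero_right: "c *\<^sub>C (0::'a::complex_vector) = 0"
  using scaleC_add_right[of c 0 "0::'a"] by simp

lemma scaleC_minus_right: "c *\<^sub>C (- y) = - (c *\<^sub>C (y::'a::complex_vector))"
  using scaleC_diff_right[of c 0 y] by (simp add: scaleC_zero_right)

lemma bounded_linear_scaleC: "bounded_linear (\<lambda>x::'a::complex_normed_vector. c *\<^sub>C x)"
  by (rule bounded_linear_intro[where K = "cmod c"])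
    (auto simp: scaleC_add_right scaleR_scaleC scaleC_scaleC norm_scaleC mult.commute)

instantiation bop :: (complex_normed_vector) real_normed_vector
begin

lift_definition zero_bop :: "'a bop" is 0
  by (simp add: clinear_on_def scaleC_zero_right)
lift_definition plus_bop :: "'a bop \<Rightarrow> 'a bop \<Rightarrow> 'a bop" is "(+)"
  by (simp add: clinear_on_def blinfun.add_left scaleC_add_right)
lift_definition minus_bop :: "'a bop \<Rightarrow> 'a bop \<Rightarrow> 'a bop" is "(-)"
  by (simp add: clinear_on_def blinfun.diff_left scaleC_diff_right)
lift_definition uminus_bop :: "'a bop \<Rightarrow> 'a bop" is "uminus"
  by (simp add: clinear_on_def blinfun.minus_left scaleC_minus_right)
lift_definition scaleR_bop :: "real \<Rightarrow> 'a bop \<Rightarrow> 'a bop" is "scaleR"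
  by (simp add: clinear_on_def blinfun.scaleR_left scaleC_add_right scaleR_scaleC
      scaleC_scaleC mult.commute)
lift_definition norm_bop :: "'a bop \<Rightarrow> real" is norm .
lift_definition dist_bop :: "'a bop \<Rightarrow> 'a bop \<Rightarrow> real" is dist .
lift_definition sgn_bop :: "'a bop \<Rightarrow> 'a bop" is sgn
  by (simp add: sgn_div_norm clinear_on_def blinfun.scaleR_left scaleC_add_right scaleR_scaleC
      scaleC_scaleC mult.commute)
definition uniformity_bop :: "('a bop \<times> 'a bop) filter"
  where "uniformity_bop = (INF e\<in>{0<..}. principal {(x, y). dist x y < e})"
definition open_bop :: "'a bop set \<Rightarrow> bool"
  where "open_bop S = (\<forall>x\<in>S. \<forall>\<^sub>F (x', y) in uniformity. x' = x \<longrightarrow> y \<in> S)"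

instance
proof
  fix a b :: real and S T U :: "'a bop" and X :: "'a bop set"
  show "S + T + U = S + (T + U)" "S + T = T + S" "0 + S = S" "- S + S = 0" "S - T = S + - T"
    by (transfer; simp)+
  show "a *\<^sub>R (S + T) = a *\<^sub>R S + a *\<^sub>R T" "(a + b) *\<^sub>R S = a *\<^sub>R S + b *\<^sub>R S"
    "a *\<^sub>R b *\<^sub>R S = (a * b) *\<^sub>R S" "1 *\<^sub>R S = S"
    by (transfer; simp add: scaleR_add_right scaleR_add_left)+
  show "dist S T = norm (S - T)" by transfer (rule dist_norm)
  show "sgn S = inverse (norm S) *\<^sub>R S" by transfer (rule sgn_div_norm)
  show "(norm S = 0) = (S = 0)" "norm (S + T) \<le> norm S + norm T"
    "norm (a *\<^sub>R S) = \<bar>a\<bar> * norm S"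
    by (transfer; simp add: norm_triangle_ineq)+
  show "uniformity = (INF e\<in>{0<..}. principal {(x, y :: 'a bop). dist x y < e})"
    by (rule uniformity_bop_def)
  show "open X = (\<forall>x\<in>X. \<forall>\<^sub>F (x', y) in uniformity. x' = x \<longrightarrow> y \<in> X)"
    by (rule open_bop_def)
qed

end

instantiation bop :: (complex_normed_vector) "{complex_normed_algebra, monoid_mult}"
begin

lift_definition scaleC_bop :: "complex \<Rightarrow> 'a bop \<Rightarrow> 'a bop"
  is "\<lambda>c T. Blinfun (\<lambda>x. c *\<^sub>C blinfun_apply T x)"
  by (auto simp: clinear_on_def bounded_linear_Blinfun_apply scaleC_add_right scaleC_scaleC
      mult.commute bounded_linear_compose[OF bounded_linear_scaleC blinfun.bounded_linear_right])
lift_definition times_bop :: "'a bop \<Rightarrow> 'a bop \<Rightarrow> 'a bop" is "(o\<^sub>L)"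
  by (simp add: clinear_on_def)
lift_definition one_bop :: "'a bop" is id_blinfun
  by (simp add: clinear_on_def)

lemma bop_apply_simps:
  "bop_apply 0 x = 0"
  "bop_apply (S + T) x = bop_apply S x + bop_apply T x"
  "bop_apply (S - T) x = bop_apply S x - bop_apply T x"
  "bop_apply (r *\<^sub>R T) x = r *\<^sub>R bop_apply T x"
  "bop_apply (c *\<^sub>C T) x = c *\<^sub>C bop_apply T x"
  "bop_apply (S * T) x = bop_apply S (bop_apply T x)"
  "bop_apply 1 x = x"
  "bop_apply T (x + y) = bop_apply T x + bop_apply T y"
  "bop_apply T (r *\<^sub>R x) = r *\<^sub>R bop_apply T x"
  "bop_apply T (c *\<^sub>C x) = c *\<^sub>C bop_apply T x"
  by (transfer; simp add: blinfun.bilinear_simps clinear_on_def bounded_linear_Blinfun_apply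
      bounded_linear_compose[OF bounded_linear_scaleC blinfun.bounded_linear_right])+

lemma norm_bop_apply: "norm (bop_apply T x) \<le> norm T * norm x"
  by transfer (rule norm_blinfun)

lemma norm_bop_bound:
  assumes "0 \<le> b" "\<And>x. norm (bop_apply T x) \<le> b * norm x"
  shows "norm T \<le> b"
  using assms by transfer (rule norm_blinfun_bound)

instance
proof
  fix a b :: complex and r :: real and S T U :: "'a bop"
  show "a *\<^sub>C (S + T) = a *\<^sub>C S + a *\<^sub>C T" "(a + b) *\<^sub>C S = a *\<^sub>C S + b *\<^sub>C S"
    "a *\<^sub>C b *\<^sub>C S = (a * b) *\<^sub>C S" "r *\<^sub>R S = complex_of_real r *\<^sub>C S"
    by (rule bop_eqI, simp add: bop_apply_simps scaleC_add_right scaleC_add_left scaleC_scaleC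
        scaleR_scaleC)+
  show "S * T * U = S * (T * U)" "(S + T) * U = S * U + T * U" "S * (T + U) = S * T + S * U"
    "r *\<^sub>R S * T = r *\<^sub>R (S * T)" "S * r *\<^sub>R T = r *\<^sub>R (S * T)" "1 * S = S" "S * 1 = S"
    "a *\<^sub>C S * T = a *\<^sub>C (S * T)" "S * a *\<^sub>C T = a *\<^sub>C (S * T)"
    by (rule bop_eqI, simp add: bop_apply_simps)+
  show "norm (S * T) \<le> norm S * norm T"
    by transfer (rule norm_blinfun_compose)
  show "norm (a *\<^sub>C S) = cmod a * norm S"
  proof (rule antisym)
    have le: "norm (c *\<^sub>C R) \<le> cmod c * norm R" for c and R :: "'a bop"
      by (rule norm_bop_bound)
        (auto simp: bop_apply_simps norm_scaleC mult.assoc intro!: mult_left_mono norm_bop_apply)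
    show "norm (a *\<^sub>C S) \<le> cmod a * norm S" by (rule le)
    show "cmod a * norm S \<le> norm (a *\<^sub>C S)"
    proof (cases "a = 0")
      case False
      have "inverse a *\<^sub>C a *\<^sub>C S = S"
        using False by (intro bop_eqI)
          (simp add: bop_apply_simps scaleC_scaleC scaleR_scaleC[of 1, simplified, symmetric])
      then have "norm S \<le> cmod (inverse a) * norm (a *\<^sub>C S)"
        using le[of "inverse a" "a *\<^sub>C S"] by simp
      then show ?thesis
        using False by (simp add: norm_divide field_simps)
    qed simp
  qed
qed

end


section \<open>Trace class operators and the weak-star topology\<close>

definition is_onb :: "'h::complex_hilbert_space set \<Rightarrow> bool"
  where "is_onb E \<longleftrightarrow> (\<forall>e\<in>E. norm e = 1) \<and> (\<forall>e\<in>E. \<forall>f\<in>E. e \<noteq> f \<longrightarrow> cinner e f = 0) \<and>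
    closure (cspan E) = UNIV"

text \<open>Neither the next definition nor the trace of a trace class operator depends on the choice
  of the orthonormal basis.  Trace class operators are defined, following Schatten, as the products
  of two Hilbert--Schmidt operators.\<close>

definition hilbert_schmidt :: "'h::complex_hilbert_space bop \<Rightarrow> bool"
  where "hilbert_schmidt T \<longleftrightarrow> (\<exists>E. is_onb E \<and> (\<lambda>e. (norm (bop_apply T e))\<^sup>2) summable_on E)"

definition trace_class :: "'h::complex_hilbert_space bop \<Rightarrow> bool"
  where "trace_class T \<longleftrightarrow> (\<exists>R S. hilbert_schmidt R \<and> hilbert_schmidt S \<and> T = R * S)"

definition op_trace :: "'h::complex_hilbert_space bop \<Rightarrow> complex"
  where "op_trace T = (\<Sum>\<^sub>\<infinity>e\<in>(SOME E. is_onb E). cinner e (bop_apply T e))"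

definition wstar_topology :: "'h::complex_hilbert_space bop topology"
  where "wstar_topology = topology_generated_by
    {{X. op_trace (X * T) \<in> U} | T U. trace_class T \<and> open U}"


section \<open>Operator algebras\<close>

definition csubalgebra :: "'a::complex_normed_algebra set \<Rightarrow> bool"
  where "csubalgebra A \<longleftrightarrow> csubspace A \<and> (\<forall>x\<in>A. \<forall>y\<in>A. x * y \<in> A)"

definition unital_operator_subalgebra :: "'h::complex_hilbert_space bop set \<Rightarrow> bool"
  where "unital_operator_subalgebra A \<longleftrightarrow> csubalgebra A \<and> 1 \<in> A \<and> closed A"

definition wstar_closed_algebra_generated ::
    "'h::complex_hilbert_space bop set \<Rightarrow> 'h bop set"
  where "wstar_closed_algebra_generated X =
    (\<lambda>M. csubalgebra M \<and> closedin wstar_topology M) hull X"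

definition near_inclusion ::
    "'a::complex_normed_vector set \<Rightarrow> real \<Rightarrow> 'a set \<Rightarrow> bool"
  where "near_inclusion E \<gamma> F \<longleftrightarrow> (\<forall>x\<in>E. norm x \<le> 1 \<longrightarrow> (\<exists>y\<in>F. norm (x - y) \<le> \<gamma>))"

definition bounded_projection_onto ::
    "('a::complex_normed_vector \<Rightarrow> 'a) \<Rightarrow> 'a set \<Rightarrow> bool"
  where "bounded_projection_onto P N \<longleftrightarrow>
    bounded_clinear P \<and> (\<forall>x. P (P x) = P x) \<and> range P = N"


section \<open>Duals of seminormed spaces\<close>

text \<open>A seminormed space is given by a carrier \<open>V\<close>, a complex subspace of the ambient type, and
  a seminorm \<open>p\<close> on \<open>V\<close>; it stands for the normed space obtained by identifying vectors at
  distance zero.  Bounded functionals on \<open>V\<close> respect this identification, so the dual space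
  and the dual norm are those of the normed quotient.  Functionals are set to zero outside \<open>V\<close>,
  so that equality of functionals is equality on \<open>V\<close>.\<close>

definition dual_space ::
    "'v::complex_vector set \<Rightarrow> ('v \<Rightarrow> real) \<Rightarrow> ('v \<Rightarrow> complex) set"
  where "dual_space V p = {\<phi>. clinear_on V \<phi> \<and> (\<exists>C. \<forall>x\<in>V. cmod (\<phi> x) \<le> C * p x) \<and>
    (\<forall>x. x \<notin> V \<longrightarrow> \<phi> x = 0)}"

definition dual_norm ::
    "'v::complex_vector set \<Rightarrow> ('v \<Rightarrow> real) \<Rightarrow> ('v \<Rightarrow> complex) \<Rightarrow> real"
  where "dual_norm V p \<phi> = Sup {cmod (\<phi> x) | x. x \<in> V \<and> p x \<le> 1}"

definition bidual_space ::
    "'v::complex_vector set \<Rightarrow> ('v \<Rightarrow> real) \<Rightarrow> (('v \<Rightarrow> complex) \<Rightarrow> complex) set"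
  where "bidual_space V p = dual_space (dual_space V p) (dual_norm V p)"

definition bidual_norm ::
    "'v::complex_vector set \<Rightarrow> ('v \<Rightarrow> real) \<Rightarrow> (('v \<Rightarrow> complex) \<Rightarrow> complex) \<Rightarrow> real"
  where "bidual_norm V p = dual_norm (dual_space V p) (dual_norm V p)"

definition canonical_embedding ::
    "'v::complex_vector set \<Rightarrow> ('v \<Rightarrow> real) \<Rightarrow> 'v \<Rightarrow> (('v \<Rightarrow> complex) \<Rightarrow> complex)"
  where "canonical_embedding V p x = (\<lambda>\<phi>. if \<phi> \<in> dual_space V p then \<phi> x else 0)"

text \<open>The adjoint of a map \<open>T\<close> with domain \<open>V\<close>.\<close>

definition adjoint_on ::
    "'v set \<Rightarrow> ('v \<Rightarrow> 'w) \<Rightarrow> ('w \<Rightarrow> complex) \<Rightarrow> ('v \<Rightarrow> complex)"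
  where "adjoint_on V T \<psi> = (\<lambda>x. if x \<in> V then \<psi> (T x) else 0)"

text \<open>The second adjoint from the bidual of \<open>(V, p)\<close> to the bidual of \<open>(W, q)\<close>, for a bounded
  operator \<open>T\<close> from \<open>(V, p)\<close> to \<open>(W, q)\<close>.\<close>

definition second_adjoint ::
    "'v set \<Rightarrow> 'w::complex_vector set \<Rightarrow> ('w \<Rightarrow> real) \<Rightarrow> ('v \<Rightarrow> 'w) \<Rightarrow>
      (('v \<Rightarrow> complex) \<Rightarrow> complex) \<Rightarrow> (('w \<Rightarrow> complex) \<Rightarrow> complex)"
  where "second_adjoint V W q T = adjoint_on (dual_space W q) (adjoint_on V T)"


section \<open>The projective tensor product\<close>

text \<open>The completion of a seminormed space: Cauchy sequences with the limit seminorm.\<close>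

definition completion ::
    "'v::complex_vector set \<Rightarrow> ('v \<Rightarrow> real) \<Rightarrow> (nat \<Rightarrow> 'v) set"
  where "completion V p =
    {X. (\<forall>n. X n \<in> V) \<and> (\<forall>e>0. \<exists>M. \<forall>m\<ge>M. \<forall>n\<ge>M. p (X m - X n) < e)}"

definition completion_norm :: "('v \<Rightarrow> real) \<Rightarrow> (nat \<Rightarrow> 'v) \<Rightarrow> real"
  where "completion_norm p X = lim (\<lambda>n. p (X n))"

text \<open>The algebraic tensor product \<open>A \<otimes> A\<close> is the free complex vector space on \<open>A \<times> A\<close> (finitely
  supported functions, with basis vectors \<open>elem_tensor x y\<close>) modulo the subspace
  \<open>tensor_relations A\<close> spanned by the bilinearity relations.  It is
  represented by the free space, equipped with the projective seminorm; the null space of that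
  seminorm is exactly \<open>tensor_relations A\<close>.\<close>

definition elem_tensor :: "'a \<Rightarrow> 'a \<Rightarrow> 'a \<times> 'a \<Rightarrow> complex"
  where "elem_tensor x y = (\<lambda>z. if z = (x, y) then 1 else 0)"

definition free_tensors :: "'a set \<Rightarrow> ('a \<times> 'a \<Rightarrow> complex) set"
  where "free_tensors A = {f. finite {z. f z \<noteq> 0} \<and> {z. f z \<noteq> 0} \<subseteq> A \<times> A}"

definition tensor_relations :: "'a::complex_vector set \<Rightarrow> ('a \<times> 'a \<Rightarrow> complex) set"
  where "tensor_relations A = cspan (
    {elem_tensor (x + x') y - elem_tensor x y - elem_tensor x' y | x x' y.
       x \<in> A \<and> x' \<in> A \<and> y \<in> A} \<union>
    {elem_tensor x (y + y') - elem_tensor x y - elem_tensor x y' | x y y'.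
       x \<in> A \<and> y \<in> A \<and> y' \<in> A} \<union>
    {elem_tensor (c *\<^sub>C x) y - c *\<^sub>C elem_tensor x y | c x y. x \<in> A \<and> y \<in> A} \<union>
    {elem_tensor x (c *\<^sub>C y) - c *\<^sub>C elem_tensor x y | c x y. x \<in> A \<and> y \<in> A})"

definition projective_norm ::
    "'a::complex_normed_vector set \<Rightarrow> ('a \<times> 'a \<Rightarrow> complex) \<Rightarrow> real"
  where "projective_norm A f = Inf {(\<Sum>i<n. norm (x i) * norm (y i)) | (n::nat) x y.
    (\<forall>i<n. x i \<in> A \<and> y i \<in> A) \<and> f - (\<Sum>i<n. elem_tensor (x i) (y i)) \<in> tensor_relations A}"

type_synonym 'a ptensor = "nat \<Rightarrow> 'a \<times> 'a \<Rightarrow> complex"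
type_synonym 'a ptensor_bidual = "('a ptensor \<Rightarrow> complex) \<Rightarrow> complex"

definition ptensor :: "'a::complex_normed_vector set \<Rightarrow> 'a ptensor set"
  where "ptensor A = completion (free_tensors A) (projective_norm A)"

definition ptensor_norm :: "'a::complex_normed_vector set \<Rightarrow> 'a ptensor \<Rightarrow> real"
  where "ptensor_norm A = completion_norm (projective_norm A)"

text \<open>\<open>free_extend g\<close> is the linear extension of \<open>x \<otimes> y \<mapsto> g x y\<close> to the free space.  The module
  actions \<open>a \<cdot> (x \<otimes> y) = ax \<otimes> y\<close> and \<open>(x \<otimes> y) \<cdot> b = x \<otimes> yb\<close>, and the multiplication map
  \<open>x \<otimes> y \<mapsto> xy\<close>, are extended linearly and then continuously to the completion.\<close>

definition free_extend ::
    "('a \<Rightarrow> 'a \<Rightarrow> 'v::complex_vector) \<Rightarrow> ('a \<times> 'a \<Rightarrow> complex) \<Rightarrow> 'v"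
  where "free_extend g f = (\<Sum>z | f z \<noteq> 0. f z *\<^sub>C g (fst z) (snd z))"

definition ptensor_left :: "'a::complex_normed_algebra \<Rightarrow> 'a ptensor \<Rightarrow> 'a ptensor"
  where "ptensor_left a X = (\<lambda>n. free_extend (\<lambda>x y. elem_tensor (a * x) y) (X n))"

definition ptensor_right :: "'a::complex_normed_algebra \<Rightarrow> 'a ptensor \<Rightarrow> 'a ptensor"
  where "ptensor_right b X = (\<lambda>n. free_extend (\<lambda>x y. elem_tensor x (y * b)) (X n))"

definition ptensor_mult :: "'a::complex_normed_algebra ptensor \<Rightarrow> 'a"
  where "ptensor_mult X = lim (\<lambda>n. free_extend (\<lambda>x y. x * y) (X n))"

text \<open>The bimodule structure of the bidual is given by the second adjoints of the module actions:
  \<open>(a \<cdot> u)(\<phi>) = u(\<phi> \<cdot> a)\<close> with \<open>(\<phi> \<cdot> a)(t) = \<phi>(a \<cdot> t)\<close>, and likewise on the right.\<close>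

definition bidual_left ::
    "'a::complex_normed_algebra set \<Rightarrow> 'a \<Rightarrow> 'a ptensor_bidual \<Rightarrow> 'a ptensor_bidual"
  where "bidual_left A a = second_adjoint (ptensor A) (ptensor A) (ptensor_norm A) (ptensor_left a)"

definition bidual_right ::
    "'a::complex_normed_algebra set \<Rightarrow> 'a \<Rightarrow> 'a ptensor_bidual \<Rightarrow> 'a ptensor_bidual"
  where "bidual_right A b = second_adjoint (ptensor A) (ptensor A) (ptensor_norm A) (ptensor_right b)"

definition bidual_mult ::
    "'a::complex_normed_algebra set \<Rightarrow> 'a ptensor_bidual \<Rightarrow> (('a \<Rightarrow> complex) \<Rightarrow> complex)"
  where "bidual_mult A = second_adjoint (ptensor A) A norm ptensor_mult"

definition virtual_diagonal ::
    "'a::{complex_normed_algebra, one} set \<Rightarrow> 'a ptensor_bidual \<Rightarrow> bool"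
  where "virtual_diagonal A u \<longleftrightarrow>
    u \<in> bidual_space (ptensor A) (ptensor_norm A) \<and>
    (\<forall>a\<in>A. bidual_left A a u = bidual_right A a u) \<and>
    bidual_mult A u = canonical_embedding A norm 1"

definition virtual_diagonal_norm ::
    "'a::complex_normed_algebra set \<Rightarrow> 'a ptensor_bidual \<Rightarrow> real"
  where "virtual_diagonal_norm A u = bidual_norm (ptensor A) (ptensor_norm A) u"

definition perturbation_bound :: "real \<Rightarrow> real \<Rightarrow> real"
  where "perturbation_bound x y =
    (1 + x) * (y + 4 * (x + 2) * y ^ 2 + 8 * (x + 2) * x ^ 2 * y ^ 3)"

end

theory Submission
  imports Defs
begin

text \<open>The idea is B. E. Johnson's: if an amenable algebra almost has a homomorphism into a dual
  algebra, then it has one nearby.  Write \<open>\<integral> \<Phi>(a, b) du(a, b)\<close> for the value of a virtual diagonal \<open>u\<close>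
  at a bounded bilinear map \<open>\<Phi>\<close> from \<open>A \<times> A\<close> to the operators on \<open>H\<close>.  This weak integral has norm at
  most \<open>\<parallel>u\<parallel> \<parallel>\<Phi>\<parallel>\<close> and commutes with multiplication by fixed operators, and the axioms of a virtual
  diagonal become \<open>\<integral> \<Phi>(c a, b) du = \<integral> \<Phi>(a, b c) du\<close> for \<open>c \<in> A\<close> (\<open>diag_integral_shift\<close>) and
  \<open>\<integral> f(a b) du = f(1)\<close> (\<open>diag_integral_product\<close>).  Moreover the integral of a map with values in a
  weak-star closed subspace stays in that subspace (\<open>diag_integral_mem_wstar_closed\<close>).  This rests on the
  fact that a trace functional \<open>X \<mapsto> tr (X T)\<close> is a norm limit of finite sums of matrix coefficients.

  Let \<open>\<phi>\<close> be the restriction of \<open>P\<close> to \<open>A\<close>.  Near inclusion gives \<open>\<parallel>\<phi>(a) - a\<parallel> \<le> (1 + \<parallel>P\<parallel>) \<gamma> \<parallel>a\<parallel>\<close>, so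
  the defect \<open>D(a, b) = \<phi>(a b) - \<phi>(a) \<phi>(b)\<close> has norm at most \<open>\<delta> = (\<parallel>P\<parallel> + 2) (1 + \<parallel>P\<parallel>) \<gamma>\<close>.  Put
  \<open>\<theta>(c) = \<integral> \<phi>(a) D(b, c) du(a, b)\<close> and replace \<open>\<phi>\<close> by \<open>\<phi> + \<theta>\<close>.  By the cocycle identity for \<open>D\<close> the
  new defect at \<open>(c, d)\<close> is
  \<open>(\<integral> D(a, b) du) D(c, d) + \<integral> D(c, a) D(b, d) du - \<theta>(c) \<theta>(d)\<close> (\<open>newton_step_defect\<close>), which is quadratic
  in \<open>D\<close>.  The hypothesis on \<open>\<gamma>\<close> makes the iteration converge to a homomorphism \<open>\<psi>\<close> from \<open>A\<close> to \<open>N\<close> with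
  \<open>\<parallel>\<psi> - \<phi>\<parallel> \<le> 4 \<parallel>P\<parallel> \<parallel>u\<parallel> \<delta>\<close> (\<open>near_homomorphism_close_to_homomorphism\<close>).

  Finally \<open>S = \<integral> \<psi>(a) b du(a, b)\<close> satisfies \<open>\<psi>(c) S = S c\<close>, lies in every weak-star closed algebra that
  contains \<open>A\<close> and \<open>N\<close>, and differs from \<open>1 = \<integral> a b du(a, b)\<close> by at most \<open>\<parallel>u\<parallel>\<close> times the norm of
  \<open>\<psi> - id\<close> (\<open>intertwiner\<close>).  That distance is less than 1, so \<open>S\<close> is invertible, and
  \<open>S c S\<^sup>-\<^sup>1 = \<psi>(c) \<in> N\<close>.\<close>

section \<open>Complex vector spaces\<close>

lemma scaleC_one [simp]: "1 *\<^sub>C (x::'a::complex_vector) = x"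
  using scaleR_scaleC[of 1 x] by simp

lemma scaleC_zero_left [simp]: "0 *\<^sub>C (x::'a::complex_vector) = 0"
  using scaleR_scaleC[of 0 x] by simp

lemma scaleC_minus_left: "(- c) *\<^sub>C (x::'a::complex_vector) = - (c *\<^sub>C x)"
  using scaleC_add_left[of "-c" c x] by (simp add: eq_neg_iff_add_eq_0)

lemma scaleC_minus_one: "(- 1) *\<^sub>C (x::'a::complex_vector) = - x"
  by (simp add: scaleC_minus_left)

lemma scaleC_diff_left: "(a - b) *\<^sub>C (x::'a::complex_vector) = a *\<^sub>C x - b *\<^sub>C x"
  using scaleC_add_left[of a "-b" x] by (simp add: scaleC_minus_left)

lemma scaleC_sum_right: "c *\<^sub>C (\<Sum>i\<in>I. f i) = (\<Sum>i\<in>I. c *\<^sub>C (f i :: 'a::complex_vector))"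
  by (induction I rule: infinite_finite_induct) (auto simp: scaleC_zero_right scaleC_add_right)

lemma csubspace_0: "csubspace V \<Longrightarrow> 0 \<in> V"
  and csubspace_add: "csubspace V \<Longrightarrow> x \<in> V \<Longrightarrow> y \<in> V \<Longrightarrow> x + y \<in> V"
  and csubspace_scaleC: "csubspace V \<Longrightarrow> x \<in> V \<Longrightarrow> c *\<^sub>C x \<in> V"
  by (auto simp: csubspace_def)

lemma csubspace_minus: "csubspace V \<Longrightarrow> x \<in> V \<Longrightarrow> - x \<in> V"
  using csubspace_scaleC[of V x "-1"] by (simp add: scaleC_minus_one)

lemma csubspace_diff: "csubspace V \<Longrightarrow> x \<in> V \<Longrightarrow> y \<in> V \<Longrightarrow> x - y \<in> V"
  using csubspace_add[of V x "-y"] csubspace_minus[of V y] by simp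

lemma csubspace_sum: "csubspace V \<Longrightarrow> (\<And>i. i \<in> I \<Longrightarrow> f i \<in> V) \<Longrightarrow> (\<Sum>i\<in>I. f i) \<in> V"
  by (induction I rule: infinite_finite_induct) (auto intro: csubspace_0 csubspace_add)

lemma csubspace_cspan: "csubspace (cspan S)"
  unfolding cspan_def by (rule hull_in) (auto simp: csubspace_def)

lemma cspan_superset: "S \<subseteq> cspan S"
  unfolding cspan_def by (rule hull_subset)

lemma cspan_minimal: "S \<subseteq> V \<Longrightarrow> csubspace V \<Longrightarrow> cspan S \<subseteq> V"
  unfolding cspan_def by (rule hull_minimal)

lemma clinear_onD:
  assumes "clinear_on V f"
  shows "x \<in> V \<Longrightarrow> y \<in> V \<Longrightarrow> f (x + y) = f x + f y"
    and "x \<in> V \<Longrightarrow> f (c *\<^sub>C x) = c *\<^sub>C f x"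
  using assms by (auto simp: clinear_on_def)

lemma clinear_on_zero: "clinear_on V f \<Longrightarrow> csubspace V \<Longrightarrow> f 0 = 0"
  using clinear_onD(2)[of V f 0 0] by (auto simp: csubspace_def)

lemma clinear_on_diff:
  assumes "clinear_on V f" "csubspace V" "x \<in> V" "y \<in> V"
  shows "f (x - y) = f x - f y"
  using clinear_onD(1)[OF assms(1), of x "- y"] clinear_onD(2)[OF assms(1), of y "-1"] assms
  by (auto simp: scaleC_minus_one csubspace_minus)


section \<open>Hilbert spaces: Riesz representation, adjoints and Parseval's identity\<close>

lemma cinner_add_left: "cinner (x + y) z = cinner x z + cinner y (z::'h::complex_hilbert_space)"
  by (simp add: cinner_commute[of _ z] cinner_add_right)

lemma cinner_scaleC_left: "cinner (c *\<^sub>C x) y = cnj c * cinner x (y::'h::complex_hilbert_space)"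
  by (simp add: cinner_commute[of _ y] cinner_scaleC_right)

lemma cinner_zero_right [simp]: "cinner (x::'h::complex_hilbert_space) 0 = 0"
  using cinner_scaleC_right[of x 0 0] by simp

lemma cinner_zero_left [simp]: "cinner 0 (x::'h::complex_hilbert_space) = 0"
  using cinner_commute[of 0 x] by simp

lemma cinner_diff_right: "cinner x (y - z) = cinner x y - cinner x (z::'h::complex_hilbert_space)"
  using cinner_add_right[of x y "(-1) *\<^sub>C z"] cinner_scaleC_right[of x "-1" z]
  by (simp add: scaleC_minus_one)

lemma cinner_eq_norm_sq:
  "(cmod (cinner x y))\<^sup>2 = Re (cinner x y * cinner y (x::'h::complex_hilbert_space))"
  unfolding cinner_commute[of y x] complex_norm_square[symmetric] by (simp only: Re_complex_of_real)

lemma norm_add_sq: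
  fixes x y :: "'h::complex_hilbert_space"
  shows "(norm (x + y))\<^sup>2 = (norm x)\<^sup>2 + (norm y)\<^sup>2 + 2 * Re (cinner x y)"
proof -
  have "complex_of_real ((norm (x+y))\<^sup>2) = cinner (x+y) (x+y)" by (simp only: cinner_norm)
  also have "\<dots> = cinner x x + cinner y y + (cinner x y + cinner y x)"
    by (simp only: cinner_add_right cinner_add_left ac_simps)
  also have "cinner x y + cinner y x = complex_of_real (2 * Re (cinner x y))"
    using cinner_commute[of y x] by (simp add: complex_add_cnj)
  finally show ?thesis unfolding cinner_norm of_real_add[symmetric] of_real_eq_iff .
qed

lemma cinner_sum_right: "cinner x (\<Sum>i\<in>I. f i) = (\<Sum>i\<in>I. cinner x (f i :: 'h::complex_hilbert_space))"
  by (induction I rule: infinite_finite_induct) (auto simp: cinner_add_right)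

definition orthonormal :: "'h::complex_hilbert_space set \<Rightarrow> bool"
  where "orthonormal E \<longleftrightarrow> (\<forall>e\<in>E. norm e = 1) \<and> (\<forall>e\<in>E. \<forall>f\<in>E. e \<noteq> f \<longrightarrow> cinner e f = 0)"

lemma orthonormal_subset: "orthonormal E \<Longrightarrow> F \<subseteq> E \<Longrightarrow> orthonormal F"
  by (auto simp: orthonormal_def)

lemma orthonormal_cinner:
  "orthonormal E \<Longrightarrow> e \<in> E \<Longrightarrow> f \<in> E \<Longrightarrow> cinner e f = (if e = f then 1 else 0)"
  by (auto simp: orthonormal_def cinner_norm)

lemma norm_diff_projection:
  fixes x :: "'h::complex_hilbert_space"
  assumes "finite F" "orthonormal F"
  shows "(norm (x - (\<Sum>e\<in>F. cinner e x *\<^sub>C e)))\<^sup>2 = (norm x)\<^sup>2 - (\<Sum>e\<in>F. (cmod (cinner e x))\<^sup>2)"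
  using assms
proof (induction F)
  case (insert e F)
  define r where "r = x - (\<Sum>e\<in>F. cinner e x *\<^sub>C e)"
  have F: "orthonormal F" using insert.prems by (rule orthonormal_subset) auto
  have "cinner e r = cinner e x - (\<Sum>f\<in>F. cinner f x * cinner e f)"
    by (simp add: r_def cinner_diff_right cinner_sum_right cinner_scaleC_right)
  also have "(\<Sum>f\<in>F. cinner f x * cinner e f) = 0"
    using insert by (intro sum.neutral) (auto simp: orthonormal_def)
  finally have er: "cinner e r = cinner e x" by simp
  have ne: "norm e = 1" using insert.prems by (auto simp: orthonormal_def)
  have "x - (\<Sum>e\<in>insert e F. cinner e x *\<^sub>C e) = r + (- cinner e x) *\<^sub>C e"
    using insert.hyps by (simp add: r_def scaleC_minus_left algebra_simps)
  also have "(norm \<dots>)\<^sup>2 = (norm r)\<^sup>2 + (cmod (cinner e x))\<^sup>2 + 2 * Re (- cinner e x * cinner r e)"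
    by (simp only: norm_add_sq norm_scaleC cinner_scaleC_right ne) simp
  also have "Re (- cinner e x * cinner r e) = - (cmod (cinner e x))\<^sup>2"
    using cinner_eq_norm_sq[of e r] by (simp add: er)
  also have "(norm r)\<^sup>2 = (norm x)\<^sup>2 - (\<Sum>e\<in>F. (cmod (cinner e x))\<^sup>2)"
    unfolding r_def using insert.IH F by blast
  finally show ?case using insert.hyps by simp
qed simp

lemma bessel:
  fixes x :: "'h::complex_hilbert_space"
  assumes "finite F" "orthonormal F"
  shows "(\<Sum>e\<in>F. (cmod (cinner e x))\<^sup>2) \<le> (norm x)\<^sup>2"
  using norm_diff_projection[OF assms, of x] by (smt (verit) zero_le_power2)

lemma cauchy_schwarz:
  fixes x y :: "'h::complex_hilbert_space"
  shows "cmod (cinner x y) \<le> norm x * norm y"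
proof (cases "x = 0")
  case False
  define e where "e = complex_of_real (inverse (norm x)) *\<^sub>C x"
  have "norm e = 1" using False by (simp add: e_def norm_scaleC norm_inverse)
  then have "orthonormal {e}" by (simp add: orthonormal_def)
  then have "(cmod (cinner e y))\<^sup>2 \<le> (norm y)\<^sup>2" using bessel[of "{e}" y] by simp
  then have "cmod (cinner e y) \<le> norm y" by (rule power2_le_imp_le) simp
  then show ?thesis
    using False by (simp add: e_def cinner_scaleC_left norm_mult norm_inverse norm_divide field_simps)
qed simp

lemma cinner_eqI:
  fixes v w :: "'h::complex_hilbert_space"
  assumes "\<And>x. cinner x v = cinner x w"
  shows "v = w"
proof -
  have "cinner (v - w) (v - w) = 0" using assms by (simp add: cinner_diff_right)
  then show ?thesis by (simp add: cinner_norm)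
qed

text \<open>The representing vector is the minimum of the strictly convex functional
  \<open>J x = \<parallel>x\<parallel>\<^sup>2 - 2 Re (f x)\<close>: by the parallelogram law, minimizing sequences are Cauchy, and the
  first variation of \<open>J\<close> at the minimum vanishes.\<close>

lemma riesz_representation:
  fixes f :: "'h::complex_hilbert_space \<Rightarrow> complex"
  assumes lin: "clinear_on UNIV f" and bnd: "\<And>x. cmod (f x) \<le> C * norm x"
  shows "\<exists>v. \<forall>x. f x = cinner v x"
proof -
  note f_add = clinear_onD(1)[OF lin] and f_scaleC = clinear_onD(2)[OF lin, simplified scaleC_complex_def]
  define J where "J x = (norm x)\<^sup>2 - 2 * Re (f x)" for x
  have below: "J x \<ge> - C\<^sup>2" for x
  proof -
    have "Re (f x) \<le> C * norm x" using bnd[of x] complex_Re_le_cmod[of "f x"] by linarith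
    moreover have "0 \<le> (norm x - C)\<^sup>2" by simp
    ultimately show ?thesis by (simp add: J_def power2_diff algebra_simps)
  qed
  have bdd: "bdd_below (range J)" using below by (auto simp: bdd_below_def)
  define j where "j = Inf (range J)"
  have j_le: "j \<le> J x" for x unfolding j_def by (rule cInf_lower) (use bdd in auto)
  have "\<exists>x. J x < j + inverse (real (Suc n))" for n
  proof -
    have "Inf (range J) < j + inverse (real (Suc n))" by (simp add: j_def)
    then show ?thesis using cInf_lessD[of "range J"] by blast
  qed
  then obtain s where s: "\<And>n. J (s n) < j + inverse (real (Suc n))" by metis
  have half: "f ((1/2) *\<^sub>C x) = f x / 2" for x by (simp add: f_scaleC)
  have mid: "(norm (x - y))\<^sup>2 \<le> 2 * (J x - j) + 2 * (J y - j)" for x y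
  proof -
    have "(norm ((1/2) *\<^sub>C (x + y)))\<^sup>2 = (norm (x + y))\<^sup>2 / 4"
      by (simp add: norm_scaleC power2_eq_square norm_divide)
    then have "J ((1/2) *\<^sub>C (x + y)) = (norm (x + y))\<^sup>2 / 4 - Re (f x) - Re (f y)"
      by (simp add: J_def half f_add add_divide_distrib)
    moreover have "(norm (x - y))\<^sup>2 = (norm x)\<^sup>2 + (norm y)\<^sup>2 - 2 * Re (cinner x y)"
      using norm_add_sq[of x "(-1) *\<^sub>C y"] by (simp add: cinner_scaleC_right[of x "-1" y, unfolded scaleC_minus_one] scaleC_minus_one)
    ultimately show ?thesis
      using j_le[of "(1/2) *\<^sub>C (x + y)"] norm_add_sq[of x y] unfolding J_def by argo
  qed
  have "Cauchy s"
  proof (rule metric_CauchyI)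
    fix e :: real assume e: "0 < e"
    obtain M where M: "inverse (real (Suc M)) < e\<^sup>2 / 4"
      using reals_Archimedean[of "e\<^sup>2/4"] e by auto
    have "dist (s m) (s n) < e" if "m \<ge> M" "n \<ge> M" for m n
    proof -
      have "inverse (real (Suc m)) \<le> inverse (real (Suc M))" "inverse (real (Suc n)) \<le> inverse (real (Suc M))"
        using that by (auto intro!: le_imp_inverse_le)
      then have "J (s m) - j < e\<^sup>2 / 4" "J (s n) - j < e\<^sup>2 / 4" using s[of m] s[of n] M by argo+
      then have "(norm (s m - s n))\<^sup>2 < e\<^sup>2" using mid[of "s m" "s n"] by argo
      then show ?thesis unfolding dist_norm using e by (intro power2_less_imp_less[of _ e]) auto
    qed
    then show "\<exists>M. \<forall>m\<ge>M. \<forall>n\<ge>M. dist (s m) (s n) < e" by blast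
  qed
  then obtain v where v: "s \<longlonglongrightarrow> v" using Cauchy_convergent convergent_def by blast
  have bl: "bounded_linear f"
    by (rule bounded_linear_intro[where K = C])
      (use f_add bnd in \<open>auto simp: scaleR_scaleC f_scaleC scaleC_complex_def mult.commute\<close>)
  have "(\<lambda>n. J (s n)) \<longlonglongrightarrow> J v"
    unfolding J_def by (intro tendsto_intros v bounded_linear.tendsto[OF bl])
  moreover have "(\<lambda>n. j + inverse (real (Suc n))) \<longlonglongrightarrow> j + 0"
    by (intro tendsto_intros LIMSEQ_inverse_real_of_nat)
  ultimately have "J v \<le> j + 0" using s by (intro LIMSEQ_le) (auto intro: less_imp_le)
  then have min: "J v \<le> J x" for x using j_le[of x] by simp
  have Re_eq: "Re (cinner v x) = Re (f x)" for x
  proof (rule ccontr)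
    define d where "d = Re (cinner v x) - Re (f x)"
    assume "Re (cinner v x) \<noteq> Re (f x)"
    then have d: "d \<noteq> 0" by (simp add: d_def)
    have quad: "0 \<le> t\<^sup>2 * (norm x)\<^sup>2 + 2 * t * d" for t :: real
      using min[of "v + complex_of_real t *\<^sub>C x"]
      by (simp add: J_def norm_add_sq norm_scaleC f_add f_scaleC cinner_scaleC_right d_def
          power_mult_distrib algebra_simps)
    \<comment> \<open>Near the minimum over \<open>t\<close> of the quadratic; the summand 1 avoids a division by zero.\<close>
    define t where "t = - d / ((norm x)\<^sup>2 + 1)"
    have p: "0 < (norm x)\<^sup>2 + 1" by (smt (verit) zero_le_power2)
    have "t\<^sup>2 * (norm x)\<^sup>2 \<le> t\<^sup>2 * ((norm x)\<^sup>2 + 1)" by (simp add: algebra_simps)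
    also have "\<dots> = - t * d" using p by (simp add: t_def power2_eq_square)
    finally have "0 \<le> t * d" using quad[of t] by simp
    moreover have "t * d < 0" using p d by (simp add: t_def divide_less_0_iff mult_less_0_iff flip: power2_eq_square)
    ultimately show False by simp
  qed
  have "f x = cinner v x" for x
    using Re_eq[of x] Re_eq[of "\<i> *\<^sub>C x"] by (simp add: complex_eq_iff f_scaleC cinner_scaleC_right)
  then show ?thesis by blast
qed

text \<open>Operators are only ever constructed through their matrix coefficients; this is how both adjoints
  and operator-valued integrals come into being.\<close>

lemma sesquilinear_form_operator:
  fixes B :: "'h::complex_hilbert_space \<Rightarrow> 'h \<Rightarrow> complex"
  assumes right: "\<And>x. clinear_on UNIV (B x)"
    and left: "\<And>y. clinear_on UNIV (\<lambda>x. cnj (B x y))"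
    and bnd: "\<And>x y. cmod (B x y) \<le> C * norm x * norm y" and C: "0 \<le> C"
  shows "\<exists>T. (\<forall>x y. cinner x (bop_apply T y) = B x y) \<and> norm T \<le> C"
proof -
  have "\<exists>v. \<forall>x. cnj (B x y) = cinner v x" for y
    by (rule riesz_representation[where C = "C * norm y"])
      (use left bnd in \<open>auto simp: mult_ac\<close>)
  then obtain g where "\<And>x y. cnj (B x y) = cinner (g y) x" by metis
  then have g: "cinner x (g y) = B x y" for x y
    by (metis cinner_commute complex_cnj_cnj)
  have add: "g (x + y) = g x + g y" for x y
    by (rule cinner_eqI) (simp add: g cinner_add_right clinear_onD(1)[OF right])
  have scale: "g (c *\<^sub>C x) = c *\<^sub>C g x" for c x
    by (rule cinner_eqI) (simp add: g cinner_scaleC_right clinear_onD(2)[OF right] scaleC_complex_def)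
  have norm: "norm (g y) \<le> C * norm y" for y
  proof (cases "g y = 0")
    case False
    have "norm (g y) * norm (g y) = cmod (cinner (g y) (g y))"
      by (simp add: cinner_norm power2_eq_square norm_mult)
    also have "\<dots> \<le> (C * norm y) * norm (g y)" using bnd[of "g y" y] by (simp add: g mult_ac)
    finally show ?thesis using False by simp
  qed (use C in auto)
  have bl: "bounded_linear g"
    by (rule bounded_linear_intro[where K = C])
      (use norm in \<open>auto simp: add scale scaleR_scaleC mult.commute\<close>)
  define T where "T = Bop (Blinfun g)"
  have "bop_apply T y = g y" for y
    unfolding T_def bop_apply_def using bl add scale
    by (simp add: Bop_inverse clinear_on_def bounded_linear_Blinfun_apply)
  then show ?thesis using g norm C by (intro exI[of _ T]) (auto intro!: norm_bop_bound)
qed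

definition bop_adjoint :: "'h::complex_hilbert_space bop \<Rightarrow> 'h bop"
  where "bop_adjoint T = (SOME T'. \<forall>x y. cinner x (bop_apply T' y) = cinner (bop_apply T x) y)"

lemma cinner_bop_adjoint:
  "cinner x (bop_apply (bop_adjoint T) y) = cinner (bop_apply T x) y"
proof -
  have "\<exists>T'. (\<forall>x y. cinner x (bop_apply T' y) = cinner (bop_apply T x) y) \<and> norm T' \<le> norm T"
  proof (rule sesquilinear_form_operator)
    fix x y
    have "cmod (cinner (bop_apply T x) y) \<le> norm (bop_apply T x) * norm y" by (rule cauchy_schwarz)
    also have "\<dots> \<le> norm T * norm x * norm y" by (intro mult_right_mono norm_bop_apply) auto
    finally show "cmod (cinner (bop_apply T x) y) \<le> norm T * norm x * norm y" .
  qed (auto simp: clinear_on_def cinner_add_right cinner_scaleC_right scaleC_complex_def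
      cinner_add_left cinner_scaleC_left bop_apply_simps)
  then have "\<exists>T'. \<forall>x y. cinner x (bop_apply T' y) = cinner (bop_apply T x) y" by blast
  then show ?thesis unfolding bop_adjoint_def by (rule someI2_ex) blast
qed

lemma cinner_bop_adjoint_left:
  "cinner (bop_apply (bop_adjoint T) x) y = cinner x (bop_apply T y)"
  using cinner_bop_adjoint[of y T x] by (metis cinner_commute)

lemma bop_adjoint_adjoint: "bop_adjoint (bop_adjoint T) = T"
  by (rule bop_eqI, rule cinner_eqI) (simp add: cinner_bop_adjoint cinner_bop_adjoint_left)

lemma is_onb_orthonormal: "is_onb E \<Longrightarrow> orthonormal E"
  by (auto simp: is_onb_def orthonormal_def)

text \<open>For vectors of the algebraic span the Fourier expansion is finite; density of the span will do the
  rest.\<close>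

lemma cspan_projection:
  assumes E: "orthonormal E" and w: "w \<in> cspan E"
  shows "\<exists>F. finite F \<and> F \<subseteq> E \<and> (\<forall>G. finite G \<longrightarrow> F \<subseteq> G \<longrightarrow> G \<subseteq> E \<longrightarrow> w = (\<Sum>e\<in>G. cinner e w *\<^sub>C e))"
proof -
  define V where "V = {w. \<exists>F. finite F \<and> F \<subseteq> E \<and>
    (\<forall>G. finite G \<longrightarrow> F \<subseteq> G \<longrightarrow> G \<subseteq> E \<longrightarrow> w = (\<Sum>e\<in>G. cinner e w *\<^sub>C e))}"
  have "csubspace V"
    unfolding csubspace_def
  proof (intro conjI ballI allI)
    show "0 \<in> V" unfolding V_def by (auto intro!: exI[of _ "{}"])
  next
    fix v w assume "v \<in> V" "w \<in> V"
    then obtain F F' where F: "finite F" "F \<subseteq> E" "\<And>G. finite G \<Longrightarrow> F \<subseteq> G \<Longrightarrow> G \<subseteq> E \<Longrightarrow> v = (\<Sum>e\<in>G. cinner e v *\<^sub>C e)"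
      and F': "finite F'" "F' \<subseteq> E" "\<And>G. finite G \<Longrightarrow> F' \<subseteq> G \<Longrightarrow> G \<subseteq> E \<Longrightarrow> w = (\<Sum>e\<in>G. cinner e w *\<^sub>C e)"
      unfolding V_def by blast
    have "v + w = (\<Sum>e\<in>G. cinner e (v + w) *\<^sub>C e)" if "finite G" "F \<union> F' \<subseteq> G" "G \<subseteq> E" for G
      using F(3)[of G] F'(3)[of G] that by (simp add: cinner_add_right scaleC_add_left sum.distrib)
    then show "v + w \<in> V" unfolding V_def using F(1,2) F'(1,2) by (auto intro!: exI[of _ "F \<union> F'"])
  next
    fix c w assume "w \<in> V"
    then obtain F where F: "finite F" "F \<subseteq> E" "\<And>G. finite G \<Longrightarrow> F \<subseteq> G \<Longrightarrow> G \<subseteq> E \<Longrightarrow> w = (\<Sum>e\<in>G. cinner e w *\<^sub>C e)"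
      unfolding V_def by blast
    have "c *\<^sub>C w = (\<Sum>e\<in>G. cinner e (c *\<^sub>C w) *\<^sub>C e)" if "finite G" "F \<subseteq> G" "G \<subseteq> E" for G
    proof -
      have "c *\<^sub>C w = c *\<^sub>C (\<Sum>e\<in>G. cinner e w *\<^sub>C e)" by (rule arg_cong[OF F(3)[OF that]])
      also have "\<dots> = (\<Sum>e\<in>G. cinner e (c *\<^sub>C w) *\<^sub>C e)"
        by (simp only: cinner_scaleC_right scaleC_sum_right scaleC_scaleC)
      finally show ?thesis .
    qed
    then show "c *\<^sub>C w \<in> V" unfolding V_def using F(1,2) by (auto intro!: exI[of _ F])
  qed
  moreover have "E \<subseteq> V"
  proof
    fix e assume e: "e \<in> E"
    have "e = (\<Sum>f\<in>G. cinner f e *\<^sub>C f)" if "finite G" "{e} \<subseteq> G" "G \<subseteq> E" for G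
    proof -
      have "(\<Sum>f\<in>G. cinner f e *\<^sub>C f) = (\<Sum>f\<in>G. if f = e then e else 0)"
        using that e by (intro sum.cong) (auto simp: orthonormal_cinner[OF E])
      also have "\<dots> = e" using that by simp
      finally show ?thesis by simp
    qed
    then show "e \<in> V" unfolding V_def using e by (auto intro!: exI[of _ "{e}"])
  qed
  ultimately show ?thesis using cspan_minimal[of E V] w unfolding V_def by blast
qed

text \<open>Partial Fourier sums are best approximations, so once they reproduce a vector of the span near
  \<open>x\<close> they are at least as near to \<open>x\<close>.\<close>

lemma parseval:
  assumes E: "is_onb E"
  shows "((\<lambda>e. (cmod (cinner e x))\<^sup>2) has_sum (norm x)\<^sup>2) E"
  unfolding has_sum_def tendsto_iff eventually_finite_subsets_at_top
proof (intro allI impI)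
  fix d :: real assume d: "0 < d"
  note on = is_onb_orthonormal[OF E]
  have "x \<in> closure (cspan E)" using E by (simp add: is_onb_def)
  then obtain w where w: "w \<in> cspan E" "dist w x < sqrt d"
    using closure_approachable[of x "cspan E"] d by (meson real_sqrt_gt_zero)
  obtain F where F: "finite F" "F \<subseteq> E"
    "\<And>G. finite G \<Longrightarrow> F \<subseteq> G \<Longrightarrow> G \<subseteq> E \<Longrightarrow> w = (\<Sum>e\<in>G. cinner e w *\<^sub>C e)"
    using cspan_projection[OF on w(1)] by blast
  have "dist (\<Sum>e\<in>G. (cmod (cinner e x))\<^sup>2) ((norm x)\<^sup>2) < d" if G: "finite G" "F \<subseteq> G" "G \<subseteq> E" for G
  proof -
    have onG: "orthonormal G" using on G(3) by (rule orthonormal_subset)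
    have "x - w - (\<Sum>e\<in>G. cinner e (x - w) *\<^sub>C e) = x - (\<Sum>e\<in>G. cinner e x *\<^sub>C e)"
      using F(3)[OF G] by (simp add: cinner_diff_right scaleC_diff_left sum_subtractf)
    then have "(norm (x - (\<Sum>e\<in>G. cinner e x *\<^sub>C e)))\<^sup>2 \<le> (norm (x - w))\<^sup>2"
      using norm_diff_projection[OF G(1) onG, of "x - w"] by (simp only: ) (simp add: sum_nonneg)
    also have "\<dots> < (sqrt d)\<^sup>2"
      using w(2) by (intro power_strict_mono) (auto simp: dist_norm norm_minus_commute)
    finally have "(norm x)\<^sup>2 - (\<Sum>e\<in>G. (cmod (cinner e x))\<^sup>2) < d"
      using d norm_diff_projection[OF G(1) onG, of x] by simp
    then show ?thesis using bessel[OF G(1) onG, of x] by (simp add: dist_real_def)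
  qed
  then show "\<exists>X. finite X \<and> X \<subseteq> E \<and> (\<forall>Y. finite Y \<and> X \<subseteq> Y \<and> Y \<subseteq> E \<longrightarrow>
      dist (\<Sum>e\<in>Y. (cmod (cinner e x))\<^sup>2) ((norm x)\<^sup>2) < d)"
    using F(1,2) by blast
qed

section \<open>The Banach algebra of bounded operators\<close>

instance complex_hilbert_space \<subseteq> banach ..

text \<open>A norm limit of complex linear operators is complex linear, because it is a pointwise limit.\<close>

instance bop :: (complex_hilbert_space) complete_space
proof
  fix X :: "nat \<Rightarrow> 'a bop" assume "Cauchy X"
  then have C: "Cauchy (\<lambda>n. blinfun_of_bop (X n))"
    unfolding Cauchy_def dist_bop.rep_eq .
  then obtain L where L: "(\<lambda>n. blinfun_of_bop (X n)) \<longlonglongrightarrow> L"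
    using Cauchy_convergent[OF C] unfolding convergent_def by (elim exE)
  have lim: "(\<lambda>n. bop_apply (X n) x) \<longlonglongrightarrow> blinfun_apply L x" for x
    unfolding bop_apply.rep_eq by (intro tendsto_intros L)
  have "clinear_on UNIV (blinfun_apply L)"
    unfolding clinear_on_def
  proof (intro conjI ballI allI)
    fix c x
    have "(\<lambda>n. bop_apply (X n) (c *\<^sub>C x)) \<longlonglongrightarrow> c *\<^sub>C blinfun_apply L x"
      unfolding bop_apply_simps by (rule bounded_linear.tendsto[OF bounded_linear_scaleC lim])
    then show "blinfun_apply L (c *\<^sub>C x) = c *\<^sub>C blinfun_apply L x"
      using lim[of "c *\<^sub>C x"] LIMSEQ_unique by blast
  qed (simp add: blinfun.bilinear_simps)
  then have "blinfun_of_bop (Bop L) = L" by (simp add: Bop_inverse)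
  then have "X \<longlonglongrightarrow> Bop L"
    using L unfolding tendsto_iff dist_bop.rep_eq by simp
  then show "convergent X" by (auto simp: convergent_def)
qed

instance bop :: (complex_hilbert_space) banach ..

lemma norm_one_bop_le: "norm (1::'h::complex_normed_vector bop) \<le> 1"
  by (rule norm_bop_bound) (auto simp: bop_apply_simps)

text \<open>The inverse is the Neumann series \<open>\<Sum>n. (1 - S) ^ n\<close>.\<close>

lemma neumann_inverse:
  fixes S :: "'h::complex_hilbert_space bop"
  assumes "norm (S - 1) < 1"
  shows "\<exists>R. S * R = 1 \<and> R * S = 1"
proof -
  define T where "T = 1 - S"
  have T: "norm T < 1" using assms by (simp add: T_def norm_minus_commute)
  have pow: "norm (T ^ n) \<le> norm T ^ n" for n
  proof (induction n)
    case (Suc n)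
    then show ?case using norm_mult_ineq[of T "T ^ n"] mult_left_mono[OF Suc, of "norm T"] by simp
  qed (simp add: norm_one_bop_le)
  have "summable (\<lambda>n. T ^ n)"
    by (rule summable_comparison_test[OF _ summable_geometric[of "norm T"]]) (use pow T in auto)
  then have "(\<lambda>n. T ^ n) sums (suminf (\<lambda>n. T ^ n))" (is "_ sums ?R") by (rule summable_sums)
  then have lim: "(\<lambda>n. \<Sum>k<n. T ^ k) \<longlonglongrightarrow> ?R" by (simp add: sums_def)
  have "(\<lambda>n. norm T ^ n) \<longlonglongrightarrow> 0" by (rule LIMSEQ_power_zero) (use T in auto)
  then have "(\<lambda>n. T ^ n) \<longlonglongrightarrow> 0" by (rule Lim_null_comparison[rotated]) (use pow in auto)
  then have one: "(\<lambda>n. 1 - T ^ n) \<longlonglongrightarrow> 1" using tendsto_diff[OF tendsto_const[of 1]] by fastforce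
  have S: "S = 1 - T" by (simp add: T_def)
  have "S * (\<Sum>k<n. T ^ k) = 1 - T ^ n" for n
    by (induction n) (simp_all add: S distrib_left left_diff_distrib)
  moreover have "(\<Sum>k<n. T ^ k) * S = 1 - T ^ n" for n
  proof (induction n)
    case (Suc n)
    have "T ^ n * S = T ^ n - T ^ Suc n" by (simp add: S right_diff_distrib power_commutes)
    then show ?case using Suc by (simp add: distrib_right)
  qed simp
  ultimately have "(\<lambda>n. 1 - T ^ n) \<longlonglongrightarrow> S * ?R" "(\<lambda>n. 1 - T ^ n) \<longlonglongrightarrow> ?R * S"
    using tendsto_mult_left[OF lim, of S] tendsto_mult_right[OF lim, of S] by simp_all
  then have "S * ?R = 1" "?R * S = 1" using one LIMSEQ_unique by blast+
  then show ?thesis by blast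
qed

section \<open>Trace functionals and weak-star closed subspaces\<close>

lemma has_sum_finite_sum:
  fixes f :: "'i \<Rightarrow> 'a \<Rightarrow> real"
  assumes "\<And>i. i \<in> I \<Longrightarrow> (f i has_sum s i) A"
  shows "((\<lambda>x. \<Sum>i\<in>I. f i x) has_sum (\<Sum>i\<in>I. s i)) A"
  using assms by (induction I rule: infinite_finite_induct) (auto intro: has_sum_add)

text \<open>Expand \<open>\<parallel>T* e\<parallel>\<^sup>2\<close> by Parseval in the basis \<open>E\<close>, exchange the two sums, and apply Bessel to
  \<open>G\<close>.  Used twice, this makes the Hilbert--Schmidt condition independent of the basis.\<close>

lemma hs_adjoint_bound:
  assumes E: "is_onb E" and sm: "(\<lambda>f. (norm (bop_apply T f))\<^sup>2) summable_on E"
    and G: "finite G" "orthonormal G"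
  shows "(\<Sum>e\<in>G. (norm (bop_apply (bop_adjoint T) e))\<^sup>2) \<le> (\<Sum>\<^sub>\<infinity>f\<in>E. (norm (bop_apply T f))\<^sup>2)"
proof -
  have "((\<lambda>f. (cmod (cinner f (bop_apply (bop_adjoint T) e)))\<^sup>2) has_sum
      (norm (bop_apply (bop_adjoint T) e))\<^sup>2) E" for e
    by (rule parseval[OF E])
  moreover have "cmod (cinner f (bop_apply (bop_adjoint T) e)) = cmod (cinner e (bop_apply T f))" for e f
    by (metis cinner_bop_adjoint cinner_commute complex_mod_cnj)
  ultimately have "((\<lambda>f. (cmod (cinner e (bop_apply T f)))\<^sup>2) has_sum
      (norm (bop_apply (bop_adjoint T) e))\<^sup>2) E" for e by simp
  then have "((\<lambda>f. \<Sum>e\<in>G. (cmod (cinner e (bop_apply T f)))\<^sup>2) has_sum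
      (\<Sum>e\<in>G. (norm (bop_apply (bop_adjoint T) e))\<^sup>2)) E"
    by (intro has_sum_finite_sum)
  moreover have "((\<lambda>f. (norm (bop_apply T f))\<^sup>2) has_sum (\<Sum>\<^sub>\<infinity>f\<in>E. (norm (bop_apply T f))\<^sup>2)) E"
    using sm by simp
  ultimately show ?thesis by (rule has_sum_mono) (rule bessel[OF G])
qed

lemma summable_on_nonneg_boundedI:
  fixes f :: "'a \<Rightarrow> real"
  assumes "\<And>x. x \<in> E \<Longrightarrow> 0 \<le> f x" "\<And>F. finite F \<Longrightarrow> F \<subseteq> E \<Longrightarrow> sum f F \<le> B"
  shows "f summable_on E"
  using assms by (intro nonneg_bdd_above_summable_on) (auto simp: bdd_above_def)

lemma hilbert_schmidt_any_basis:
  assumes "hilbert_schmidt T" and E: "is_onb E"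
  shows "(\<lambda>e. (norm (bop_apply T e))\<^sup>2) summable_on E"
proof -
  obtain E' where E': "is_onb E'" and sm: "(\<lambda>e. (norm (bop_apply T e))\<^sup>2) summable_on E'"
    using assms(1) by (auto simp: hilbert_schmidt_def)
  have "(\<lambda>e. (norm (bop_apply (bop_adjoint T) e))\<^sup>2) summable_on E'"
    by (rule summable_on_nonneg_boundedI, simp, rule hs_adjoint_bound[OF E' sm])
      (auto intro: orthonormal_subset[OF is_onb_orthonormal[OF E']])
  from hs_adjoint_bound[OF E' this] show ?thesis
    unfolding bop_adjoint_adjoint
    by (intro summable_on_nonneg_boundedI)
      (auto intro: orthonormal_subset[OF is_onb_orthonormal[OF E]])
qed

lemma summable_on_nonneg_tail:
  fixes f :: "'a \<Rightarrow> real"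
  assumes sm: "f summable_on E" and nn: "\<And>x. x \<in> E \<Longrightarrow> 0 \<le> f x" and d: "0 < d"
  shows "\<exists>F. finite F \<and> F \<subseteq> E \<and> (\<forall>G. finite G \<longrightarrow> G \<subseteq> E - F \<longrightarrow> sum f G < d)"
proof -
  have "(f has_sum infsum f E) E" using sm by simp
  then have "\<forall>\<^sub>F F in finite_subsets_at_top E. dist (sum f F) (infsum f E) < d"
    using d unfolding has_sum_def tendsto_iff by blast
  then obtain F where F: "finite F" "F \<subseteq> E"
    and FG: "\<forall>G. finite G \<and> F \<subseteq> G \<and> G \<subseteq> E \<longrightarrow> dist (sum f G) (infsum f E) < d"
    unfolding eventually_finite_subsets_at_top by (elim exE conjE)
  have "sum f G < d" if G: "finite G" "G \<subseteq> E - F" for G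
  proof -
    have "sum f (F \<union> G) \<le> infsum f E"
      using F G by (intro finite_sum_le_infsum sm nn) auto
    moreover have "sum f (F \<union> G) = sum f F + sum f G"
      using F G by (intro sum.union_disjoint) auto
    moreover have "infsum f E - sum f F < d"
      using FG F by (auto simp: dist_real_def)
    ultimately show ?thesis by linarith
  qed
  then show ?thesis using F(1,2) by blast
qed

lemma cauchy_schwarz_sum:
  assumes "finite G"
  shows "(\<Sum>e\<in>G. cmod (cinner (f e) (g e :: 'h::complex_hilbert_space)))
    \<le> sqrt (\<Sum>e\<in>G. (norm (f e))\<^sup>2) * sqrt (\<Sum>e\<in>G. (norm (g e))\<^sup>2)"
proof -
  have "(\<Sum>e\<in>G. cmod (cinner (f e) (g e))) \<le> (\<Sum>e\<in>G. \<bar>norm (f e)\<bar> * \<bar>norm (g e)\<bar>)"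
    by (intro sum_mono) (simp add: cauchy_schwarz)
  also have "\<dots> \<le> L2_set (\<lambda>e. norm (f e)) G * L2_set (\<lambda>e. norm (g e)) G"
    by (rule L2_set_mult_ineq)
  finally show ?thesis by (simp add: L2_set_def)
qed

text \<open>Write \<open>T = R S\<close> with Hilbert--Schmidt factors.  Then \<open>\<langle>e, X R S e\<rangle> = \<langle>(X R)* e, S e\<rangle>\<close>, and by
  Cauchy--Schwarz the tail of the trace is controlled by the tail of \<open>\<Sum>e. \<parallel>S e\<parallel>\<^sup>2\<close>, which does not
  involve \<open>X\<close>.  The uniformity in \<open>X\<close> is what later allows a trace to be exchanged with a virtual
  diagonal.\<close>

lemma trace_uniform_tail:
  assumes T: "trace_class T" and E: "is_onb E" and d: "0 < d"
  shows "\<exists>F. finite F \<and> F \<subseteq> E \<and> (\<forall>X G. finite G \<longrightarrow> G \<subseteq> E - F \<longrightarrow>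
    (\<Sum>e\<in>G. cmod (cinner e (bop_apply (X * T) e))) \<le> d * norm X)"
proof -
  obtain R S where R: "hilbert_schmidt R" and S: "hilbert_schmidt S" and TRS: "T = R * S"
    using T by (auto simp: trace_class_def)
  have smR: "(\<lambda>e. (norm (bop_apply R e))\<^sup>2) summable_on E" by (rule hilbert_schmidt_any_basis[OF R E])
  have smS: "(\<lambda>e. (norm (bop_apply S e))\<^sup>2) summable_on E" by (rule hilbert_schmidt_any_basis[OF S E])
  define K where "K = (\<Sum>\<^sub>\<infinity>e\<in>E. (norm (bop_apply R e))\<^sup>2)"
  have K: "0 \<le> K" unfolding K_def by (rule infsum_nonneg) simp
  \<comment> \<open>Dividing by \<open>K + 1\<close> instead of \<open>K\<close> covers the case \<open>R = 0\<close>.\<close>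
  have "0 < d\<^sup>2 / (K + 1)" using d K by simp
  from summable_on_nonneg_tail[OF smS _ this] obtain F where F: "finite F" "F \<subseteq> E"
    "\<And>G. finite G \<Longrightarrow> G \<subseteq> E - F \<Longrightarrow> (\<Sum>e\<in>G. (norm (bop_apply S e))\<^sup>2) < d\<^sup>2 / (K + 1)" by auto
  have "(\<Sum>e\<in>G. cmod (cinner e (bop_apply (X * T) e))) \<le> d * norm X"
    if G: "finite G" "G \<subseteq> E - F" for X G
  proof -
    have onG: "orthonormal G" using G is_onb_orthonormal[OF E] by (auto intro: orthonormal_subset)
    have XR: "(norm (bop_apply (X * R) e))\<^sup>2 \<le> (norm X)\<^sup>2 * (norm (bop_apply R e))\<^sup>2" for e
      unfolding power_mult_distrib[symmetric] bop_apply_simps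
      by (intro power_mono norm_bop_apply) auto
    have sm2: "(\<lambda>e. (norm X)\<^sup>2 * (norm (bop_apply R e))\<^sup>2) summable_on E"
      by (intro summable_on_cmult_right smR)
    have smXR: "(\<lambda>e. (norm (bop_apply (X * R) e))\<^sup>2) summable_on E"
      by (rule summable_on_comparison_test[OF sm2]) (use XR in auto)
    have "(\<Sum>e\<in>G. (norm (bop_apply (bop_adjoint (X * R)) e))\<^sup>2) \<le> (\<Sum>\<^sub>\<infinity>e\<in>E. (norm (bop_apply (X * R) e))\<^sup>2)"
      by (rule hs_adjoint_bound[OF E smXR G(1) onG])
    also have "\<dots> \<le> (\<Sum>\<^sub>\<infinity>e\<in>E. (norm X)\<^sup>2 * (norm (bop_apply R e))\<^sup>2)"
      by (intro infsum_mono smXR sm2 XR)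
    also have "\<dots> = (norm X)\<^sup>2 * K" unfolding K_def by (rule infsum_cmult_right')
    finally have 1: "(\<Sum>e\<in>G. (norm (bop_apply (bop_adjoint (X * R)) e))\<^sup>2) \<le> (norm X)\<^sup>2 * K" .
    have "(\<Sum>e\<in>G. cmod (cinner e (bop_apply (X * T) e)))
        = (\<Sum>e\<in>G. cmod (cinner (bop_apply (bop_adjoint (X * R)) e) (bop_apply S e)))"
      by (simp add: cinner_bop_adjoint_left TRS bop_apply_simps)
    also have "\<dots> \<le> sqrt (\<Sum>e\<in>G. (norm (bop_apply (bop_adjoint (X * R)) e))\<^sup>2)
        * sqrt (\<Sum>e\<in>G. (norm (bop_apply S e))\<^sup>2)"
      by (rule cauchy_schwarz_sum[OF G(1)])
    also have "\<dots> \<le> sqrt ((norm X)\<^sup>2 * K) * sqrt (d\<^sup>2 / (K + 1))"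
      using 1 F(3)[OF G] by (intro mult_mono) (auto simp: K sum_nonneg)
    also have "\<dots> = norm X * d * sqrt (K / (K + 1))"
      using d by (simp add: real_sqrt_mult real_sqrt_divide)
    also have "\<dots> \<le> norm X * d * 1"
      using d K by (intro mult_left_mono) (auto simp: divide_le_eq)
    finally show ?thesis by (simp add: mult.commute)
  qed
  then show ?thesis using F(1,2) by blast
qed

definition trace_basis :: "'h::complex_hilbert_space set"
  where "trace_basis = (SOME E. is_onb E)"

lemma trace_class_is_onb: "trace_class (T :: 'h::complex_hilbert_space bop) \<Longrightarrow> is_onb (trace_basis :: 'h set)"
  unfolding trace_basis_def trace_class_def hilbert_schmidt_def using someI_ex[of is_onb] by auto

lemma trace_class_has_sum:
  fixes T :: "'a::complex_hilbert_space bop"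
  assumes T: "trace_class T"
  shows "((\<lambda>e. cinner e (bop_apply (X * T) e)) has_sum op_trace (X * T)) trace_basis"
proof -
  let ?f = "\<lambda>e. cinner e (bop_apply (X * T) e)"
  obtain F where F: "finite F" "F \<subseteq> trace_basis"
    "\<And>G. finite G \<Longrightarrow> G \<subseteq> trace_basis - F \<Longrightarrow> (\<Sum>e\<in>G. cmod (?f e)) \<le> 1 * norm X"
    using trace_uniform_tail[OF T trace_class_is_onb[OF T], of 1] by auto
  have "(\<lambda>e. cmod (?f e)) summable_on trace_basis"
  proof (rule summable_on_nonneg_boundedI)
    fix G :: "'a set" assume G: "finite G" "G \<subseteq> trace_basis"
    have "(\<Sum>e\<in>G. cmod (?f e)) \<le> (\<Sum>e\<in>(G - F) \<union> F. cmod (?f e))"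
      using G F by (intro sum_mono2) auto
    also have "\<dots> = (\<Sum>e\<in>G - F. cmod (?f e)) + (\<Sum>e\<in>F. cmod (?f e))"
      using G F by (intro sum.union_disjoint) auto
    also have "\<dots> \<le> norm X + (\<Sum>e\<in>F. cmod (?f e))"
      using F(3)[of "G - F"] G by auto
    finally show "(\<Sum>e\<in>G. cmod (?f e)) \<le> norm X + (\<Sum>e\<in>F. cmod (?f e))" .
  qed simp
  then have "?f summable_on trace_basis" by (rule abs_summable_summable)
  then show ?thesis unfolding op_trace_def trace_basis_def[symmetric] by simp
qed

text \<open>A weak-star continuous functional is a norm limit of finite sums of matrix coefficients.\<close>

lemma trace_approximation:
  assumes T: "trace_class T" and d: "0 < d"
  shows "\<exists>F. finite F \<and> (\<forall>X. cmod (op_trace (X * T) - (\<Sum>e\<in>F. cinner e (bop_apply (X * T) e))) \<le> d * norm X)"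
proof -
  obtain F where F: "finite F" "F \<subseteq> trace_basis"
    "\<And>X G. finite G \<Longrightarrow> G \<subseteq> trace_basis - F \<Longrightarrow>
      (\<Sum>e\<in>G. cmod (cinner e (bop_apply (X * T) e))) \<le> d * norm X"
    using trace_uniform_tail[OF T trace_class_is_onb[OF T] d] by auto
  have "cmod (op_trace (X * T) - (\<Sum>e\<in>F. cinner e (bop_apply (X * T) e))) \<le> d * norm X" for X
  proof (rule tendsto_upperbound)
    let ?f = "\<lambda>e. cinner e (bop_apply (X * T) e)"
    show "((\<lambda>G. cmod (sum ?f G - sum ?f F)) \<longlongrightarrow> cmod (op_trace (X * T) - sum ?f F))
        (finite_subsets_at_top trace_basis)"
      using trace_class_has_sum[OF T, of X] unfolding has_sum_def by (intro tendsto_intros)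
    have "cmod (sum ?f G - sum ?f F) \<le> d * norm X" if G: "finite G" "F \<subseteq> G" "G \<subseteq> trace_basis" for G
    proof -
      have "sum ?f G - sum ?f F = sum ?f (G - F)" using G by (simp add: sum_diff)
      then show ?thesis using F(3)[of "G - F" X] sum_norm_le[of "G - F" ?f "\<lambda>e. cmod (?f e)"] G by force
    qed
    then show "\<forall>\<^sub>F G in finite_subsets_at_top trace_basis. cmod (sum ?f G - sum ?f F) \<le> d * norm X"
      unfolding eventually_finite_subsets_at_top using F(1,2) by blast
  qed simp
  then show ?thesis using F(1) by blast
qed

lemma op_trace_clinear:
  assumes T: "trace_class T"
  shows "clinear_on UNIV (\<lambda>X. op_trace (X * T))"
proof -
  note hs = trace_class_has_sum[OF T]
  have "op_trace ((X + Y) * T) = op_trace (X * T) + op_trace (Y * T)" for X Y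
    using has_sum_add[OF hs[of X] hs[of Y]] hs[of "X + Y"]
    by (intro has_sum_unique[where A = trace_basis]) (simp_all add: bop_apply_simps cinner_add_right)
  moreover have "op_trace ((c *\<^sub>C X) * T) = c * op_trace (X * T)" for c X
    using has_sum_cmult_right[OF hs[of X], of c] hs[of "c *\<^sub>C X"]
    by (intro has_sum_unique[where A = trace_basis]) (simp_all add: bop_apply_simps cinner_scaleC_right)
  ultimately show ?thesis by (auto simp: clinear_on_def scaleC_complex_def)
qed

lemma op_trace_bounded:
  assumes T: "trace_class T"
  shows "\<exists>C\<ge>0. \<forall>X. cmod (op_trace (X * T)) \<le> C * norm X"
proof -
  obtain F where F: "finite F"
    "\<And>X. cmod (op_trace (X * T) - (\<Sum>e\<in>F. cinner e (bop_apply (X * T) e))) \<le> 1 * norm X"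
    using trace_approximation[OF T, of 1] by auto
  define C where "C = 1 + (\<Sum>e\<in>F. norm e * norm (bop_apply T e))"
  have "cmod (op_trace (X * T)) \<le> C * norm X" for X
  proof -
    have "cmod (cinner e (bop_apply (X * T) e)) \<le> norm e * norm (bop_apply T e) * norm X" for e
    proof -
      have "cmod (cinner e (bop_apply (X * T) e)) \<le> norm e * norm (bop_apply X (bop_apply T e))"
        unfolding bop_apply_simps by (rule cauchy_schwarz)
      also have "\<dots> \<le> norm e * (norm X * norm (bop_apply T e))"
        by (intro mult_left_mono norm_bop_apply) auto
      finally show ?thesis by (simp add: mult_ac)
    qed
    then have "cmod (\<Sum>e\<in>F. cinner e (bop_apply (X * T) e)) \<le> (\<Sum>e\<in>F. norm e * norm (bop_apply T e) * norm X)"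
      by (intro sum_norm_le)
    then show ?thesis
      using F(2)[of X] norm_triangle_sub[of "op_trace (X * T)" "\<Sum>e\<in>F. cinner e (bop_apply (X * T) e)"]
      by (simp add: C_def distrib_right sum_distrib_right)
  qed
  moreover have "0 \<le> C" by (simp add: C_def sum_nonneg)
  ultimately show ?thesis by blast
qed

text \<open>Finite-dimensional separation, by elimination of one functional: if \<open>L j\<close> does not vanish on \<open>M\<close>,
  a vector \<open>Z\<close> of \<open>M\<close> with \<open>L j Z = 1\<close> takes care of the value at \<open>j\<close>, and the other values are
  corrected inside the kernel of \<open>L j\<close>.\<close>

lemma finite_interpolation:
  fixes L :: "'i \<Rightarrow> 'a::complex_vector \<Rightarrow> complex"
  assumes "finite I" and M: "csubspace M" and L: "\<And>i. i \<in> I \<Longrightarrow> clinear_on UNIV (L i)"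
    and rel: "\<And>a. (\<And>Y. Y \<in> M \<Longrightarrow> (\<Sum>i\<in>I. a i * L i Y) = 0) \<Longrightarrow> (\<Sum>i\<in>I. a i * c i) = 0"
  shows "\<exists>Y\<in>M. \<forall>i\<in>I. L i Y = c i"
  using assms
proof (induction I arbitrary: M c)
  case empty
  then show ?case by (auto simp: csubspace_def)
next
  case (insert j I)
  have L_add: "L i (x + y) = L i x + L i y" and L_scale: "L i (r *\<^sub>C x) = r * L i x"
    if "i \<in> insert j I" for i x y r
    using insert.prems(2)[OF that] by (auto simp: clinear_on_def scaleC_complex_def)
  show ?case
  proof (cases "\<forall>Y\<in>M. L j Y = 0")
    case True
    have cj: "c j = 0"
      using insert.prems(3)[of "\<lambda>i. if i = j then 1 else 0"] True insert.hyps
      by (simp add: if_distrib[of "\<lambda>a. a * _"] sum.delta cong: if_cong)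
    have "(\<Sum>i\<in>I. a i * c i) = 0" if a: "\<And>Y. Y \<in> M \<Longrightarrow> (\<Sum>i\<in>I. a i * L i Y) = 0" for a
      using insert.prems(3)[of a] True insert.hyps a cj by simp
    then show ?thesis
      using insert.IH[OF insert.prems(1), of c] insert.prems(2) True cj by auto
  next
    case False
    then obtain Z0 where Z0: "Z0 \<in> M" "L j Z0 \<noteq> 0" by blast
    define Z where "Z = inverse (L j Z0) *\<^sub>C Z0"
    have Z: "Z \<in> M" "L j Z = 1"
      using Z0 insert.prems(1) by (auto simp: Z_def L_scale csubspace_scaleC)
    define M' where "M' = {Y\<in>M. L j Y = 0}"
    have Lj0: "L j 0 = 0" using L_scale[of j 0 0] by simp
    have M': "csubspace M'"
      using insert.prems(1) L_add L_scale Lj0 by (auto simp: csubspace_def M'_def)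
    have "(\<Sum>i\<in>I. a i * (c i - c j * L i Z)) = 0"
      if a: "\<And>Y. Y \<in> M' \<Longrightarrow> (\<Sum>i\<in>I. a i * L i Y) = 0" for a
    proof -
      \<comment> \<open>A relation on the kernel of \<open>L j\<close> in \<open>M\<close> extends to \<open>M\<close> with \<open>- m\<close> as coefficient of \<open>L j\<close>.\<close>
      define m where "m = (\<Sum>i\<in>I. a i * L i Z)"
      define b where "b i = (if i = j then - m else a i)" for i
      have bsum: "(\<Sum>i\<in>insert j I. b i * g i) = (\<Sum>i\<in>I. a i * g i) - m * g j" for g
      proof -
        have "(\<Sum>i\<in>I. b i * g i) = (\<Sum>i\<in>I. a i * g i)"
          using insert.hyps by (intro sum.cong) (auto simp: b_def)
        then show ?thesis using insert.hyps by (simp add: b_def)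
      qed
      have "(\<Sum>i\<in>insert j I. b i * L i Y) = 0" if Y: "Y \<in> M" for Y
      proof -
        have "Y + (- L j Y) *\<^sub>C Z \<in> M'"
          using Y Z insert.prems(1)
          by (auto simp: M'_def L_add L_scale intro!: csubspace_add csubspace_scaleC)
        from a[OF this] have "(\<Sum>i\<in>I. a i * L i Y + (- L j Y) * (a i * L i Z)) = 0"
          by (simp add: L_add L_scale algebra_simps)
        then have "(\<Sum>i\<in>I. a i * L i Y) = L j Y * m"
          unfolding sum.distrib sum_distrib_left[symmetric] m_def[symmetric] by simp
        then show ?thesis by (simp add: bsum)
      qed
      from insert.prems(3)[OF this] have "(\<Sum>i\<in>I. a i * c i) = m * c j" by (simp add: bsum)
      then show ?thesis
        by (simp add: m_def sum_distrib_left sum_distrib_right right_diff_distrib sum_subtractf mult_ac)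
    qed
    from insert.IH[OF M' _ this] insert.prems(2)
    obtain Y where Y: "Y \<in> M'" "\<forall>i\<in>I. L i Y = c i - c j * L i Z" by blast
    have "Y + c j *\<^sub>C Z \<in> M" using Y Z insert.prems(1) by (auto simp: M'_def intro!: csubspace_add csubspace_scaleC)
    moreover have "\<forall>i\<in>insert j I. L i (Y + c j *\<^sub>C Z) = c i"
      using Y Z by (auto simp: L_add L_scale M'_def)
    ultimately show ?thesis by blast
  qed
qed

lemma generated_topology_finite_basis:
  assumes "openin (topology_generated_by S) V" "x \<in> V"
  shows "\<exists>F. finite F \<and> F \<subseteq> S \<and> x \<in> \<Inter>F \<and> \<Inter>F \<subseteq> V"
proof -
  have "generate_topology_on S V" using assms(1) by (simp add: openin_topology_generated_by_iff)
  then show ?thesis using assms(2)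
  proof (induction V)
    case (Int a b)
    then obtain F G where "finite F" "F \<subseteq> S" "x \<in> \<Inter>F" "\<Inter>F \<subseteq> a" "finite G" "G \<subseteq> S" "x \<in> \<Inter>G" "\<Inter>G \<subseteq> b"
      by (metis IntE)
    then show ?case by (intro exI[of _ "F \<union> G"]) auto
  next
    case (UN K)
    then obtain k where k: "k \<in> K" "x \<in> k" by auto
    from UN.IH[OF this] obtain F where "finite F" "F \<subseteq> S" "x \<in> \<Inter>F" "\<Inter>F \<subseteq> k" by (elim exE conjE)
    then show ?case using k(1) by (intro exI[of _ F]) auto
  next
    case (Basis s)
    then show ?case by (intro exI[of _ "{s}"]) auto
  qed simp
qed

text \<open>The Hahn--Banach criterion for weak-star closed subspaces.  A basic neighbourhood of \<open>X\<close> involves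
  finitely many trace functionals only, and interpolation produces a point of \<open>M\<close> at which they all
  agree with their values at \<open>X\<close>.\<close>

lemma wstar_closed_subspace_memI:
  fixes X :: "'a::complex_hilbert_space bop"
  assumes cl: "closedin wstar_topology M" and M: "csubspace M"
    and rel: "\<And>I a. finite I \<Longrightarrow> (\<And>T. T \<in> I \<Longrightarrow> trace_class T) \<Longrightarrow>
      (\<And>Y. Y \<in> M \<Longrightarrow> (\<Sum>T\<in>I. a T * op_trace (Y * T)) = 0) \<Longrightarrow> (\<Sum>T\<in>I. a T * op_trace (X * T)) = 0"
  shows "X \<in> M"
proof (rule ccontr)
  assume X: "X \<notin> M"
  let ?S = "{{X. op_trace (X * T) \<in> U} | T U. trace_class T \<and> open U} :: 'a bop set set"
  have "(0 :: 'a bop) \<in> topspace wstar_topology" using closedin_subset[OF cl] csubspace_0[OF M] by (rule subsetD)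
  then obtain V where "V \<in> ?S"
    unfolding wstar_topology_def topology_generated_by_topspace by (elim UnionE)
  then obtain T0 :: "'a bop" where "trace_class T0" by (simp only: mem_Collect_eq) (elim exE conjE)
  then have "{X. op_trace (X * T0) \<in> UNIV} \<in> ?S" using open_UNIV by blast
  then have "X \<in> topspace wstar_topology"
    unfolding wstar_topology_def topology_generated_by_topspace by (rule UnionI) simp
  then have "X \<in> topspace wstar_topology - M" using X by (rule DiffI)
  moreover have "openin (topology_generated_by ?S) (topspace wstar_topology - M)"
    using cl unfolding wstar_topology_def closedin_def by (elim conjE)
  ultimately have "\<exists>F. finite F \<and> F \<subseteq> ?S \<and> X \<in> \<Inter>F \<and> \<Inter>F \<subseteq> topspace wstar_topology - M"
    by (intro generated_topology_finite_basis)
  then obtain F where F: "finite F" "F \<subseteq> ?S" "X \<in> \<Inter>F" "\<Inter>F \<subseteq> topspace wstar_topology - M"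
    by (elim exE conjE)
  have "\<exists>T U. trace_class T \<and> V = {X. op_trace (X * T) \<in> U}" if "V \<in> F" for V
    using subsetD[OF F(2) that] by (simp only: mem_Collect_eq) (elim exE conjE, intro exI conjI)
  then obtain t U where tU: "\<And>V. V \<in> F \<Longrightarrow> trace_class (t V)" "\<And>V. V \<in> F \<Longrightarrow> V = {X. op_trace (X * t V) \<in> U V}"
    by metis
  have "\<exists>Y\<in>M. \<forall>T\<in>t ` F. op_trace (Y * T) = op_trace (X * T)"
  proof (rule finite_interpolation[OF _ M])
    show "clinear_on UNIV (\<lambda>X. op_trace (X * T))" if "T \<in> t ` F" for T
      using that tU(1) by (auto intro: op_trace_clinear)
    show "(\<Sum>T\<in>t ` F. a T * op_trace (X * T)) = 0"
      if "\<And>Y. Y \<in> M \<Longrightarrow> (\<Sum>T\<in>t ` F. a T * op_trace (Y * T)) = 0" for a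
      using F(1) tU(1) by (intro rel that) auto
  qed (use F(1) in simp)
  then obtain Y where Y: "Y \<in> M" "\<And>V. V \<in> F \<Longrightarrow> op_trace (Y * t V) = op_trace (X * t V)" by blast
  have "Y \<in> V" if V: "V \<in> F" for V
  proof -
    have "X \<in> V" using F(3) V by blast
    then have "op_trace (X * t V) \<in> U V" using tU(2)[OF V] by auto
    then have "op_trace (Y * t V) \<in> U V" using Y(2)[OF V] by simp
    then show ?thesis using tU(2)[OF V] by auto
  qed
  then show False using F(4) Y(1) by blast
qed

section \<open>The projective seminorm on the algebraic tensor product\<close>

lemma clinear_on_sum:
  assumes f: "clinear_on V f" and V: "csubspace V" and "\<And>i. i \<in> I \<Longrightarrow> x i \<in> V"
  shows "f (\<Sum>i\<in>I. x i) = (\<Sum>i\<in>I. f (x i))"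
  using assms(3)
  by (induction I rule: infinite_finite_induct)
    (auto simp: clinear_on_zero[OF f V] clinear_onD(1)[OF f] csubspace_sum[OF V])

text \<open>The bound is a parameter because the iteration below keeps track of constants.\<close>

definition bounded_clinear_on ::
    "'a::complex_normed_vector set \<Rightarrow> real \<Rightarrow> ('a \<Rightarrow> 'b::complex_normed_vector) \<Rightarrow> bool"
  where "bounded_clinear_on A K f \<longleftrightarrow> 0 \<le> K \<and> clinear_on A f \<and> (\<forall>x\<in>A. norm (f x) \<le> K * norm x)"

definition bounded_cbilinear_on ::
    "'a::complex_normed_vector set \<Rightarrow> real \<Rightarrow> ('a \<Rightarrow> 'a \<Rightarrow> 'b::complex_normed_vector) \<Rightarrow> bool"
  where "bounded_cbilinear_on A K \<beta> \<longleftrightarrow> 0 \<le> K \<and> (\<forall>x\<in>A. clinear_on A (\<beta> x)) \<and>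
    (\<forall>y\<in>A. clinear_on A (\<lambda>x. \<beta> x y)) \<and>
    (\<forall>x\<in>A. \<forall>y\<in>A. norm (\<beta> x y) \<le> K * (norm x * norm y))"

lemma free_extend_eq_sum:
  assumes "finite Z" "{z. f z \<noteq> 0} \<subseteq> Z"
  shows "free_extend g f = (\<Sum>z\<in>Z. f z *\<^sub>C g (fst z) (snd z))"
  unfolding free_extend_def using assms by (intro sum.mono_neutral_left) auto

lemma free_extend_elem_tensor [simp]: "free_extend g (elem_tensor x y) = g x y"
  by (subst free_extend_eq_sum[of "{(x, y)}"]) (auto simp: elem_tensor_def)

lemma free_tensors_subspace: "csubspace (free_tensors A)"
  unfolding csubspace_def
proof (intro conjI ballI allI)
  fix f g :: "'a \<times> 'a \<Rightarrow> complex" and c :: complex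
  assume f: "f \<in> free_tensors A"
  have "{z. (c *\<^sub>C f) z \<noteq> 0} \<subseteq> {z. f z \<noteq> 0}" by (auto simp: scaleC_fun_def scaleC_zero_right)
  then show "c *\<^sub>C f \<in> free_tensors A"
    using f finite_subset unfolding free_tensors_def by blast
  assume g: "g \<in> free_tensors A"
  have "{z. (f + g) z \<noteq> 0} \<subseteq> {z. f z \<noteq> 0} \<union> {z. g z \<noteq> 0}" by auto
  moreover have "finite ({z. f z \<noteq> 0} \<union> {z. g z \<noteq> 0})" "{z. f z \<noteq> 0} \<union> {z. g z \<noteq> 0} \<subseteq> A \<times> A"
    using f g by (auto simp: free_tensors_def)
  ultimately show "f + g \<in> free_tensors A"
    unfolding free_tensors_def mem_Collect_eq by (meson finite_subset order_trans)
qed (simp add: free_tensors_def)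

lemma elem_tensor_free [simp]: "x \<in> A \<Longrightarrow> y \<in> A \<Longrightarrow> elem_tensor x y \<in> free_tensors A"
  by (auto simp: free_tensors_def elem_tensor_def)

lemma free_extend_clinear: "clinear_on (free_tensors A) (free_extend g)"
  unfolding clinear_on_def
proof (intro conjI ballI allI)
  fix f h :: "'a \<times> 'a \<Rightarrow> complex" and c :: complex
  assume f: "f \<in> free_tensors A"
  then have fin: "finite {z. f z \<noteq> 0}" by (simp add: free_tensors_def)
  show "free_extend g (c *\<^sub>C f) = c *\<^sub>C free_extend g f"
    by (subst (1 2) free_extend_eq_sum[OF fin])
      (auto simp: scaleC_fun_def scaleC_complex_def scaleC_sum_right scaleC_scaleC)
  assume h: "h \<in> free_tensors A"
  have finh: "finite {z. h z \<noteq> 0}" using h by (simp add: free_tensors_def)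
  let ?Z = "{z. f z \<noteq> 0} \<union> {z. h z \<noteq> 0}"
  have Z: "finite ?Z" using fin finh by simp
  show "free_extend g (f + h) = free_extend g f + free_extend g h"
    by (subst (1 2 3) free_extend_eq_sum[OF Z]) (auto simp: scaleC_add_left sum.distrib)
qed

lemmas free_extend_add = clinear_onD(1)[OF free_extend_clinear]
lemmas free_extend_scaleC = clinear_onD(2)[OF free_extend_clinear]
lemmas free_extend_diff = clinear_on_diff[OF free_extend_clinear free_tensors_subspace]
lemmas free_extend_sum = clinear_on_sum[OF free_extend_clinear free_tensors_subspace]

lemma free_extend_in_subspace:
  assumes V: "csubspace V" and g: "\<And>x y. x \<in> A \<Longrightarrow> y \<in> A \<Longrightarrow> g x y \<in> V" and f: "f \<in> free_tensors A"
  shows "free_extend g f \<in> V"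
  unfolding free_extend_def using f
  by (intro csubspace_sum[OF V] csubspace_scaleC[OF V] g) (auto simp: free_tensors_def)

lemma free_extend_compose:
  assumes L: "clinear_on V L" and V: "csubspace V" and g: "\<And>x y. x \<in> A \<Longrightarrow> y \<in> A \<Longrightarrow> g x y \<in> V"
    and f: "f \<in> free_tensors A"
  shows "L (free_extend g f) = free_extend (\<lambda>x y. L (g x y)) f"
proof -
  have mem: "g (fst z) (snd z) \<in> V" if "f z \<noteq> 0" for z
    using f that by (intro g) (auto simp: free_tensors_def)
  have "L (free_extend g f) = (\<Sum>z | f z \<noteq> 0. L (f z *\<^sub>C g (fst z) (snd z)))"
    unfolding free_extend_def
    by (rule clinear_on_sum[OF L V]) (use mem in \<open>auto intro: csubspace_scaleC[OF V]\<close>)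
  also have "\<dots> = free_extend (\<lambda>x y. L (g x y)) f"
    unfolding free_extend_def
    by (intro sum.cong refl) (use mem in \<open>auto simp: clinear_onD(2)[OF L]\<close>)
  finally show ?thesis .
qed

lemma free_extend_cong:
  assumes "f \<in> free_tensors A" "\<And>x y. x \<in> A \<Longrightarrow> y \<in> A \<Longrightarrow> g x y = h x y"
  shows "free_extend g f = free_extend h f"
  unfolding free_extend_def using assms by (intro sum.cong) (auto simp: free_tensors_def)

lemma relations_subspace: "csubspace (tensor_relations A)"
  unfolding tensor_relations_def by (rule csubspace_cspan)

lemma tensor_relations_induct:
  assumes V: "csubspace V"
    and "\<And>x x' y. x \<in> A \<Longrightarrow> x' \<in> A \<Longrightarrow> y \<in> A \<Longrightarrow>
      elem_tensor (x + x') y - elem_tensor x y - elem_tensor x' y \<in> V"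
    and "\<And>x y y'. x \<in> A \<Longrightarrow> y \<in> A \<Longrightarrow> y' \<in> A \<Longrightarrow>
      elem_tensor x (y + y') - elem_tensor x y - elem_tensor x y' \<in> V"
    and "\<And>c x y. x \<in> A \<Longrightarrow> y \<in> A \<Longrightarrow> elem_tensor (c *\<^sub>C x) y - c *\<^sub>C elem_tensor x y \<in> V"
    and "\<And>c x y. x \<in> A \<Longrightarrow> y \<in> A \<Longrightarrow> elem_tensor x (c *\<^sub>C y) - c *\<^sub>C elem_tensor x y \<in> V"
  shows "tensor_relations A \<subseteq> V"
  unfolding tensor_relations_def by (rule cspan_minimal[OF _ V]) (use assms(2-) in auto)

lemma tensor_relationsI:
  shows "x \<in> A \<Longrightarrow> x' \<in> A \<Longrightarrow> y \<in> A \<Longrightarrow>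
      elem_tensor (x + x') y - elem_tensor x y - elem_tensor x' y \<in> tensor_relations A"
    and "x \<in> A \<Longrightarrow> y \<in> A \<Longrightarrow> y' \<in> A \<Longrightarrow>
      elem_tensor x (y + y') - elem_tensor x y - elem_tensor x y' \<in> tensor_relations A"
    and "x \<in> A \<Longrightarrow> y \<in> A \<Longrightarrow> elem_tensor (c *\<^sub>C x) y - c *\<^sub>C elem_tensor x y \<in> tensor_relations A"
    and "x \<in> A \<Longrightarrow> y \<in> A \<Longrightarrow> elem_tensor x (c *\<^sub>C y) - c *\<^sub>C elem_tensor x y \<in> tensor_relations A"
  unfolding tensor_relations_def by (rule subsetD[OF cspan_superset], blast)+


text \<open>This is what makes the linear extension of a bilinear map well defined on the tensor product.\<close>

lemma relations_subset_vanishing: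
  assumes A: "csubspace A" and \<beta>: "bounded_cbilinear_on A K \<beta>"
  shows "tensor_relations A \<subseteq> {r \<in> free_tensors A. free_extend \<beta> r = 0}"
proof (rule tensor_relations_induct)
  note ft = free_tensors_subspace[of A]
  show "csubspace {r \<in> free_tensors A. free_extend \<beta> r = 0}"
    using ft clinear_on_zero[OF free_extend_clinear ft, of \<beta>]
    by (auto simp: csubspace_def free_extend_add free_extend_scaleC scaleC_zero_right)
  note cl = csubspace_add[OF A] csubspace_scaleC[OF A] csubspace_diff[OF ft] csubspace_scaleC[OF ft]
  have lin: "\<And>x. x \<in> A \<Longrightarrow> clinear_on A (\<beta> x)" "\<And>y. y \<in> A \<Longrightarrow> clinear_on A (\<lambda>x. \<beta> x y)"
    using \<beta> by (auto simp: bounded_cbilinear_on_def)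
  fix x x' y y' c
  note [simp] = cl free_extend_diff[where A = A] free_extend_scaleC[where A = A]
  show "x \<in> A \<Longrightarrow> x' \<in> A \<Longrightarrow> y \<in> A \<Longrightarrow> elem_tensor (x + x') y - elem_tensor x y - elem_tensor x' y
      \<in> {r \<in> free_tensors A. free_extend \<beta> r = 0}"
    by (simp add: clinear_onD(1)[OF lin(2)])
  show "x \<in> A \<Longrightarrow> y \<in> A \<Longrightarrow> y' \<in> A \<Longrightarrow> elem_tensor x (y + y') - elem_tensor x y - elem_tensor x y'
      \<in> {r \<in> free_tensors A. free_extend \<beta> r = 0}"
    by (simp add: clinear_onD(1)[OF lin(1)])
  show "x \<in> A \<Longrightarrow> y \<in> A \<Longrightarrow> elem_tensor (c *\<^sub>C x) y - c *\<^sub>C elem_tensor x y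
      \<in> {r \<in> free_tensors A. free_extend \<beta> r = 0}"
    by (simp add: clinear_onD(2)[OF lin(2)])
  show "x \<in> A \<Longrightarrow> y \<in> A \<Longrightarrow> elem_tensor x (c *\<^sub>C y) - c *\<^sub>C elem_tensor x y
      \<in> {r \<in> free_tensors A. free_extend \<beta> r = 0}"
    by (simp add: clinear_onD(2)[OF lin(1)])
qed

text \<open>Representations indexed by an arbitrary finite set are admitted, so that two of them can be
  concatenated without renumbering.\<close>

lemma projective_norm_le:
  assumes "finite I" "\<And>i. i \<in> I \<Longrightarrow> x i \<in> A" "\<And>i. i \<in> I \<Longrightarrow> y i \<in> A"
    and rel: "f - (\<Sum>i\<in>I. elem_tensor (x i) (y i)) \<in> tensor_relations A"
  shows "projective_norm A f \<le> (\<Sum>i\<in>I. norm (x i) * norm (y i))"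
proof -
  obtain h where h: "bij_betw h {0..<card I} I" using ex_bij_betw_nat_finite[OF \<open>finite I\<close>] by blast
  then have h': "bij_betw h {..<card I} I" by (simp add: atLeast0LessThan)
  have hI: "h i \<in> I" if "i < card I" for i using h' that by (auto simp: bij_betw_def)
  show ?thesis
    unfolding projective_norm_def
  proof (rule cInf_lower)
    show "(\<Sum>i\<in>I. norm (x i) * norm (y i)) \<in> {(\<Sum>i<n. norm (x i) * norm (y i)) | (n::nat) x y.
      (\<forall>i<n. x i \<in> A \<and> y i \<in> A) \<and> f - (\<Sum>i<n. elem_tensor (x i) (y i)) \<in> tensor_relations A}"
      unfolding mem_Collect_eq
      by (rule exI[of _ "card I"], rule exI[of _ "x \<circ> h"], rule exI[of _ "y \<circ> h"])
        (use assms hI rel in \<open>simp add: sum.reindex_bij_betw[OF h', of "\<lambda>i. norm (x i) * norm (y i)"]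
          sum.reindex_bij_betw[OF h', of "\<lambda>i. elem_tensor (x i) (y i)"]\<close>)
    show "bdd_below {(\<Sum>i<n. norm (x i) * norm (y i)) | (n::nat) x y.
      (\<forall>i<n. x i \<in> A \<and> y i \<in> A) \<and> f - (\<Sum>i<n. elem_tensor (x i) (y i)) \<in> tensor_relations A}"
      by (rule bdd_belowI[of _ 0]) (auto intro!: sum_nonneg)
  qed
qed

lemma sum_fun_apply: "(\<Sum>i\<in>I. f i) x = (\<Sum>i\<in>I. f i (x :: 'a) :: 'b::comm_monoid_add)"
  by (induction I rule: infinite_finite_induct) auto

text \<open>Every free tensor is a sum of elementary tensors modulo the bilinearity relations, so that the
  infimum defining the projective seminorm is taken over a nonempty set.\<close>

lemma free_tensor_representation:
  assumes A: "csubspace A" and f: "f \<in> free_tensors A"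
  shows "\<exists>(n::nat) x y. (\<forall>i<n. x i \<in> A \<and> y i \<in> A) \<and> f - (\<Sum>i<n. elem_tensor (x i) (y i)) \<in> tensor_relations A"
proof -
  have fin: "finite {z. f z \<noteq> 0}" and sub: "{z. f z \<noteq> 0} \<subseteq> A \<times> A" using f by (auto simp: free_tensors_def)
  obtain h where h: "bij_betw h {0..<card {z. f z \<noteq> 0}} {z. f z \<noteq> 0}"
    using ex_bij_betw_nat_finite[OF fin] by blast
  define n where "n = card {z. f z \<noteq> 0}"
  have h': "bij_betw h {..<n} {z. f z \<noteq> 0}" using h by (simp add: atLeast0LessThan n_def)
  have hI: "fst (h i) \<in> A" "snd (h i) \<in> A" if "i < n" for i
    using subsetD[OF sub, of "h i"] bij_betwE[OF h'] that by (auto simp: mem_Times_iff)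
  have "f = free_extend elem_tensor f"
  proof
    fix z
    have "free_extend elem_tensor f z = (\<Sum>w | f w \<noteq> 0. f w * (if z = w then 1 else 0))"
      unfolding free_extend_def sum_fun_apply
      by (intro sum.cong) (auto simp: scaleC_fun_def scaleC_complex_def elem_tensor_def)
    also have "\<dots> = f z" using fin by (simp add: sum.delta if_distrib cong: if_cong)
    finally show "f z = free_extend elem_tensor f z" by simp
  qed
  also have "\<dots> = (\<Sum>i<n. f (h i) *\<^sub>C elem_tensor (fst (h i)) (snd (h i)))"
    unfolding free_extend_def by (rule sum.reindex_bij_betw[OF h', symmetric])
  finally have "f - (\<Sum>i<n. elem_tensor (f (h i) *\<^sub>C fst (h i)) (snd (h i)))
      = - (\<Sum>i<n. elem_tensor (f (h i) *\<^sub>C fst (h i)) (snd (h i)) - f (h i) *\<^sub>C elem_tensor (fst (h i)) (snd (h i)))"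
    by (simp add: sum_subtractf)
  also have "\<dots> \<in> tensor_relations A"
    by (intro csubspace_minus[OF relations_subspace] csubspace_sum[OF relations_subspace] tensor_relationsI)
      (use hI in auto)
  finally show ?thesis
    using hI csubspace_scaleC[OF A]
    by (intro exI[of _ n] exI[of _ "\<lambda>i. f (h i) *\<^sub>C fst (h i)"] exI[of _ "\<lambda>i. snd (h i)"]) auto
qed

lemma projective_norm_approx:
  assumes A: "csubspace A" and f: "f \<in> free_tensors A" and r: "projective_norm A f < r"
  shows "\<exists>(n::nat) x y. (\<forall>i<n. x i \<in> A \<and> y i \<in> A) \<and> f - (\<Sum>i<n. elem_tensor (x i) (y i)) \<in> tensor_relations A
    \<and> (\<Sum>i<n. norm (x i) * norm (y i)) < r"
proof -
  have "\<exists>s \<in> {(\<Sum>i<n. norm (x i) * norm (y i)) | (n::nat) x y.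
      (\<forall>i<n. x i \<in> A \<and> y i \<in> A) \<and> f - (\<Sum>i<n. elem_tensor (x i) (y i)) \<in> tensor_relations A}. s < r"
    using free_tensor_representation[OF A f] r unfolding projective_norm_def by (intro cInf_lessD) blast+
  then show ?thesis by blast
qed

lemma projective_norm_nonneg:
  assumes "csubspace A" "f \<in> free_tensors A"
  shows "0 \<le> projective_norm A f"
  unfolding projective_norm_def using free_tensor_representation[OF assms]
  by (intro cInf_greatest) (auto intro!: sum_nonneg)

lemma projective_norm_zero: "csubspace A \<Longrightarrow> projective_norm A 0 = 0"
  using projective_norm_le[of "{}" undefined A undefined 0] projective_norm_nonneg[of A 0]
    csubspace_0[OF relations_subspace[of A]] csubspace_0[OF free_tensors_subspace[of A]] by auto

lemma projective_norm_triangle: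
  assumes A: "csubspace A" and f: "f \<in> free_tensors A" and g: "g \<in> free_tensors A"
  shows "projective_norm A (f + g) \<le> projective_norm A f + projective_norm A g"
proof (rule field_le_epsilon)
  fix e :: real assume e: "0 < e"
  obtain n :: nat and x y where f': "\<forall>i<n. x i \<in> A \<and> y i \<in> A" "f - (\<Sum>i<n. elem_tensor (x i) (y i)) \<in> tensor_relations A"
    "(\<Sum>i<n. norm (x i) * norm (y i)) < projective_norm A f + e / 2"
    using projective_norm_approx[OF A f, of "projective_norm A f + e / 2"] e by auto
  obtain m :: nat and v w where g': "\<forall>i<m. v i \<in> A \<and> w i \<in> A" "g - (\<Sum>i<m. elem_tensor (v i) (w i)) \<in> tensor_relations A"
    "(\<Sum>i<m. norm (v i) * norm (w i)) < projective_norm A g + e / 2"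
    using projective_norm_approx[OF A g, of "projective_norm A g + e / 2"] e by auto
  let ?I = "{..<n} <+> {..<m}"
  have "f + g - (\<Sum>i\<in>?I. elem_tensor (case_sum x v i) (case_sum y w i))
      = (f - (\<Sum>i<n. elem_tensor (x i) (y i))) + (g - (\<Sum>i<m. elem_tensor (v i) (w i)))"
    by (simp add: sum.Plus)
  then have "f + g - (\<Sum>i\<in>?I. elem_tensor (case_sum x v i) (case_sum y w i)) \<in> tensor_relations A"
    using f'(2) g'(2) by (simp only: csubspace_add[OF relations_subspace])
  then have "projective_norm A (f + g) \<le> (\<Sum>i\<in>?I. norm (case_sum x v i) * norm (case_sum y w i))"
    using f'(1) g'(1) by (intro projective_norm_le) auto
  also have "\<dots> = (\<Sum>i<n. norm (x i) * norm (y i)) + (\<Sum>i<m. norm (v i) * norm (w i))"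
    by (simp add: sum.Plus)
  finally show "projective_norm A (f + g) \<le> projective_norm A f + projective_norm A g + e"
    using f'(3) g'(3) by argo
qed

lemma projective_norm_scaleC:
  assumes A: "csubspace A" and f: "f \<in> free_tensors A"
  shows "projective_norm A (c *\<^sub>C f) \<le> cmod c * projective_norm A f"
proof -
  have "projective_norm A (c *\<^sub>C f) \<le> cmod c * r" if r: "projective_norm A f < r" for r
  proof -
    obtain n :: nat and x y where f': "\<forall>i<n. x i \<in> A \<and> y i \<in> A" "f - (\<Sum>i<n. elem_tensor (x i) (y i)) \<in> tensor_relations A"
      "(\<Sum>i<n. norm (x i) * norm (y i)) < r"
      using projective_norm_approx[OF A f r] by blast
    have "c *\<^sub>C f - (\<Sum>i<n. elem_tensor (c *\<^sub>C x i) (y i)) = c *\<^sub>C (f - (\<Sum>i<n. elem_tensor (x i) (y i)))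
        - (\<Sum>i<n. elem_tensor (c *\<^sub>C x i) (y i) - c *\<^sub>C elem_tensor (x i) (y i))"
      by (simp add: scaleC_diff_right scaleC_sum_right sum_subtractf)
    also have "\<dots> \<in> tensor_relations A"
      by (intro csubspace_diff[OF relations_subspace] csubspace_scaleC[OF relations_subspace] f'(2)
          csubspace_sum[OF relations_subspace] tensor_relationsI) (use f'(1) in auto)
    finally have "projective_norm A (c *\<^sub>C f) \<le> (\<Sum>i<n. norm (c *\<^sub>C x i) * norm (y i))"
      using f'(1) csubspace_scaleC[OF A] by (intro projective_norm_le) auto
    also have "\<dots> = cmod c * (\<Sum>i<n. norm (x i) * norm (y i))"
      by (simp add: norm_scaleC sum_distrib_left mult.assoc)
    also have "\<dots> \<le> cmod c * r" using f'(3) by (intro mult_left_mono) auto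
    finally show ?thesis .
  qed
  then show ?thesis
    by (intro tendsto_lowerbound[of "\<lambda>r. cmod c * r" _ "at_right (projective_norm A f)"])
      (auto intro!: tendsto_intros simp: eventually_at_right_less eventually_at_filter)
qed

text \<open>The universal property of the projective seminorm, with the sharp constant.\<close>

lemma norm_free_extend_le:
  assumes A: "csubspace A" and f: "f \<in> free_tensors A" and \<beta>: "bounded_cbilinear_on A K \<beta>"
  shows "norm (free_extend \<beta> f) \<le> K * projective_norm A f"
proof -
  have K: "0 \<le> K" using \<beta> by (simp add: bounded_cbilinear_on_def)
  have "norm (free_extend \<beta> f) \<le> K * r" if r: "projective_norm A f < r" for r
  proof -
    obtain n :: nat and x y where f': "\<forall>i<n. x i \<in> A \<and> y i \<in> A" "f - (\<Sum>i<n. elem_tensor (x i) (y i)) \<in> tensor_relations A"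
      "(\<Sum>i<n. norm (x i) * norm (y i)) < r"
      using projective_norm_approx[OF A f r] by blast
    have mem: "(\<Sum>i<n. elem_tensor (x i) (y i)) \<in> free_tensors A"
      using f'(1) by (intro csubspace_sum[OF free_tensors_subspace]) auto
    have "free_extend \<beta> (f - (\<Sum>i<n. elem_tensor (x i) (y i))) = 0"
      using relations_subset_vanishing[OF A \<beta>] f'(2) by blast
    then have "free_extend \<beta> f = free_extend \<beta> (\<Sum>i<n. elem_tensor (x i) (y i))"
      using free_extend_diff[OF f mem, of \<beta>] by simp
    also have "\<dots> = (\<Sum>i<n. free_extend \<beta> (elem_tensor (x i) (y i)))"
      by (rule free_extend_sum[where A = A]) (use f'(1) in auto)
    finally have "norm (free_extend \<beta> f) \<le> (\<Sum>i<n. K * (norm (x i) * norm (y i)))"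
      using f'(1) \<beta> by (auto simp: bounded_cbilinear_on_def intro!: sum_norm_le)
    also have "\<dots> = K * (\<Sum>i<n. norm (x i) * norm (y i))" by (simp add: sum_distrib_left)
    also have "\<dots> \<le> K * r" using f'(3) K by (intro mult_left_mono) auto
    finally show ?thesis .
  qed
  then show ?thesis
    by (intro tendsto_lowerbound[of "\<lambda>r. K * r" _ "at_right (projective_norm A f)"])
      (auto intro!: tendsto_intros simp: eventually_at_right_less eventually_at_filter)
qed

text \<open>The map \<open>g \<otimes> h\<close> is bounded for the projective seminorm.  With multiplication by a fixed element as
  one factor and the identity as the other it gives the two module actions.\<close>

lemma projective_norm_tensor_map:
  assumes A: "csubspace A" and f: "f \<in> free_tensors A"
    and g: "bounded_clinear_on A G g" and gA: "g ` A \<subseteq> A"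
    and h: "bounded_clinear_on A H h" and hA: "h ` A \<subseteq> A"
  defines "T \<equiv> free_extend (\<lambda>x y. elem_tensor (g x) (h y))"
  shows "projective_norm A (T f) \<le> G * H * projective_norm A f"
proof -
  have GH: "0 \<le> G" "0 \<le> H" using g h by (auto simp: bounded_clinear_on_def)
  have lin: "clinear_on A g" "clinear_on A h" using g h by (auto simp: bounded_clinear_on_def)
  have mem: "g x \<in> A" "h x \<in> A" if "x \<in> A" for x using gA hA that by auto
  have Tf: "T f \<in> free_tensors A" if "f \<in> free_tensors A" for f
    unfolding T_def by (rule free_extend_in_subspace[OF free_tensors_subspace _ that]) (simp add: mem)
  note ft = free_tensors_subspace[of A] and rs = relations_subspace[of A]
  have Trel: "tensor_relations A \<subseteq> {r \<in> free_tensors A. T r \<in> tensor_relations A}"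
  proof (rule tensor_relations_induct)
    show "csubspace {r \<in> free_tensors A. T r \<in> tensor_relations A}"
      using ft rs clinear_on_zero[OF free_extend_clinear ft, of "\<lambda>x y. elem_tensor (g x) (h y)"]
      by (auto simp: csubspace_def T_def free_extend_add free_extend_scaleC)
    note [simp] = csubspace_add[OF A] csubspace_scaleC[OF A] csubspace_diff[OF ft]
      csubspace_scaleC[OF ft] free_extend_diff[where A = A] free_extend_scaleC[where A = A] mem tensor_relationsI
      clinear_onD[OF lin(1)] clinear_onD[OF lin(2)]
    fix x x' y y' c
    show "x \<in> A \<Longrightarrow> x' \<in> A \<Longrightarrow> y \<in> A \<Longrightarrow> elem_tensor (x + x') y - elem_tensor x y - elem_tensor x' y
        \<in> {r \<in> free_tensors A. T r \<in> tensor_relations A}" by (simp add: T_def)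
    show "x \<in> A \<Longrightarrow> y \<in> A \<Longrightarrow> y' \<in> A \<Longrightarrow> elem_tensor x (y + y') - elem_tensor x y - elem_tensor x y'
        \<in> {r \<in> free_tensors A. T r \<in> tensor_relations A}" by (simp add: T_def)
    show "x \<in> A \<Longrightarrow> y \<in> A \<Longrightarrow> elem_tensor (c *\<^sub>C x) y - c *\<^sub>C elem_tensor x y
        \<in> {r \<in> free_tensors A. T r \<in> tensor_relations A}" by (simp add: T_def)
    show "x \<in> A \<Longrightarrow> y \<in> A \<Longrightarrow> elem_tensor x (c *\<^sub>C y) - c *\<^sub>C elem_tensor x y
        \<in> {r \<in> free_tensors A. T r \<in> tensor_relations A}" by (simp add: T_def)
  qed
  have "projective_norm A (T f) \<le> G * H * r" if r: "projective_norm A f < r" for r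
  proof -
    obtain n :: nat and x y where f': "\<forall>i<n. x i \<in> A \<and> y i \<in> A" "f - (\<Sum>i<n. elem_tensor (x i) (y i)) \<in> tensor_relations A"
      "(\<Sum>i<n. norm (x i) * norm (y i)) < r"
      using projective_norm_approx[OF A f r] by blast
    have sm: "(\<Sum>i<n. elem_tensor (x i) (y i)) \<in> free_tensors A"
      using f'(1) by (intro csubspace_sum[OF free_tensors_subspace]) auto
    have "T (f - (\<Sum>i<n. elem_tensor (x i) (y i))) \<in> tensor_relations A" using Trel f'(2) by blast
    also have "T (f - (\<Sum>i<n. elem_tensor (x i) (y i))) = T f - T (\<Sum>i<n. elem_tensor (x i) (y i))"
      unfolding T_def by (rule free_extend_diff[OF f sm])
    also have "T (\<Sum>i<n. elem_tensor (x i) (y i)) = (\<Sum>i<n. T (elem_tensor (x i) (y i)))"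
      unfolding T_def by (rule free_extend_sum[where A = A]) (use f'(1) in auto)
    also have "\<dots> = (\<Sum>i<n. elem_tensor (g (x i)) (h (y i)))" by (simp add: T_def)
    finally have "T f - (\<Sum>i<n. elem_tensor (g (x i)) (h (y i))) \<in> tensor_relations A" .
    then have "projective_norm A (T f) \<le> (\<Sum>i<n. norm (g (x i)) * norm (h (y i)))"
      by (rule projective_norm_le[rotated -1]) (use f'(1) mem in auto)
    also have "\<dots> \<le> (\<Sum>i<n. (G * norm (x i)) * (H * norm (y i)))"
      using f'(1) g h GH by (intro sum_mono mult_mono) (auto simp: bounded_clinear_on_def)
    also have "\<dots> = G * H * (\<Sum>i<n. norm (x i) * norm (y i))" by (simp add: sum_distrib_left mult_ac)
    also have "\<dots> \<le> G * H * r" using f'(3) GH by (intro mult_left_mono) auto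
    finally show ?thesis .
  qed
  then show ?thesis
    by (intro tendsto_lowerbound[of "\<lambda>r. G * H * r" _ "at_right (projective_norm A f)"])
      (auto intro!: tendsto_intros simp: eventually_at_right_less eventually_at_filter)
qed

section \<open>Functionals on the projective tensor product and on its dual\<close>

lemma ptensorD:
  assumes "X \<in> ptensor A"
  shows "X n \<in> free_tensors A"
    and "0 < e \<Longrightarrow> \<exists>M. \<forall>m\<ge>M. \<forall>n\<ge>M. projective_norm A (X m - X n) < e"
  using assms by (auto simp: ptensor_def completion_def)

lemma ptensor_subspace:
  assumes A: "csubspace A"
  shows "csubspace (ptensor A)"
  unfolding csubspace_def
proof (intro conjI ballI allI)
  note ft = free_tensors_subspace[of A]
  show "0 \<in> ptensor A"
    using csubspace_0[OF ft] projective_norm_zero[OF A] by (auto simp: ptensor_def completion_def)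
  fix X Y c assume X: "X \<in> ptensor A"
  show "c *\<^sub>C X \<in> ptensor A"
    unfolding ptensor_def completion_def mem_Collect_eq
  proof (intro conjI allI impI)
    show "(c *\<^sub>C X) n \<in> free_tensors A" for n
      using csubspace_scaleC[OF ft ptensorD(1)[OF X]] by (simp add: scaleC_fun_def)
    fix e :: real assume "0 < e"
    then have e: "0 < e / (cmod c + 1)" by (simp add: add_nonneg_pos)
    obtain M where M: "\<And>m n. m \<ge> M \<Longrightarrow> n \<ge> M \<Longrightarrow> projective_norm A (X m - X n) < e / (cmod c + 1)"
      using ptensorD(2)[OF X e] by blast
    have "projective_norm A ((c *\<^sub>C X) m - (c *\<^sub>C X) n) < e" if "m \<ge> M" "n \<ge> M" for m n
    proof -
      have mem: "X m - X n \<in> free_tensors A" by (intro csubspace_diff[OF ft] ptensorD(1)[OF X])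
      have "(c *\<^sub>C X) m - (c *\<^sub>C X) n = c *\<^sub>C (X m - X n)"
        by (simp add: scaleC_fun_def[of c X] scaleC_diff_right)
      then have "projective_norm A ((c *\<^sub>C X) m - (c *\<^sub>C X) n) \<le> cmod c * projective_norm A (X m - X n)"
        using projective_norm_scaleC[OF A mem] by simp
      also have "\<dots> \<le> cmod c * (e / (cmod c + 1))" using M[OF that] by (intro mult_left_mono) auto
      also have "\<dots> < e"
        using \<open>0 < e\<close> add_nonneg_pos[OF norm_ge_zero[of c] zero_less_one]
        by (simp add: divide_less_eq algebra_simps)
      finally show ?thesis .
    qed
    then show "\<exists>M. \<forall>m\<ge>M. \<forall>n\<ge>M. projective_norm A ((c *\<^sub>C X) m - (c *\<^sub>C X) n) < e" by blast
  qed
  assume Y: "Y \<in> ptensor A"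
  show "X + Y \<in> ptensor A"
    unfolding ptensor_def completion_def mem_Collect_eq
  proof (intro conjI allI impI)
    show "(X + Y) n \<in> free_tensors A" for n
      using csubspace_add[OF ft ptensorD(1)[OF X] ptensorD(1)[OF Y]] by simp
    fix e :: real assume "0 < e"
    then have e: "0 < e / 2" by simp
    obtain M where M: "\<And>m n. m \<ge> M \<Longrightarrow> n \<ge> M \<Longrightarrow> projective_norm A (X m - X n) < e / 2"
      using ptensorD(2)[OF X e] by blast
    obtain M' where M': "\<And>m n. m \<ge> M' \<Longrightarrow> n \<ge> M' \<Longrightarrow> projective_norm A (Y m - Y n) < e / 2"
      using ptensorD(2)[OF Y e] by blast
    have "projective_norm A ((X + Y) m - (X + Y) n) < e" if "m \<ge> max M M'" "n \<ge> max M M'" for m n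
    proof -
      have eq: "(X + Y) m - (X + Y) n = (X m - X n) + (Y m - Y n)" by simp
      have "projective_norm A ((X m - X n) + (Y m - Y n))
          \<le> projective_norm A (X m - X n) + projective_norm A (Y m - Y n)"
        by (intro projective_norm_triangle[OF A] csubspace_diff[OF ft] ptensorD(1)[OF X] ptensorD(1)[OF Y])
      then show ?thesis unfolding eq using M[of m n] M'[of m n] that by simp
    qed
    then show "\<exists>M. \<forall>m\<ge>M. \<forall>n\<ge>M. projective_norm A ((X + Y) m - (X + Y) n) < e" by blast
  qed
qed

lemma ptensor_norm_tendsto:
  assumes A: "csubspace A" and X: "X \<in> ptensor A"
  shows "(\<lambda>n. projective_norm A (X n)) \<longlonglongrightarrow> ptensor_norm A X"
proof -
  note ft = free_tensors_subspace[of A]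
  have le: "projective_norm A (X m) - projective_norm A (X n) \<le> projective_norm A (X m - X n)" for m n
    using projective_norm_triangle[OF A csubspace_diff[OF ft ptensorD(1)[OF X] ptensorD(1)[OF X]] ptensorD(1)[OF X], of m n n]
    by simp
  have "Cauchy (\<lambda>n. projective_norm A (X n))"
  proof (rule metric_CauchyI)
    fix e :: real assume e: "0 < e"
    obtain M where M: "\<And>m n. m \<ge> M \<Longrightarrow> n \<ge> M \<Longrightarrow> projective_norm A (X m - X n) < e"
      using ptensorD(2)[OF X e] by blast
    have "dist (projective_norm A (X m)) (projective_norm A (X n)) < e" if "m \<ge> M" "n \<ge> M" for m n
      using le[of m n] le[of n m] M[of m n] M[of n m] that by (auto simp: dist_real_def)
    then show "\<exists>M. \<forall>m\<ge>M. \<forall>n\<ge>M. dist (projective_norm A (X m)) (projective_norm A (X n)) < e" by blast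
  qed
  then show ?thesis
    unfolding ptensor_norm_def completion_norm_def
    by (intro convergent_LIMSEQ_iff[THEN iffD1] Cauchy_convergent)
qed

lemma ptensor_norm_zero: "csubspace A \<Longrightarrow> ptensor_norm A 0 = 0"
  by (simp add: ptensor_norm_def completion_norm_def projective_norm_zero)

lemma free_extend_LIMSEQ:
  fixes \<beta> :: "'a::complex_normed_vector \<Rightarrow> 'a \<Rightarrow> 'b::{complex_normed_vector, banach}"
  assumes A: "csubspace A" and \<beta>: "bounded_cbilinear_on A K \<beta>" and X: "X \<in> ptensor A"
  shows "(\<lambda>n. free_extend \<beta> (X n)) \<longlonglongrightarrow> lim (\<lambda>n. free_extend \<beta> (X n))"
proof -
  have K: "0 \<le> K" using \<beta> by (simp add: bounded_cbilinear_on_def)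
  have "Cauchy (\<lambda>n. free_extend \<beta> (X n))"
  proof (rule metric_CauchyI)
    fix e :: real assume e: "0 < e"
    then have e': "0 < e / (K + 1)" using K by simp
    obtain M where M: "\<And>m n. m \<ge> M \<Longrightarrow> n \<ge> M \<Longrightarrow> projective_norm A (X m - X n) < e / (K + 1)"
      using ptensorD(2)[OF X e'] by blast
    have "dist (free_extend \<beta> (X m)) (free_extend \<beta> (X n)) < e" if "m \<ge> M" "n \<ge> M" for m n
    proof -
      have "dist (free_extend \<beta> (X m)) (free_extend \<beta> (X n)) = norm (free_extend \<beta> (X m - X n))"
        using free_extend_diff[OF ptensorD(1)[OF X] ptensorD(1)[OF X], of \<beta> m n] by (simp add: dist_norm)
      also have "\<dots> \<le> K * projective_norm A (X m - X n)"
        by (rule norm_free_extend_le[OF A csubspace_diff[OF free_tensors_subspace] \<beta>]) (intro ptensorD(1)[OF X])+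
      also have "\<dots> \<le> K * (e / (K + 1))" using M[OF that] K by (intro mult_left_mono) auto
      also have "\<dots> < e" using e K by (simp add: divide_less_eq algebra_simps)
      finally show ?thesis .
    qed
    then show "\<exists>M. \<forall>m\<ge>M. \<forall>n\<ge>M. dist (free_extend \<beta> (X m)) (free_extend \<beta> (X n)) < e" by blast
  qed
  then show ?thesis by (intro convergent_LIMSEQ_iff[THEN iffD1] Cauchy_convergent)
qed

text \<open>The functional \<open>x \<otimes> y \<mapsto> \<beta> x y\<close> on the completed tensor product.  The value \<open>0\<close> off the carrier is
  the normalization that membership in \<open>dual_space\<close> demands.\<close>

definition tensor_functional ::
    "'a::complex_normed_vector set \<Rightarrow> ('a \<Rightarrow> 'a \<Rightarrow> complex) \<Rightarrow> 'a ptensor \<Rightarrow> complex"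
  where "tensor_functional A \<beta> X = (if X \<in> ptensor A then lim (\<lambda>n. free_extend \<beta> (X n)) else 0)"

lemma tensor_functional_LIMSEQ:
  assumes "csubspace A" "bounded_cbilinear_on A K \<beta>" "X \<in> ptensor A"
  shows "(\<lambda>n. free_extend \<beta> (X n)) \<longlonglongrightarrow> tensor_functional A \<beta> X"
  using free_extend_LIMSEQ[OF assms] assms(3) by (simp add: tensor_functional_def)

lemma tensor_functional_eqI:
  assumes "X \<in> ptensor A" "(\<lambda>n. free_extend \<beta> (X n)) \<longlonglongrightarrow> l"
  shows "tensor_functional A \<beta> X = l"
  using assms by (simp add: tensor_functional_def limI)

lemma tensor_functional_clinear:
  assumes A: "csubspace A" and \<beta>: "bounded_cbilinear_on A K \<beta>"
  shows "clinear_on (ptensor A) (tensor_functional A \<beta>)"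
  unfolding clinear_on_def
proof (intro conjI ballI allI)
  note lim = tensor_functional_LIMSEQ[OF A \<beta>]
  fix X Y c assume X: "X \<in> ptensor A"
  have "(\<lambda>n. c * free_extend \<beta> (X n)) \<longlonglongrightarrow> c * tensor_functional A \<beta> X"
    by (intro tendsto_intros lim X)
  then show "tensor_functional A \<beta> (c *\<^sub>C X) = c *\<^sub>C tensor_functional A \<beta> X"
    using free_extend_scaleC[OF ptensorD(1)[OF X], of \<beta> c]
    by (intro tensor_functional_eqI csubspace_scaleC[OF ptensor_subspace[OF A]] X)
      (simp add: scaleC_fun_def[of c X] scaleC_complex_def)
  assume Y: "Y \<in> ptensor A"
  have "(\<lambda>n. free_extend \<beta> (X n) + free_extend \<beta> (Y n)) \<longlonglongrightarrow> tensor_functional A \<beta> X + tensor_functional A \<beta> Y"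
    by (intro tendsto_intros lim X Y)
  then show "tensor_functional A \<beta> (X + Y) = tensor_functional A \<beta> X + tensor_functional A \<beta> Y"
    using free_extend_add[OF ptensorD(1)[OF X] ptensorD(1)[OF Y], of \<beta>]
    by (intro tensor_functional_eqI csubspace_add[OF ptensor_subspace[OF A]] X Y) simp
qed

lemma tensor_functional_bound:
  assumes A: "csubspace A" and \<beta>: "bounded_cbilinear_on A K \<beta>" and X: "X \<in> ptensor A"
  shows "cmod (tensor_functional A \<beta> X) \<le> K * ptensor_norm A X"
proof (rule LIMSEQ_le)
  show "(\<lambda>n. cmod (free_extend \<beta> (X n))) \<longlonglongrightarrow> cmod (tensor_functional A \<beta> X)"
    by (intro tendsto_norm tensor_functional_LIMSEQ[OF A \<beta> X])
  show "(\<lambda>n. K * projective_norm A (X n)) \<longlonglongrightarrow> K * ptensor_norm A X"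
    by (intro tendsto_mult_left ptensor_norm_tendsto[OF A X])
  show "\<exists>N. \<forall>n\<ge>N. cmod (free_extend \<beta> (X n)) \<le> K * projective_norm A (X n)"
    using norm_free_extend_le[OF A ptensorD(1)[OF X] \<beta>] by blast
qed

lemma tensor_functional_dual:
  assumes A: "csubspace A" and \<beta>: "bounded_cbilinear_on A K \<beta>"
  shows "tensor_functional A \<beta> \<in> dual_space (ptensor A) (ptensor_norm A)"
  unfolding dual_space_def
  using tensor_functional_clinear[OF A \<beta>] tensor_functional_bound[OF A \<beta>]
  by (auto simp: tensor_functional_def)

lemma tensor_functional_norm:
  assumes A: "csubspace A" and \<beta>: "bounded_cbilinear_on A K \<beta>"
  shows "dual_norm (ptensor A) (ptensor_norm A) (tensor_functional A \<beta>) \<le> K"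
  unfolding dual_norm_def
proof (rule cSup_least)
  show "{cmod (tensor_functional A \<beta> x) |x. x \<in> ptensor A \<and> ptensor_norm A x \<le> 1} \<noteq> {}"
    using csubspace_0[OF ptensor_subspace[OF A]] ptensor_norm_zero[OF A] by auto
  fix r assume "r \<in> {cmod (tensor_functional A \<beta> x) |x. x \<in> ptensor A \<and> ptensor_norm A x \<le> 1}"
  then obtain X where X: "r = cmod (tensor_functional A \<beta> X)" "X \<in> ptensor A" "ptensor_norm A X \<le> 1" by blast
  have "K * ptensor_norm A X \<le> K * 1"
    using \<beta> X(3) by (intro mult_left_mono) (auto simp: bounded_cbilinear_on_def)
  then show "r \<le> K" using tensor_functional_bound[OF A \<beta> X(2)] X(1) by simp
qed

lemma cmod_le_dual_norm:
  assumes \<phi>: "\<phi> \<in> dual_space V p" and pnn: "\<And>x. x \<in> V \<Longrightarrow> 0 \<le> p x"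
    and x: "x \<in> V" "p x \<le> 1"
  shows "cmod (\<phi> x) \<le> dual_norm V p \<phi>"
  unfolding dual_norm_def
proof (rule cSup_upper)
  show "cmod (\<phi> x) \<in> {cmod (\<phi> x) |x. x \<in> V \<and> p x \<le> 1}" using x by blast
  obtain C where C: "\<And>x. x \<in> V \<Longrightarrow> cmod (\<phi> x) \<le> C * p x" using \<phi> by (auto simp: dual_space_def)
  have "cmod (\<phi> x) \<le> max C 0" if "x \<in> V" "p x \<le> 1" for x
  proof -
    have "cmod (\<phi> x) \<le> C * p x" using C that by blast
    also have "\<dots> \<le> max C 0 * p x" using pnn that by (intro mult_right_mono) auto
    also have "\<dots> \<le> max C 0 * 1" using that by (intro mult_left_mono) auto
    finally show ?thesis by simp
  qed
  then show "bdd_above {cmod (\<phi> x) |x. x \<in> V \<and> p x \<le> 1}" by (auto simp: bdd_above_def)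
qed

lemma dual_space_subspace: "csubspace (dual_space V p)"
  unfolding csubspace_def
proof (intro conjI ballI allI)
  show "0 \<in> dual_space V p"
    by (auto simp: dual_space_def clinear_on_def scaleC_zero_right intro!: exI[of _ 0])
  fix f g c assume f: "f \<in> dual_space V p"
  obtain C where C: "\<And>x. x \<in> V \<Longrightarrow> cmod (f x) \<le> C * p x" using f by (auto simp: dual_space_def)
  have "\<forall>x\<in>V. cmod ((c *\<^sub>C f) x) \<le> (cmod c * C) * p x"
    using C by (auto simp: scaleC_fun_def scaleC_complex_def norm_mult mult.assoc intro!: mult_left_mono)
  moreover have "clinear_on V (c *\<^sub>C f)" "\<forall>x. x \<notin> V \<longrightarrow> (c *\<^sub>C f) x = 0"
    using f by (auto simp: dual_space_def clinear_on_def scaleC_fun_def scaleC_complex_def algebra_simps)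
  ultimately show "c *\<^sub>C f \<in> dual_space V p" unfolding dual_space_def by blast
  assume g: "g \<in> dual_space V p"
  obtain D where D: "\<And>x. x \<in> V \<Longrightarrow> cmod (g x) \<le> D * p x" using g by (auto simp: dual_space_def)
  have "\<forall>x\<in>V. cmod ((f + g) x) \<le> (C + D) * p x"
  proof
    fix x assume "x \<in> V"
    then show "cmod ((f + g) x) \<le> (C + D) * p x"
      using C[of x] D[of x] norm_triangle_ineq[of "f x" "g x"] by (simp add: distrib_right)
  qed
  moreover have "clinear_on V (f + g)" "\<forall>x. x \<notin> V \<longrightarrow> (f + g) x = 0"
    using f g by (auto simp: dual_space_def clinear_on_def scaleC_complex_def algebra_simps)
  ultimately show "f + g \<in> dual_space V p" unfolding dual_space_def by blast
qed

text \<open>By homogeneity it suffices to treat functionals of dual norm at most one.  A functional of dual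
  norm \<open>0\<close> cannot be normalized; there the mere boundedness of \<open>u\<close> gives the value \<open>0\<close>.\<close>

lemma bidual_bound:
  assumes V: "csubspace V" and p0: "p 0 = 0" and pnn: "\<And>x. x \<in> V \<Longrightarrow> 0 \<le> p x"
    and u: "u \<in> bidual_space V p" and \<phi>: "\<phi> \<in> dual_space V p"
  shows "cmod (u \<phi>) \<le> bidual_norm V p u * dual_norm V p \<phi>"
proof -
  let ?D = "dual_space V p" and ?n = "dual_norm V p"
  have D: "csubspace ?D" by (rule dual_space_subspace)
  have nn: "0 \<le> ?n \<psi>" if "\<psi> \<in> ?D" for \<psi>
    using cmod_le_dual_norm[OF that pnn csubspace_0[OF V]] norm_ge_zero[of "\<psi> 0"] p0 by linarith
  obtain C where C: "\<And>\<psi>. \<psi> \<in> ?D \<Longrightarrow> cmod (u \<psi>) \<le> C * ?n \<psi>"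
    using u by (auto simp: bidual_space_def dual_space_def[of ?D])
  have n_scale: "?n (complex_of_real r *\<^sub>C \<psi>) \<le> r * ?n \<psi>" if "\<psi> \<in> ?D" "0 < r" for r \<psi>
    unfolding dual_norm_def[of V p "complex_of_real r *\<^sub>C \<psi>"]
  proof (rule cSup_least)
    show "{cmod ((complex_of_real r *\<^sub>C \<psi>) x) |x. x \<in> V \<and> p x \<le> 1} \<noteq> {}"
      using csubspace_0[OF V] p0 by auto
    fix s assume "s \<in> {cmod ((complex_of_real r *\<^sub>C \<psi>) x) |x. x \<in> V \<and> p x \<le> 1}"
    then obtain x where x: "s = cmod ((complex_of_real r *\<^sub>C \<psi>) x)" "x \<in> V" "p x \<le> 1" by blast
    then show "s \<le> r * ?n \<psi>"
      using cmod_le_dual_norm[OF that(1) pnn x(2,3)] that(2)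
      by (simp add: scaleC_fun_def scaleC_complex_def norm_mult)
  qed
  show ?thesis
  proof (cases "?n \<phi> = 0")
    case True
    then show ?thesis using C[OF \<phi>] by simp
  next
    case False
    then have pos: "0 < ?n \<phi>" using nn[OF \<phi>] by simp
    let ?\<psi> = "complex_of_real (inverse (?n \<phi>)) *\<^sub>C \<phi>"
    have \<psi>: "?\<psi> \<in> ?D" by (rule csubspace_scaleC[OF D \<phi>])
    have "?n ?\<psi> \<le> 1" using n_scale[OF \<phi>, of "inverse (?n \<phi>)"] pos by simp
    moreover have "u \<in> dual_space ?D ?n" using u by (simp add: bidual_space_def)
    ultimately have "cmod (u ?\<psi>) \<le> bidual_norm V p u"
      unfolding bidual_norm_def using nn \<psi> by (intro cmod_le_dual_norm)
    moreover have "u ?\<psi> = complex_of_real (inverse (?n \<phi>)) * u \<phi>"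
      using u \<phi> clinear_onD(2)[of ?D u \<phi>] by (auto simp: bidual_space_def dual_space_def[of ?D] scaleC_complex_def)
    ultimately have "inverse (?n \<phi>) * cmod (u \<phi>) \<le> bidual_norm V p u"
      using pos by (simp add: norm_mult norm_inverse)
    then show ?thesis using pos by (simp add: field_simps)
  qed
qed

lemma ptensor_norm_nonneg: "csubspace A \<Longrightarrow> X \<in> ptensor A \<Longrightarrow> 0 \<le> ptensor_norm A X"
  by (rule LIMSEQ_le_const[OF ptensor_norm_tendsto]) (auto intro: projective_norm_nonneg ptensorD(1))

lemma tensor_functional_add:
  assumes A: "csubspace A" and \<beta>: "bounded_cbilinear_on A K \<beta>" and \<beta>': "bounded_cbilinear_on A K' \<beta>'"
  shows "tensor_functional A (\<lambda>x y. \<beta> x y + \<beta>' x y) = tensor_functional A \<beta> + tensor_functional A \<beta>'"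
proof
  fix X
  show "tensor_functional A (\<lambda>x y. \<beta> x y + \<beta>' x y) X = (tensor_functional A \<beta> + tensor_functional A \<beta>') X"
  proof (cases "X \<in> ptensor A")
    case True
    have "(\<lambda>n. free_extend \<beta> (X n) + free_extend \<beta>' (X n)) \<longlonglongrightarrow> tensor_functional A \<beta> X + tensor_functional A \<beta>' X"
      by (intro tendsto_intros tensor_functional_LIMSEQ[OF A \<beta>] tensor_functional_LIMSEQ[OF A \<beta>'] True)
    then show ?thesis
      by (intro tensor_functional_eqI True) (simp add: free_extend_def scaleC_add_right sum.distrib)
  qed (simp add: tensor_functional_def)
qed

lemma tensor_functional_scaleC:
  assumes A: "csubspace A" and \<beta>: "bounded_cbilinear_on A K \<beta>"
  shows "tensor_functional A (\<lambda>x y. c * \<beta> x y) = c *\<^sub>C tensor_functional A \<beta>"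
proof
  fix X
  show "tensor_functional A (\<lambda>x y. c * \<beta> x y) X = (c *\<^sub>C tensor_functional A \<beta>) X"
  proof (cases "X \<in> ptensor A")
    case True
    have "(\<lambda>n. c * free_extend \<beta> (X n)) \<longlonglongrightarrow> c * tensor_functional A \<beta> X"
      by (intro tendsto_intros tensor_functional_LIMSEQ[OF A \<beta>] True)
    then show ?thesis
      unfolding scaleC_fun_def[of c "tensor_functional A \<beta>"] scaleC_complex_def[of c "tensor_functional A \<beta> X"]
      by (intro tensor_functional_eqI True)
        (simp add: free_extend_def scaleC_complex_def sum_distrib_left mult_ac)
  qed (simp add: tensor_functional_def scaleC_fun_def scaleC_complex_def)
qed

lemma tensor_functional_cong:
  assumes "\<And>x y. x \<in> A \<Longrightarrow> y \<in> A \<Longrightarrow> \<beta> x y = \<beta>' x y"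
  shows "tensor_functional A \<beta> = tensor_functional A \<beta>'"
proof
  fix X
  show "tensor_functional A \<beta> X = tensor_functional A \<beta>' X"
    using free_extend_cong[OF ptensorD(1)[of X A] assms] by (simp add: tensor_functional_def)
qed

lemma tensor_map_ptensor:
  assumes A: "csubspace A" and X: "X \<in> ptensor A"
    and g: "bounded_clinear_on A G g" and gA: "g ` A \<subseteq> A"
    and h: "bounded_clinear_on A H h" and hA: "h ` A \<subseteq> A"
  shows "(\<lambda>n. free_extend (\<lambda>x y. elem_tensor (g x) (h y)) (X n)) \<in> ptensor A"
  unfolding ptensor_def completion_def mem_Collect_eq
proof (intro conjI allI impI)
  let ?T = "free_extend (\<lambda>x y. elem_tensor (g x) (h y))"
  have mem: "g x \<in> A" "h x \<in> A" if "x \<in> A" for x using gA hA that by auto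
  show "?T (X n) \<in> free_tensors A" for n
    by (rule free_extend_in_subspace[OF free_tensors_subspace _ ptensorD(1)[OF X]]) (simp add: mem)
  have GH: "0 \<le> G * H" using g h by (auto simp: bounded_clinear_on_def)
  fix e :: real assume "0 < e"
  then have e: "0 < e / (G * H + 1)" using GH by simp
  obtain M where M: "\<And>m n. m \<ge> M \<Longrightarrow> n \<ge> M \<Longrightarrow> projective_norm A (X m - X n) < e / (G * H + 1)"
    using ptensorD(2)[OF X e] by blast
  have "projective_norm A (?T (X m) - ?T (X n)) < e" if "m \<ge> M" "n \<ge> M" for m n
  proof -
    have "?T (X m) - ?T (X n) = ?T (X m - X n)"
      by (rule free_extend_diff[OF ptensorD(1)[OF X] ptensorD(1)[OF X], symmetric])
    moreover have "projective_norm A (?T (X m - X n)) \<le> G * H * projective_norm A (X m - X n)"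
      by (rule projective_norm_tensor_map[OF A csubspace_diff[OF free_tensors_subspace ptensorD(1)[OF X] ptensorD(1)[OF X]] g gA h hA])
    moreover have "G * H * projective_norm A (X m - X n) \<le> G * H * (e / (G * H + 1))"
      using M[OF that] GH by (intro mult_left_mono) auto
    moreover have "\<dots> < e" using \<open>0 < e\<close> GH by (simp add: divide_less_eq algebra_simps)
    ultimately show ?thesis by simp
  qed
  then show "\<exists>M. \<forall>m\<ge>M. \<forall>n\<ge>M. projective_norm A (?T (X m) - ?T (X n)) < e" by blast
qed

text \<open>In terms of bilinear forms, the adjoint of \<open>g \<otimes> h\<close> is substitution.\<close>

lemma adjoint_tensor_map:
  assumes A: "csubspace A"
    and g: "bounded_clinear_on A G g" and gA: "g ` A \<subseteq> A"
    and h: "bounded_clinear_on A H h" and hA: "h ` A \<subseteq> A"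
  shows "adjoint_on (ptensor A) (\<lambda>X n. free_extend (\<lambda>x y. elem_tensor (g x) (h y)) (X n))
    (tensor_functional A \<beta>) = tensor_functional A (\<lambda>x y. \<beta> (g x) (h y))"
proof
  fix X
  have mem: "g x \<in> A" "h x \<in> A" if "x \<in> A" for x using gA hA that by auto
  have "free_extend \<beta> (free_extend (\<lambda>x y. elem_tensor (g x) (h y)) (X n)) = free_extend (\<lambda>x y. \<beta> (g x) (h y)) (X n)"
    if "X \<in> ptensor A" for n
    using free_extend_compose[OF free_extend_clinear free_tensors_subspace _ ptensorD(1)[OF that],
        of "\<lambda>x y. elem_tensor (g x) (h y)" A \<beta> n] mem by simp
  then show "adjoint_on (ptensor A) (\<lambda>X n. free_extend (\<lambda>x y. elem_tensor (g x) (h y)) (X n))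
    (tensor_functional A \<beta>) X = tensor_functional A (\<lambda>x y. \<beta> (g x) (h y)) X"
    using tensor_map_ptensor[OF A _ g gA h hA, of X] by (simp add: adjoint_on_def tensor_functional_def)
qed

section \<open>Integration against a virtual diagonal\<close>

lemma bounded_cbilinear_onD:
  assumes "bounded_cbilinear_on A K \<beta>"
  shows "0 \<le> K" "x \<in> A \<Longrightarrow> clinear_on A (\<beta> x)" "y \<in> A \<Longrightarrow> clinear_on A (\<lambda>x. \<beta> x y)"
    "x \<in> A \<Longrightarrow> y \<in> A \<Longrightarrow> norm (\<beta> x y) \<le> K * (norm x * norm y)"
  using assms by (auto simp: bounded_cbilinear_on_def)

lemma bounded_clinear_onD:
  assumes "bounded_clinear_on A K f"
  shows "0 \<le> K" "clinear_on A f" "x \<in> A \<Longrightarrow> norm (f x) \<le> K * norm x"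
  using assms by (auto simp: bounded_clinear_on_def)

lemma bounded_cbilinear_on_bound:
  assumes "bounded_cbilinear_on A K \<beta>" "0 \<le> K'"
    "\<And>x y. x \<in> A \<Longrightarrow> y \<in> A \<Longrightarrow> norm (\<beta> x y) \<le> K' * (norm x * norm y)"
  shows "bounded_cbilinear_on A K' \<beta>"
  using assms by (auto simp: bounded_cbilinear_on_def)

lemma bounded_cbilinear_on_zero: "bounded_cbilinear_on A 0 (\<lambda>x y. 0)"
  by (auto simp: bounded_cbilinear_on_def clinear_on_def scaleC_zero_right)

lemma bounded_cbilinear_on_add:
  assumes "bounded_cbilinear_on A K \<beta>" "bounded_cbilinear_on A K' \<beta>'"
  shows "bounded_cbilinear_on A (K + K') (\<lambda>x y. \<beta> x y + \<beta>' x y)"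
  using assms unfolding bounded_cbilinear_on_def clinear_on_def
  by (auto simp: scaleC_add_right distrib_right add_ac intro!: order_trans[OF norm_triangle_ineq] add_mono)

lemma bounded_cbilinear_on_compose:
  assumes \<beta>: "bounded_cbilinear_on A K \<beta>" and L: "clinear_on UNIV L" and M: "0 \<le> M"
    and bnd: "\<And>z. norm (L z) \<le> M * norm z"
  shows "bounded_cbilinear_on A (M * K) (\<lambda>x y. L (\<beta> x y))"
  unfolding bounded_cbilinear_on_def
proof (intro conjI ballI)
  note b = bounded_cbilinear_onD[OF \<beta>]
  show "0 \<le> M * K" using M b(1) by simp
  show "clinear_on A (\<lambda>y. L (\<beta> x y))" if "x \<in> A" for x
    using b(2)[OF that] L by (auto simp: clinear_on_def)
  show "clinear_on A (\<lambda>x. L (\<beta> x y))" if "y \<in> A" for y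
    using b(3)[OF that] L by (auto simp: clinear_on_def)
  fix x y assume "x \<in> A" "y \<in> A"
  have "norm (L (\<beta> x y)) \<le> M * norm (\<beta> x y)" by (rule bnd)
  also have "\<dots> \<le> M * (K * (norm x * norm y))" by (intro mult_left_mono b(4) M \<open>x \<in> A\<close> \<open>y \<in> A\<close>)
  finally show "norm (L (\<beta> x y)) \<le> M * K * (norm x * norm y)" by (simp add: mult.assoc)
qed

lemma bounded_cbilinear_on_scaleC:
  "bounded_cbilinear_on A K \<beta> \<Longrightarrow> bounded_cbilinear_on A (cmod c * K) (\<lambda>x y. c *\<^sub>C \<beta> x y)"
  by (rule bounded_cbilinear_on_compose)
    (auto simp: clinear_on_def scaleC_add_right scaleC_scaleC mult.commute norm_scaleC)

lemma bounded_cbilinear_on_diff: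
  assumes "bounded_cbilinear_on A K \<beta>" "bounded_cbilinear_on A K' \<beta>'"
  shows "bounded_cbilinear_on A (K + K') (\<lambda>x y. \<beta> x y - \<beta>' x y)"
  using bounded_cbilinear_on_add[OF assms(1) bounded_cbilinear_on_scaleC[OF assms(2), of "-1"]]
  by (simp add: scaleC_minus_one)

lemma bounded_cbilinear_on_mult:
  fixes f g :: "'a::complex_normed_vector \<Rightarrow> 'b::complex_normed_algebra"
  assumes f: "bounded_clinear_on A K f" and g: "bounded_clinear_on A M g"
  shows "bounded_cbilinear_on A (K * M) (\<lambda>x y. f x * g y)"
  unfolding bounded_cbilinear_on_def
proof (intro conjI ballI)
  note f = bounded_clinear_onD[OF f] and g = bounded_clinear_onD[OF g]
  show "0 \<le> K * M" using f g by simp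
  show "clinear_on A (\<lambda>y. f x * g y)" for x
    using g(2) by (auto simp: clinear_on_def distrib_left mult_scaleC_right)
  show "clinear_on A (\<lambda>x. f x * g y)" for y
    using f(2) by (auto simp: clinear_on_def distrib_right mult_scaleC_left)
  fix x y assume "x \<in> A" "y \<in> A"
  have "norm (f x * g y) \<le> norm (f x) * norm (g y)" by (rule norm_mult_ineq)
  also have "\<dots> \<le> (K * norm x) * (M * norm y)"
    using f g \<open>x \<in> A\<close> \<open>y \<in> A\<close> by (intro mult_mono) auto
  finally show "norm (f x * g y) \<le> K * M * (norm x * norm y)" by (simp add: mult_ac)
qed

lemma bounded_cbilinear_on_product_map:
  fixes A :: "'a::complex_normed_algebra set"
  assumes A: "csubalgebra A" and f: "bounded_clinear_on A K f"
  shows "bounded_cbilinear_on A K (\<lambda>x y. f (x * y))"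
  unfolding bounded_cbilinear_on_def
proof (intro conjI ballI)
  note f = bounded_clinear_onD[OF f]
  have m: "x * y \<in> A" if "x \<in> A" "y \<in> A" for x y using A that by (auto simp: csubalgebra_def)
  show "0 \<le> K" by (rule f)
  show "clinear_on A (\<lambda>y. f (x * y))" if "x \<in> A" for x
    using m that f(2) by (auto simp: clinear_on_def distrib_left mult_scaleC_right)
  show "clinear_on A (\<lambda>x. f (x * y))" if "y \<in> A" for y
    using m that f(2) by (auto simp: clinear_on_def distrib_right mult_scaleC_left)
  fix x y assume "x \<in> A" "y \<in> A"
  have "norm (f (x * y)) \<le> K * norm (x * y)" using m \<open>x \<in> A\<close> \<open>y \<in> A\<close> by (intro f)
  also have "\<dots> \<le> K * (norm x * norm y)" by (intro mult_left_mono norm_mult_ineq f)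
  finally show "norm (f (x * y)) \<le> K * (norm x * norm y)" .
qed

lemma bounded_cbilinear_on_fix_left:
  assumes "bounded_cbilinear_on A K \<beta>" "x \<in> A"
  shows "bounded_clinear_on A (K * norm x) (\<beta> x)"
  using assms by (auto simp: bounded_cbilinear_on_def bounded_clinear_on_def mult.assoc)

lemma bounded_cbilinear_on_fix_right:
  assumes "bounded_cbilinear_on A K \<beta>" "y \<in> A"
  shows "bounded_clinear_on A (K * norm y) (\<lambda>x. \<beta> x y)"
  using assms by (auto simp: bounded_cbilinear_on_def bounded_clinear_on_def mult_ac)

lemma bounded_clinear_on_add:
  assumes "bounded_clinear_on A K f" "bounded_clinear_on A M g"
  shows "bounded_clinear_on A (K + M) (\<lambda>x. f x + g x)"
  using assms unfolding bounded_clinear_on_def clinear_on_def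
  by (auto simp: scaleC_add_right distrib_right add_ac intro!: order_trans[OF norm_triangle_ineq] add_mono)

lemma bounded_clinear_on_id: "bounded_clinear_on A 1 (\<lambda>x. x)"
  by (auto simp: bounded_clinear_on_def clinear_on_def)

lemma bounded_clinear_on_mult_left:
  "bounded_clinear_on A (norm c) (\<lambda>x. c * (x::'a::complex_normed_algebra))"
  by (auto simp: bounded_clinear_on_def clinear_on_def distrib_left mult_scaleC_right norm_mult_ineq)

lemma bounded_clinear_on_mult_right:
  "bounded_clinear_on A (norm c) (\<lambda>x. (x::'a::complex_normed_algebra) * c)"
  using norm_mult_ineq[of _ c]
  by (auto simp: bounded_clinear_on_def clinear_on_def distrib_right mult_scaleC_left mult.commute[of "norm c"])

lemma second_adjoint_apply:
  "\<phi> \<in> dual_space W q \<Longrightarrow> second_adjoint V W q T u \<phi> = u (adjoint_on V T \<phi>)"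
  by (simp add: second_adjoint_def adjoint_on_def[of "dual_space W q"])

locale algebra_with_virtual_diagonal =
  fixes A :: "'h::complex_hilbert_space bop set" and u :: "'h bop ptensor_bidual"
  assumes algebra: "unital_operator_subalgebra A" and diagonal: "virtual_diagonal A u"
begin

abbreviation diagonal_norm :: real where "diagonal_norm \<equiv> virtual_diagonal_norm A u"

lemma subalgebra: "csubalgebra A" and one_mem: "1 \<in> A" and closed_A: "closed A"
  using algebra by (auto simp: unital_operator_subalgebra_def)

lemma subspace: "csubspace A" and mult_mem: "x \<in> A \<Longrightarrow> y \<in> A \<Longrightarrow> x * y \<in> A"
  using subalgebra by (auto simp: csubalgebra_def)

text \<open>The value at \<open>u\<close> of the functional defined by a bilinear form, to be thought of as
  \<open>\<integral> \<beta>(x, y) du(x, y)\<close>.\<close>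

definition pairing :: "('h bop \<Rightarrow> 'h bop \<Rightarrow> complex) \<Rightarrow> complex"
  where "pairing \<beta> = u (tensor_functional A \<beta>)"

lemma diagonal_clinear: "clinear_on (dual_space (ptensor A) (ptensor_norm A)) u"
  using diagonal by (auto simp: virtual_diagonal_def bidual_space_def dual_space_def[of "dual_space _ _"])

lemma pairing_bound:
  assumes "bounded_cbilinear_on A K \<beta>"
  shows "cmod (pairing \<beta>) \<le> diagonal_norm * K"
proof -
  note V = ptensor_subspace[OF subspace] and nn = ptensor_norm_nonneg[OF subspace]
    and p0 = ptensor_norm_zero[OF subspace]
  have u: "u \<in> bidual_space (ptensor A) (ptensor_norm A)" using diagonal by (simp add: virtual_diagonal_def)
  let ?D = "dual_space (ptensor A) (ptensor_norm A)" and ?n = "dual_norm (ptensor A) (ptensor_norm A)"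
  have dn: "0 \<le> ?n \<phi>" if "\<phi> \<in> ?D" for \<phi>
    using cmod_le_dual_norm[OF that nn csubspace_0[OF V]] norm_ge_zero[of "\<phi> 0"] p0 by linarith
  have "{cmod ((0::'h bop ptensor \<Rightarrow> complex) X) |X. X \<in> ptensor A \<and> ptensor_norm A X \<le> 1} = {0}"
    using csubspace_0[OF V] p0 by auto
  then have "?n 0 \<le> 1" by (simp add: dual_norm_def)
  moreover have "u \<in> dual_space ?D ?n" using u by (simp add: bidual_space_def)
  ultimately have "cmod (u 0) \<le> diagonal_norm"
    unfolding virtual_diagonal_norm_def bidual_norm_def
    by (intro cmod_le_dual_norm dn csubspace_0[OF dual_space_subspace])
  then have y: "0 \<le> diagonal_norm" using norm_ge_zero[of "u 0"] by linarith
  have "cmod (pairing \<beta>) \<le> diagonal_norm * ?n (tensor_functional A \<beta>)"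
    unfolding pairing_def virtual_diagonal_norm_def
    by (rule bidual_bound[OF V p0 nn u tensor_functional_dual[OF subspace assms]])
  also have "\<dots> \<le> diagonal_norm * K"
    by (intro mult_left_mono tensor_functional_norm[OF subspace assms] y)
  finally show ?thesis .
qed

lemma diagonal_norm_nonneg: "0 \<le> diagonal_norm"
proof -
  have "bounded_cbilinear_on A 1 (\<lambda>x y. 0 :: complex)"
    by (rule bounded_cbilinear_on_bound[OF bounded_cbilinear_on_zero]) auto
  from pairing_bound[OF this] show ?thesis using norm_ge_zero[of "pairing (\<lambda>x y. 0)"] by linarith
qed

lemma pairing_cong: "(\<And>x y. x \<in> A \<Longrightarrow> y \<in> A \<Longrightarrow> \<beta> x y = \<beta>' x y) \<Longrightarrow> pairing \<beta> = pairing \<beta>'"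
  unfolding pairing_def by (metis tensor_functional_cong)

lemma pairing_add:
  assumes "bounded_cbilinear_on A K \<beta>" "bounded_cbilinear_on A K' \<beta>'"
  shows "pairing (\<lambda>x y. \<beta> x y + \<beta>' x y) = pairing \<beta> + pairing \<beta>'"
  unfolding pairing_def tensor_functional_add[OF subspace assms]
  by (rule clinear_onD(1)[OF diagonal_clinear tensor_functional_dual[OF subspace assms(1)]
        tensor_functional_dual[OF subspace assms(2)]])

lemma pairing_mult_const:
  assumes "bounded_cbilinear_on A K \<beta>"
  shows "pairing (\<lambda>x y. c * \<beta> x y) = c * pairing \<beta>"
  unfolding pairing_def tensor_functional_scaleC[OF subspace assms]
  using clinear_onD(2)[OF diagonal_clinear tensor_functional_dual[OF subspace assms]]
  by (simp add: scaleC_complex_def)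

lemma pairing_sum:
  assumes "finite I" "\<And>i. i \<in> I \<Longrightarrow> bounded_cbilinear_on A (K i) (\<beta> i)"
  shows "bounded_cbilinear_on A (sum K I) (\<lambda>x y. \<Sum>i\<in>I. \<beta> i x y)"
    and "pairing (\<lambda>x y. \<Sum>i\<in>I. \<beta> i x y) = (\<Sum>i\<in>I. pairing (\<beta> i))"
proof -
  have "bounded_cbilinear_on A (sum K I) (\<lambda>x y. \<Sum>i\<in>I. \<beta> i x y) \<and>
    pairing (\<lambda>x y. \<Sum>i\<in>I. \<beta> i x y) = (\<Sum>i\<in>I. pairing (\<beta> i))"
    using assms
  proof (induction I)
    case empty
    show ?case using bounded_cbilinear_on_zero pairing_bound[OF bounded_cbilinear_on_zero] by simp
  next
    case (insert i I)
    then show ?case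
      using bounded_cbilinear_on_add[of A "K i" "\<beta> i" "sum K I" "\<lambda>x y. \<Sum>i\<in>I. \<beta> i x y"]
        pairing_add[of "K i" "\<beta> i" "sum K I" "\<lambda>x y. \<Sum>i\<in>I. \<beta> i x y"] by simp
  qed
  then show "bounded_cbilinear_on A (sum K I) (\<lambda>x y. \<Sum>i\<in>I. \<beta> i x y)"
    "pairing (\<lambda>x y. \<Sum>i\<in>I. \<beta> i x y) = (\<Sum>i\<in>I. pairing (\<beta> i))" by auto
qed

text \<open>The commutation rule \<open>a \<cdot> u = u \<cdot> a\<close>, tested against a bilinear form.\<close>

lemma pairing_shift:
  assumes \<beta>: "bounded_cbilinear_on A K \<beta>" and c: "c \<in> A"
  shows "pairing (\<lambda>x y. \<beta> (c * x) y) = pairing (\<lambda>x y. \<beta> x (y * c))"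
proof -
  note dual = tensor_functional_dual[OF subspace \<beta>]
  have "bidual_left A c u (tensor_functional A \<beta>) = bidual_right A c u (tensor_functional A \<beta>)"
    using diagonal c by (simp add: virtual_diagonal_def)
  moreover have "bidual_left A c u (tensor_functional A \<beta>) = pairing (\<lambda>x y. \<beta> (c * x) y)"
    unfolding bidual_left_def second_adjoint_apply[OF dual] ptensor_left_def pairing_def
    by (subst adjoint_tensor_map[OF subspace bounded_clinear_on_mult_left _ bounded_clinear_on_id])
      (use mult_mem c in auto)
  moreover have "bidual_right A c u (tensor_functional A \<beta>) = pairing (\<lambda>x y. \<beta> x (y * c))"
    unfolding bidual_right_def second_adjoint_apply[OF dual] ptensor_right_def pairing_def
    by (subst adjoint_tensor_map[OF subspace bounded_clinear_on_id _ bounded_clinear_on_mult_right])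
      (use mult_mem c in auto)
  ultimately show ?thesis by simp
qed

text \<open>The normalization \<open>m**(u) = 1\<close>, tested against a functional.  The limit defining the product of a
  tensor stays in \<open>A\<close>, where \<open>f\<close> is continuous, because \<open>A\<close> is norm closed.\<close>

lemma pairing_product:
  assumes f: "bounded_clinear_on A K f"
  shows "pairing (\<lambda>x y. f (x * y)) = f 1"
proof -
  \<comment> \<open>The normalization required of elements of \<open>dual_space\<close>.\<close>
  define g where "g x = (if x \<in> A then f x else 0)" for x
  note fD = bounded_clinear_onD[OF f]
  have lin: "clinear_on A g"
    using fD(2) csubspace_add[OF subspace] csubspace_scaleC[OF subspace] by (auto simp: clinear_on_def g_def)
  have g: "g \<in> dual_space A norm"
    unfolding dual_space_def using lin fD(3) by (auto simp: g_def)
  have prod: "bounded_cbilinear_on A 1 (\<lambda>x y. x * y :: 'h bop)"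
    by (rule bounded_cbilinear_on_product_map[OF subalgebra bounded_clinear_on_id])
  have "g (ptensor_mult X) = tensor_functional A (\<lambda>x y. f (x * y)) X" if X: "X \<in> ptensor A" for X
  proof -
    let ?s = "\<lambda>n. free_extend (\<lambda>x y. x * y) (X n)"
    have lim: "?s \<longlonglongrightarrow> ptensor_mult X"
      unfolding ptensor_mult_def by (rule free_extend_LIMSEQ[OF subspace prod X])
    have sA: "?s n \<in> A" for n
      by (rule free_extend_in_subspace[OF subspace mult_mem ptensorD(1)[OF X]])
    have mA: "ptensor_mult X \<in> A" by (rule closed_sequentially[OF closed_A sA lim])
    have "(\<lambda>n. K * norm (?s n - ptensor_mult X)) \<longlonglongrightarrow> K * norm (ptensor_mult X - ptensor_mult X)"
      by (intro tendsto_intros lim)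
    then have "(\<lambda>n. g (?s n) - g (ptensor_mult X)) \<longlonglongrightarrow> 0"
    proof (intro Lim_null_comparison[of "\<lambda>n. g (?s n) - g (ptensor_mult X)" "\<lambda>n. K * norm (?s n - ptensor_mult X)"] always_eventually allI)
      fix n
      have "g (?s n) - g (ptensor_mult X) = g (?s n - ptensor_mult X)"
        by (rule clinear_on_diff[OF lin subspace sA mA, symmetric])
      then show "norm (g (?s n) - g (ptensor_mult X)) \<le> K * norm (?s n - ptensor_mult X)"
        using fD(3)[OF csubspace_diff[OF subspace sA mA]] csubspace_diff[OF subspace sA mA]
        by (simp add: g_def)
    qed simp
    then have "(\<lambda>n. g (?s n)) \<longlonglongrightarrow> g (ptensor_mult X)" by (simp add: Lim_null[symmetric])
    moreover have "g (?s n) = free_extend (\<lambda>x y. f (x * y)) (X n)" for n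
      using free_extend_compose[OF lin subspace mult_mem ptensorD(1)[OF X]]
        free_extend_cong[OF ptensorD(1)[OF X], of "\<lambda>x y. g (x * y)" "\<lambda>x y. f (x * y)"]
      by (simp add: g_def mult_mem)
    ultimately show ?thesis using X by (intro tensor_functional_eqI[symmetric]) auto
  qed
  then have "adjoint_on (ptensor A) ptensor_mult g = tensor_functional A (\<lambda>x y. f (x * y))"
    by (auto simp: adjoint_on_def tensor_functional_def fun_eq_iff)
  then have "pairing (\<lambda>x y. f (x * y)) = bidual_mult A u g"
    unfolding bidual_mult_def second_adjoint_apply[OF g] pairing_def by simp
  also have "\<dots> = canonical_embedding A norm 1 g" using diagonal by (simp add: virtual_diagonal_def)
  also have "\<dots> = f 1" using g one_mem by (simp add: canonical_embedding_def g_def)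
  finally show ?thesis .
qed

text \<open>The weak integral \<open>\<integral> \<Phi>(x, y) du(x, y)\<close> of an operator-valued bilinear map, defined by its matrix
  coefficients.\<close>

definition diag_integral :: "('h bop \<Rightarrow> 'h bop \<Rightarrow> 'h bop) \<Rightarrow> 'h bop"
  where "diag_integral \<Phi> = (SOME T. \<forall>\<xi> \<eta>. cinner \<xi> (bop_apply T \<eta>) =
    pairing (\<lambda>x y. cinner \<xi> (bop_apply (\<Phi> x y) \<eta>)))"

lemma matrix_coefficient_bilinear:
  fixes \<Phi> :: "'h bop \<Rightarrow> 'h bop \<Rightarrow> 'h bop"
  assumes "bounded_cbilinear_on A K \<Phi>"
  shows "bounded_cbilinear_on A (norm \<xi> * norm \<eta> * K) (\<lambda>x y. cinner \<xi> (bop_apply (\<Phi> x y) \<eta>))"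
proof (rule bounded_cbilinear_on_compose[OF assms])
  show "clinear_on UNIV (\<lambda>z. cinner \<xi> (bop_apply z \<eta>))"
    by (auto simp: clinear_on_def bop_apply_simps cinner_add_right cinner_scaleC_right scaleC_complex_def)
  fix z :: "'h bop"
  have "norm (cinner \<xi> (bop_apply z \<eta>)) \<le> norm \<xi> * norm (bop_apply z \<eta>)" by (rule cauchy_schwarz)
  also have "\<dots> \<le> norm \<xi> * (norm z * norm \<eta>)" by (intro mult_left_mono norm_bop_apply) auto
  finally show "norm (cinner \<xi> (bop_apply z \<eta>)) \<le> norm \<xi> * norm \<eta> * norm z" by (simp add: mult_ac)
qed simp

lemma diag_integral_exists:
  fixes \<Phi> :: "'h bop \<Rightarrow> 'h bop \<Rightarrow> 'h bop"
  assumes \<Phi>: "bounded_cbilinear_on A K \<Phi>"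
  shows "\<exists>T. (\<forall>\<xi> \<eta>. cinner \<xi> (bop_apply T \<eta>) = pairing (\<lambda>x y. cinner \<xi> (bop_apply (\<Phi> x y) \<eta>)))
    \<and> norm T \<le> diagonal_norm * K"
proof (rule sesquilinear_form_operator)
  note m = matrix_coefficient_bilinear[OF \<Phi>]
  show "clinear_on UNIV (\<lambda>\<eta>. pairing (\<lambda>x y. cinner \<xi> (bop_apply (\<Phi> x y) \<eta>)))" for \<xi>
    using pairing_add[OF m m] pairing_mult_const[OF m]
    by (auto simp: clinear_on_def bop_apply_simps cinner_add_right cinner_scaleC_right scaleC_complex_def)
  show "clinear_on UNIV (\<lambda>\<xi>. cnj (pairing (\<lambda>x y. cinner \<xi> (bop_apply (\<Phi> x y) \<eta>))))" for \<eta>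
    using pairing_add[OF m m] pairing_mult_const[OF m]
    by (auto simp: clinear_on_def cinner_add_left cinner_scaleC_left scaleC_complex_def)
  fix \<xi> \<eta> :: 'h
  show "cmod (pairing (\<lambda>x y. cinner \<xi> (bop_apply (\<Phi> x y) \<eta>))) \<le> diagonal_norm * K * norm \<xi> * norm \<eta>"
    using pairing_bound[OF m[of \<xi> \<eta>]] by (simp add: mult_ac)
next
  show "0 \<le> diagonal_norm * K"
    using diagonal_norm_nonneg bounded_cbilinear_onD(1)[OF \<Phi>] by (rule mult_nonneg_nonneg)
qed

lemma diag_integral_coefficient:
  assumes "bounded_cbilinear_on A K \<Phi>"
  shows "cinner \<xi> (bop_apply (diag_integral \<Phi>) \<eta>) = pairing (\<lambda>x y. cinner \<xi> (bop_apply (\<Phi> x y) \<eta>))"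
proof -
  have "\<exists>T. \<forall>\<xi> \<eta>. cinner \<xi> (bop_apply T \<eta>) = pairing (\<lambda>x y. cinner \<xi> (bop_apply (\<Phi> x y) \<eta>))"
    using diag_integral_exists[OF assms] by blast
  from someI_ex[OF this] show ?thesis unfolding diag_integral_def by blast
qed

lemma diag_integral_eqI:
  assumes "bounded_cbilinear_on A K \<Phi>"
    "\<And>\<xi> \<eta>. cinner \<xi> (bop_apply T \<eta>) = pairing (\<lambda>x y. cinner \<xi> (bop_apply (\<Phi> x y) \<eta>))"
  shows "diag_integral \<Phi> = T"
  by (rule bop_eqI, rule cinner_eqI) (simp add: diag_integral_coefficient[OF assms(1)] assms(2))

lemma diag_integral_norm:
  assumes "bounded_cbilinear_on A K \<Phi>"
  shows "norm (diag_integral \<Phi>) \<le> diagonal_norm * K"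
proof -
  obtain T where T: "\<And>\<xi> \<eta>. cinner \<xi> (bop_apply T \<eta>) = pairing (\<lambda>x y. cinner \<xi> (bop_apply (\<Phi> x y) \<eta>))"
    "norm T \<le> diagonal_norm * K"
    using diag_integral_exists[OF assms] by blast
  then show ?thesis using diag_integral_eqI[OF assms T(1)] by simp
qed

lemma diag_integral_cong:
  "(\<And>x y. x \<in> A \<Longrightarrow> y \<in> A \<Longrightarrow> \<Phi> x y = \<Phi>' x y) \<Longrightarrow> diag_integral \<Phi> = diag_integral \<Phi>'"
  unfolding diag_integral_def using pairing_cong[of "\<lambda>x y. cinner _ (bop_apply (\<Phi> x y) _)" "\<lambda>x y. cinner _ (bop_apply (\<Phi>' x y) _)"]
  by simp

lemma diag_integral_add:
  assumes \<Phi>: "bounded_cbilinear_on A K \<Phi>" and \<Phi>': "bounded_cbilinear_on A K' \<Phi>'"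
  shows "diag_integral (\<lambda>x y. \<Phi> x y + \<Phi>' x y) = diag_integral \<Phi> + diag_integral \<Phi>'"
  by (rule diag_integral_eqI[OF bounded_cbilinear_on_add[OF \<Phi> \<Phi>']])
    (simp add: bop_apply_simps cinner_add_right diag_integral_coefficient[OF \<Phi>] diag_integral_coefficient[OF \<Phi>']
      pairing_add[OF matrix_coefficient_bilinear[OF \<Phi>] matrix_coefficient_bilinear[OF \<Phi>']])

lemma diag_integral_scaleC:
  assumes \<Phi>: "bounded_cbilinear_on A K \<Phi>"
  shows "diag_integral (\<lambda>x y. c *\<^sub>C \<Phi> x y) = c *\<^sub>C diag_integral \<Phi>"
  by (rule diag_integral_eqI[OF bounded_cbilinear_on_scaleC[OF \<Phi>]])
    (simp add: bop_apply_simps cinner_scaleC_right diag_integral_coefficient[OF \<Phi>]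
      pairing_mult_const[OF matrix_coefficient_bilinear[OF \<Phi>]])

lemma diag_integral_diff:
  assumes \<Phi>: "bounded_cbilinear_on A K \<Phi>" and \<Phi>': "bounded_cbilinear_on A K' \<Phi>'"
  shows "diag_integral (\<lambda>x y. \<Phi> x y - \<Phi>' x y) = diag_integral \<Phi> - diag_integral \<Phi>'"
  using diag_integral_add[OF \<Phi> bounded_cbilinear_on_scaleC[OF \<Phi>', of "-1"]] diag_integral_scaleC[OF \<Phi>', of "-1"]
  by (simp add: scaleC_minus_one)

lemma bilinear_mult_left:
  assumes \<Phi>: "bounded_cbilinear_on A K (\<Phi> :: _ \<Rightarrow> _ \<Rightarrow> 'h bop)"
  shows "bounded_cbilinear_on A (norm S * K) (\<lambda>x y. S * \<Phi> x y)"
  by (rule bounded_cbilinear_on_compose[OF \<Phi>])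
    (auto simp: clinear_on_def distrib_left mult_scaleC_right norm_mult_ineq)

lemma bilinear_mult_right:
  assumes \<Phi>: "bounded_cbilinear_on A K (\<Phi> :: _ \<Rightarrow> _ \<Rightarrow> 'h bop)"
  shows "bounded_cbilinear_on A (norm S * K) (\<lambda>x y. \<Phi> x y * S)"
  by (rule bounded_cbilinear_on_compose[OF \<Phi>])
    (auto simp: clinear_on_def distrib_right mult_scaleC_left norm_mult_ineq mult.commute[of "norm S"])

lemma diag_integral_mult_left:
  assumes \<Phi>: "bounded_cbilinear_on A K \<Phi>"
  shows "diag_integral (\<lambda>x y. S * \<Phi> x y) = S * diag_integral \<Phi>"
  by (rule diag_integral_eqI[OF bilinear_mult_left[OF \<Phi>]])
    (simp add: bop_apply_simps cinner_bop_adjoint_left[of S, symmetric] diag_integral_coefficient[OF \<Phi>])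

lemma diag_integral_mult_right:
  assumes \<Phi>: "bounded_cbilinear_on A K \<Phi>"
  shows "diag_integral (\<lambda>x y. \<Phi> x y * S) = diag_integral \<Phi> * S"
  by (rule diag_integral_eqI[OF bilinear_mult_right[OF \<Phi>]])
    (simp add: bop_apply_simps diag_integral_coefficient[OF \<Phi>])

lemma bilinear_substitute:
  assumes \<beta>: "bounded_cbilinear_on A K \<beta>"
    and g: "bounded_clinear_on A G g" and gA: "g ` A \<subseteq> A"
    and h: "bounded_clinear_on A H h" and hA: "h ` A \<subseteq> A"
  shows "bounded_cbilinear_on A (K * (G * H)) (\<lambda>x y. \<beta> (g x) (h y))"
  unfolding bounded_cbilinear_on_def
proof (intro conjI ballI)
  note b = bounded_cbilinear_onD[OF \<beta>] and g = bounded_clinear_onD[OF g] and h = bounded_clinear_onD[OF h]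
  have mem: "g x \<in> A" "h x \<in> A" if "x \<in> A" for x using gA hA that by auto
  show "0 \<le> K * (G * H)" using b(1) g(1) h(1) by simp
  show "clinear_on A (\<lambda>y. \<beta> (g x) (h y))" if "x \<in> A" for x
    using b(2)[OF mem(1)[OF that]] h(2) mem by (auto simp: clinear_on_def)
  show "clinear_on A (\<lambda>x. \<beta> (g x) (h y))" if "y \<in> A" for y
    using b(3)[OF mem(2)[OF that]] g(2) mem by (auto simp: clinear_on_def)
  fix x y assume xy: "x \<in> A" "y \<in> A"
  have "norm (\<beta> (g x) (h y)) \<le> K * (norm (g x) * norm (h y))" using mem xy by (intro b)
  also have "\<dots> \<le> K * ((G * norm x) * (H * norm y))"
    using b(1) g h xy by (intro mult_left_mono mult_mono) auto
  finally show "norm (\<beta> (g x) (h y)) \<le> K * (G * H) * (norm x * norm y)" by (simp add: mult_ac)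
qed

lemma diag_integral_shift:
  assumes \<Phi>: "bounded_cbilinear_on A K \<Phi>" and c: "c \<in> A"
  shows "diag_integral (\<lambda>x y. \<Phi> (c * x) y) = diag_integral (\<lambda>x y. \<Phi> x (y * c))"
proof (rule diag_integral_eqI)
  show "bounded_cbilinear_on A (K * (norm c * 1)) (\<lambda>x y. \<Phi> (c * x) y)"
    by (rule bilinear_substitute[OF \<Phi> bounded_clinear_on_mult_left _ bounded_clinear_on_id])
      (use mult_mem c in auto)
  have "bounded_cbilinear_on A (K * (1 * norm c)) (\<lambda>x y. \<Phi> x (y * c))"
    by (rule bilinear_substitute[OF \<Phi> bounded_clinear_on_id _ bounded_clinear_on_mult_right])
      (use mult_mem c in auto)
  from diag_integral_coefficient[OF this] pairing_shift[OF matrix_coefficient_bilinear[OF \<Phi>] c]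
  show "cinner \<xi> (bop_apply (diag_integral (\<lambda>x y. \<Phi> x (y * c))) \<eta>) = pairing (\<lambda>x y. cinner \<xi> (bop_apply (\<Phi> (c * x) y) \<eta>))" for \<xi> \<eta>
    by simp
qed

lemma diag_integral_product:
  assumes f: "bounded_clinear_on A K f"
  shows "diag_integral (\<lambda>x y. f (x * y)) = f 1"
proof (rule diag_integral_eqI[OF bounded_cbilinear_on_product_map[OF subalgebra f]])
  fix \<xi> \<eta>
  have "bounded_clinear_on A (norm \<xi> * norm \<eta> * K) (\<lambda>x. cinner \<xi> (bop_apply (f x) \<eta>))"
    unfolding bounded_clinear_on_def
  proof (intro conjI ballI)
    note fD = bounded_clinear_onD[OF f]
    show "0 \<le> norm \<xi> * norm \<eta> * K" using fD(1) by simp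
    show "clinear_on A (\<lambda>x. cinner \<xi> (bop_apply (f x) \<eta>))"
      using fD(2) by (auto simp: clinear_on_def bop_apply_simps cinner_add_right cinner_scaleC_right scaleC_complex_def)
    fix x assume x: "x \<in> A"
    have "norm (cinner \<xi> (bop_apply (f x) \<eta>)) \<le> norm \<xi> * norm (bop_apply (f x) \<eta>)" by (rule cauchy_schwarz)
    also have "\<dots> \<le> norm \<xi> * (norm (f x) * norm \<eta>)" by (intro mult_left_mono norm_bop_apply) auto
    also have "\<dots> \<le> norm \<xi> * ((K * norm x) * norm \<eta>)"
      by (intro mult_left_mono mult_right_mono fD(3) x) auto
    finally show "norm (cinner \<xi> (bop_apply (f x) \<eta>)) \<le> norm \<xi> * norm \<eta> * K * norm x" by (simp add: mult_ac)
  qed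
  from pairing_product[OF this]
  show "cinner \<xi> (bop_apply (f 1) \<eta>) = pairing (\<lambda>x y. cinner \<xi> (bop_apply (f (x * y)) \<eta>))" by simp
qed

text \<open>The defining property of the integral covers matrix coefficients; trace functionals are norm limits
  of finite sums of these, and both sides are norm continuous.\<close>

lemma trace_diag_integral:
  assumes \<Phi>: "bounded_cbilinear_on A K \<Phi>" and T: "trace_class T"
  shows "op_trace (diag_integral \<Phi> * T) = pairing (\<lambda>x y. op_trace (\<Phi> x y * T))"
proof -
  obtain C where C: "0 \<le> C" "\<And>X. cmod (op_trace (X * T)) \<le> C * norm X" using op_trace_bounded[OF T] by blast
  have tr: "bounded_cbilinear_on A (C * K) (\<lambda>x y. op_trace (\<Phi> x y * T))"
    by (rule bounded_cbilinear_on_compose[OF \<Phi> op_trace_clinear[OF T] C(1)]) (use C(2) in simp)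
  note K = bounded_cbilinear_onD(1)[OF \<Phi>]
  define B where "B = norm (diag_integral \<Phi>) + diagonal_norm * K"
  have "cmod (op_trace (diag_integral \<Phi> * T) - pairing (\<lambda>x y. op_trace (\<Phi> x y * T))) \<le> d * B" if d: "0 < d" for d
  proof -
    obtain F where F: "finite F"
      "\<And>X. cmod (op_trace (X * T) - (\<Sum>e\<in>F. cinner e (bop_apply (X * T) e))) \<le> d * norm X"
      using trace_approximation[OF T d] by blast
    define L where "L X = op_trace (X * T) - (\<Sum>e\<in>F. cinner e (bop_apply (X * T) e))" for X
    have m: "bounded_cbilinear_on A (norm e * norm (bop_apply T e) * K) (\<lambda>x y. cinner e (bop_apply (\<Phi> x y * T) e))" for e
      using matrix_coefficient_bilinear[OF \<Phi>, of e "bop_apply T e"] by (simp add: bop_apply_simps)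
    have coeff: "cinner e (bop_apply (diag_integral \<Phi> * T) e) = pairing (\<lambda>x y. cinner e (bop_apply (\<Phi> x y * T) e))" for e
      by (simp add: bop_apply_simps diag_integral_coefficient[OF \<Phi>])
    note ms = pairing_sum[OF F(1) m]
    have "bounded_cbilinear_on A (d * K) (\<lambda>x y. L (\<Phi> x y))"
    proof (rule bounded_cbilinear_on_compose[OF \<Phi>])
      show "clinear_on UNIV L"
        using clinear_onD[OF op_trace_clinear[OF T]]
        by (auto simp: clinear_on_def L_def bop_apply_simps cinner_add_right cinner_scaleC_right
            sum.distrib scaleC_complex_def sum_distrib_left right_diff_distrib)
    qed (use d F(2) in \<open>auto simp: L_def\<close>)
    from pairing_bound[OF this] have b: "cmod (pairing (\<lambda>x y. L (\<Phi> x y))) \<le> d * (diagonal_norm * K)"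
      by (simp add: mult_ac)
    have "pairing (\<lambda>x y. L (\<Phi> x y) + (\<Sum>e\<in>F. cinner e (bop_apply (\<Phi> x y * T) e)))
        = pairing (\<lambda>x y. L (\<Phi> x y)) + pairing (\<lambda>x y. \<Sum>e\<in>F. cinner e (bop_apply (\<Phi> x y * T) e))"
      by (rule pairing_add) fact+
    then have "pairing (\<lambda>x y. op_trace (\<Phi> x y * T)) = pairing (\<lambda>x y. L (\<Phi> x y))
        + (\<Sum>e\<in>F. cinner e (bop_apply (diag_integral \<Phi> * T) e))"
      by (simp add: L_def ms(2) coeff)
    then have "op_trace (diag_integral \<Phi> * T) - pairing (\<lambda>x y. op_trace (\<Phi> x y * T))
        = L (diag_integral \<Phi>) - pairing (\<lambda>x y. L (\<Phi> x y))"
      by (simp add: L_def)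
    also have "cmod \<dots> \<le> cmod (L (diag_integral \<Phi>)) + cmod (pairing (\<lambda>x y. L (\<Phi> x y)))"
      by (rule norm_triangle_ineq4)
    also have "\<dots> \<le> d * B"
      using b F(2)[of "diag_integral \<Phi>"] by (simp add: B_def L_def distrib_left)
    finally show ?thesis .
  qed
  then have "\<forall>\<^sub>F d in at_right 0.
      cmod (op_trace (diag_integral \<Phi> * T) - pairing (\<lambda>x y. op_trace (\<Phi> x y * T))) \<le> d * B"
    by (simp add: eventually_at_filter)
  moreover have "((\<lambda>d. d * B) \<longlongrightarrow> 0 * B) (at_right 0)" by (intro tendsto_intros)
  ultimately have "cmod (op_trace (diag_integral \<Phi> * T) - pairing (\<lambda>x y. op_trace (\<Phi> x y * T))) \<le> 0 * B"
    by (intro tendsto_lowerbound) (auto simp: trivial_limit_at_right_real)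
  then show ?thesis by simp
qed

text \<open>A trace functional that vanishes on \<open>M\<close> vanishes on the integrand, hence on the integral.\<close>

lemma diag_integral_mem_wstar_closed:
  assumes \<Phi>: "bounded_cbilinear_on A K \<Phi>" and cl: "closedin wstar_topology M" and M: "csubspace M"
    and mem: "\<And>x y. x \<in> A \<Longrightarrow> y \<in> A \<Longrightarrow> \<Phi> x y \<in> M"
  shows "diag_integral \<Phi> \<in> M"
proof (rule wstar_closed_subspace_memI[OF cl M])
  fix I and a :: "'h bop \<Rightarrow> complex"
  assume I: "finite I" "\<And>T. T \<in> I \<Longrightarrow> trace_class T"
    and zero: "\<And>Y. Y \<in> M \<Longrightarrow> (\<Sum>T\<in>I. a T * op_trace (Y * T)) = 0"
  have "\<exists>C. bounded_cbilinear_on A C (\<lambda>x y. op_trace (\<Phi> x y * T))" if T: "trace_class T" for T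
  proof -
    obtain C where "0 \<le> C" "\<And>X. cmod (op_trace (X * T)) \<le> C * norm X" using op_trace_bounded[OF T] by blast
    then show ?thesis using bounded_cbilinear_on_compose[OF \<Phi> op_trace_clinear[OF T]] by blast
  qed
  then obtain C where C: "\<And>T. trace_class T \<Longrightarrow> bounded_cbilinear_on A (C T) (\<lambda>x y. op_trace (\<Phi> x y * T))" by metis
  have aC: "bounded_cbilinear_on A (cmod (a T) * C T) (\<lambda>x y. a T * op_trace (\<Phi> x y * T))" if "T \<in> I" for T
    using bounded_cbilinear_on_scaleC[OF C[OF I(2)[OF that]], of "a T"] by (simp add: scaleC_complex_def)
  have "(\<Sum>T\<in>I. a T * op_trace (diag_integral \<Phi> * T)) = (\<Sum>T\<in>I. pairing (\<lambda>x y. a T * op_trace (\<Phi> x y * T)))"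
    using I(2) by (intro sum.cong) (auto simp: trace_diag_integral[OF \<Phi>] pairing_mult_const[OF C])
  also have "\<dots> = pairing (\<lambda>x y. \<Sum>T\<in>I. a T * op_trace (\<Phi> x y * T))"
    by (rule pairing_sum(2)[OF I(1) aC, symmetric])
  also have "\<dots> = pairing (\<lambda>x y. 0)" by (intro pairing_cong zero mem)
  also have "\<dots> = 0" using pairing_bound[OF bounded_cbilinear_on_zero] by simp
  finally show "(\<Sum>T\<in>I. a T * op_trace (diag_integral \<Phi> * T)) = 0" .
qed

end

section \<open>Near homomorphisms\<close>

definition defect :: "('a::{times,ab_group_add} \<Rightarrow> 'b::{times,ab_group_add}) \<Rightarrow> 'a \<Rightarrow> 'a \<Rightarrow> 'b"
  where "defect \<phi> x y = \<phi> (x * y) - \<phi> x * \<phi> y"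

text \<open>Both ways of bracketing \<open>\<phi> (b c d)\<close> lead to a cocycle identity for the defect, multiplied here by
  \<open>\<phi> a\<close>.\<close>

lemma defect_cocycle:
  fixes \<phi> :: "'a::ring \<Rightarrow> 'b::ring"
  shows "\<phi> a * defect \<phi> b c * \<phi> d
    = \<phi> a * \<phi> b * defect \<phi> c d - \<phi> a * defect \<phi> (b * c) d + \<phi> a * defect \<phi> b (c * d)"
  by (simp add: defect_def algebra_simps)

context algebra_with_virtual_diagonal
begin

definition near_homomorphism :: "'h bop set \<Rightarrow> real \<Rightarrow> real \<Rightarrow> ('h bop \<Rightarrow> 'h bop) \<Rightarrow> bool"
  where "near_homomorphism N K \<delta> \<phi> \<longleftrightarrow> bounded_clinear_on A K \<phi> \<and> \<phi> ` A \<subseteq> N \<and> \<phi> 1 = 1 \<and> 0 \<le> \<delta> \<and>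
    (\<forall>x\<in>A. \<forall>y\<in>A. norm (defect \<phi> x y) \<le> \<delta> * (norm x * norm y))"

text \<open>To first order the defect is a Hochschild 2-cocycle, and integration against a virtual diagonal is
  the standard way of writing it as a coboundary.\<close>

definition correction :: "('h bop \<Rightarrow> 'h bop) \<Rightarrow> 'h bop \<Rightarrow> 'h bop"
  where "correction \<phi> c = diag_integral (\<lambda>a b. \<phi> a * defect \<phi> b c)"

definition newton_step :: "('h bop \<Rightarrow> 'h bop) \<Rightarrow> 'h bop \<Rightarrow> 'h bop"
  where "newton_step \<phi> c = \<phi> c + correction \<phi> c"

lemma defect_bilinear:
  assumes "near_homomorphism N K \<delta> \<phi>"
  shows "bounded_cbilinear_on A \<delta> (defect \<phi>)"
proof -
  have \<phi>: "bounded_clinear_on A K \<phi>" using assms by (simp add: near_homomorphism_def)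
  have "bounded_cbilinear_on A (K + K * K) (\<lambda>x y. \<phi> (x * y) - \<phi> x * \<phi> y)"
    by (intro bounded_cbilinear_on_diff bounded_cbilinear_on_product_map[OF subalgebra] bounded_cbilinear_on_mult \<phi>)
  then have "bounded_cbilinear_on A (K + K * K) (defect \<phi>)" unfolding defect_def .
  then show ?thesis
    by (rule bounded_cbilinear_on_bound) (use assms in \<open>auto simp: near_homomorphism_def\<close>)
qed

lemma correction_bilinear:
  assumes nh: "near_homomorphism N K \<delta> \<phi>" and c: "c \<in> A"
  shows "bounded_cbilinear_on A (K * (\<delta> * norm c)) (\<lambda>a b. \<phi> a * defect \<phi> b c)"
  using nh by (intro bounded_cbilinear_on_mult bounded_cbilinear_on_fix_right[OF defect_bilinear[OF nh] c])
    (simp add: near_homomorphism_def)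

lemma correction_clinear:
  assumes nh: "near_homomorphism N K \<delta> \<phi>"
  shows "bounded_clinear_on A (diagonal_norm * K * \<delta>) (correction \<phi>)"
  unfolding bounded_clinear_on_def
proof (intro conjI ballI)
  note D = bounded_cbilinear_onD[OF defect_bilinear[OF nh]]
  have \<phi>: "bounded_clinear_on A K \<phi>" using nh by (simp add: near_homomorphism_def)
  show "0 \<le> diagonal_norm * K * \<delta>"
    using diagonal_norm_nonneg bounded_clinear_onD(1)[OF \<phi>] D(1) by simp
  show "clinear_on A (correction \<phi>)"
    unfolding clinear_on_def
  proof (intro conjI ballI allI)
    fix x y r assume x: "x \<in> A"
    have "correction \<phi> (r *\<^sub>C x) = diag_integral (\<lambda>a b. r *\<^sub>C (\<phi> a * defect \<phi> b x))"
      unfolding correction_def using clinear_onD(2)[OF D(2)] x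
      by (intro diag_integral_cong) (simp add: mult_scaleC_right)
    then show "correction \<phi> (r *\<^sub>C x) = r *\<^sub>C correction \<phi> x"
      using diag_integral_scaleC[OF correction_bilinear[OF nh x]] by (simp add: correction_def)
    assume y: "y \<in> A"
    have "correction \<phi> (x + y) = diag_integral (\<lambda>a b. \<phi> a * defect \<phi> b x + \<phi> a * defect \<phi> b y)"
      unfolding correction_def using clinear_onD(1)[OF D(2)] x y
      by (intro diag_integral_cong) (simp add: distrib_left)
    then show "correction \<phi> (x + y) = correction \<phi> x + correction \<phi> y"
      using diag_integral_add[OF correction_bilinear[OF nh x] correction_bilinear[OF nh y]] by (simp add: correction_def)
  qed
  fix x assume "x \<in> A"
  from diag_integral_norm[OF correction_bilinear[OF nh this]]
  show "norm (correction \<phi> x) \<le> diagonal_norm * K * \<delta> * norm x" by (simp add: correction_def mult_ac)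
qed

text \<open>The cocycle identity turns \<open>correction \<phi> c * \<phi> d\<close> into three integrals.  The first is evaluated by
  the normalization of \<open>u\<close>, the second is shifted by the commutation rule, and after that all terms
  of first order in the defect cancel.\<close>

lemma newton_step_defect:
  assumes nh: "near_homomorphism N K \<delta> \<phi>" and c: "c \<in> A" and d: "d \<in> A"
  shows "defect (newton_step \<phi>) c d = diag_integral (defect \<phi>) * defect \<phi> c d
    + diag_integral (\<lambda>a b. defect \<phi> c a * defect \<phi> b d) - correction \<phi> c * correction \<phi> d"
proof -
  have \<phi>: "bounded_clinear_on A K \<phi>" and one: "\<phi> 1 = 1" using nh by (auto simp: near_homomorphism_def)
  note D = defect_bilinear[OF nh] and cb = correction_bilinear[OF nh]
  have cd: "c * d \<in> A" by (rule mult_mem[OF c d])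
  have pp: "bounded_cbilinear_on A (K * K) (\<lambda>a b. \<phi> a * \<phi> b)" by (rule bounded_cbilinear_on_mult[OF \<phi> \<phi>])
  have "diag_integral (\<lambda>a b. \<phi> a * \<phi> b) = diag_integral (\<lambda>a b. \<phi> (a * b) - defect \<phi> a b)"
    by (simp add: defect_def)
  also have "\<dots> = 1 - diag_integral (defect \<phi>)"
    by (simp add: diag_integral_diff[OF bounded_cbilinear_on_product_map[OF subalgebra \<phi>] D] diag_integral_product[OF \<phi>] one)
  finally have first: "diag_integral (\<lambda>a b. \<phi> a * \<phi> b * defect \<phi> c d) = (1 - diag_integral (defect \<phi>)) * defect \<phi> c d"
    using diag_integral_mult_right[OF pp] by simp
  have DD: "bounded_cbilinear_on A (\<delta> * norm c * (\<delta> * norm d)) (\<lambda>a b. defect \<phi> c a * defect \<phi> b d)"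
    by (intro bounded_cbilinear_on_mult bounded_cbilinear_on_fix_left[OF D c] bounded_cbilinear_on_fix_right[OF D d])
  have "diag_integral (\<lambda>a b. \<phi> a * defect \<phi> (b * c) d) = diag_integral (\<lambda>a b. \<phi> (c * a) * defect \<phi> b d)"
    using diag_integral_shift[OF cb[OF d] c] by simp
  also have "\<dots> = diag_integral (\<lambda>a b. defect \<phi> c a * defect \<phi> b d + \<phi> c * (\<phi> a * defect \<phi> b d))"
    by (intro diag_integral_cong) (simp add: defect_def[of \<phi> c] algebra_simps)
  also have "\<dots> = diag_integral (\<lambda>a b. defect \<phi> c a * defect \<phi> b d) + \<phi> c * correction \<phi> d"
    by (simp add: diag_integral_add[OF DD bilinear_mult_left[OF cb[OF d]]] diag_integral_mult_left[OF cb[OF d]] correction_def)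
  finally have second: "diag_integral (\<lambda>a b. \<phi> a * defect \<phi> (b * c) d)
    = diag_integral (\<lambda>a b. defect \<phi> c a * defect \<phi> b d) + \<phi> c * correction \<phi> d" .
  have b1: "bounded_cbilinear_on A (norm (defect \<phi> c d) * (K * K)) (\<lambda>a b. \<phi> a * \<phi> b * defect \<phi> c d)"
    by (rule bilinear_mult_right[OF pp])
  have b2: "bounded_cbilinear_on A (K * (\<delta> * norm d) * (1 * norm c)) (\<lambda>a b. \<phi> a * defect \<phi> (b * c) d)"
    by (rule bilinear_substitute[OF cb[OF d] bounded_clinear_on_id _ bounded_clinear_on_mult_right])
      (use mult_mem c in auto)
  have "correction \<phi> c * \<phi> d = diag_integral (\<lambda>a b. \<phi> a * defect \<phi> b c * \<phi> d)"
    unfolding correction_def by (rule diag_integral_mult_right[OF cb[OF c], symmetric])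
  also have "\<dots> = diag_integral (\<lambda>a b. \<phi> a * \<phi> b * defect \<phi> c d - \<phi> a * defect \<phi> (b * c) d + \<phi> a * defect \<phi> b (c * d))"
    by (simp only: defect_cocycle)
  also have "\<dots> = (1 - diag_integral (defect \<phi>)) * defect \<phi> c d
      - (diag_integral (\<lambda>a b. defect \<phi> c a * defect \<phi> b d) + \<phi> c * correction \<phi> d) + correction \<phi> (c * d)"
    unfolding diag_integral_add[OF bounded_cbilinear_on_diff[OF b1 b2] cb[OF cd]] diag_integral_diff[OF b1 b2]
      first second by (simp add: correction_def)
  finally have key: "correction \<phi> c * \<phi> d = \<dots>" .
  have "defect (newton_step \<phi>) c d = defect \<phi> c d + correction \<phi> (c * d) - \<phi> c * correction \<phi> d
      - correction \<phi> c * \<phi> d - correction \<phi> c * correction \<phi> d"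
    by (simp add: defect_def newton_step_def algebra_simps)
  then show ?thesis unfolding key by (simp add: algebra_simps)
qed

text \<open>The three terms of the new defect contribute \<open>y * \<delta>\<^sup>2\<close>, \<open>y * \<delta>\<^sup>2\<close> and \<open>(y * K * \<delta>)\<^sup>2\<close>, where \<open>y\<close> is
  the norm of the diagonal.  The target is preserved because \<open>N\<close> is weak-star closed.\<close>

lemma newton_step_near_homomorphism:
  assumes nh: "near_homomorphism N K \<delta> \<phi>"
    and N: "csubalgebra N" and cl: "closedin wstar_topology N"
  shows "near_homomorphism N (K + diagonal_norm * K * \<delta>)
    ((2 * diagonal_norm + diagonal_norm\<^sup>2 * K\<^sup>2) * \<delta>\<^sup>2) (newton_step \<phi>)"
  unfolding near_homomorphism_def
proof (intro conjI ballI)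
  let ?y = diagonal_norm
  have \<phi>: "bounded_clinear_on A K \<phi>" and \<phi>N: "\<And>x. x \<in> A \<Longrightarrow> \<phi> x \<in> N" and one: "\<phi> 1 = 1"
    and \<delta>: "0 \<le> \<delta>" using nh by (auto simp: near_homomorphism_def)
  note y = diagonal_norm_nonneg and D = defect_bilinear[OF nh] and \<theta> = correction_clinear[OF nh]
  have Ns: "csubspace N" and Nm: "\<And>x y. x \<in> N \<Longrightarrow> y \<in> N \<Longrightarrow> x * y \<in> N" using N by (auto simp: csubalgebra_def)
  show "bounded_clinear_on A (K + ?y * K * \<delta>) (newton_step \<phi>)"
    unfolding newton_step_def by (rule bounded_clinear_on_add[OF \<phi> \<theta>])
  have "correction \<phi> x \<in> N" if "x \<in> A" for x
    unfolding correction_def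
    by (rule diag_integral_mem_wstar_closed[OF correction_bilinear[OF nh that] cl Ns])
      (auto simp: defect_def intro!: Nm csubspace_diff[OF Ns] \<phi>N mult_mem that)
  then show "newton_step \<phi> ` A \<subseteq> N" using \<phi>N by (auto simp: newton_step_def intro!: csubspace_add[OF Ns])
  have "correction \<phi> 1 = diag_integral (\<lambda>a b. 0)" unfolding correction_def by (simp add: defect_def one)
  also have "\<dots> = 0" using diag_integral_norm[OF bounded_cbilinear_on_zero] by simp
  finally show "newton_step \<phi> 1 = 1" by (simp add: newton_step_def one)
  show "0 \<le> (2 * ?y + ?y\<^sup>2 * K\<^sup>2) * \<delta>\<^sup>2" using y by simp
  fix c d assume c: "c \<in> A" and d: "d \<in> A"
  have 1: "norm (diag_integral (defect \<phi>) * defect \<phi> c d) \<le> (?y * \<delta>) * (\<delta> * (norm c * norm d))"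
    using diag_integral_norm[OF D] bounded_cbilinear_onD(4)[OF D c d] y \<delta>
    by (intro order_trans[OF norm_mult_ineq] mult_mono) auto
  have "bounded_cbilinear_on A (\<delta> * norm c * (\<delta> * norm d)) (\<lambda>a b. defect \<phi> c a * defect \<phi> b d)"
    by (intro bounded_cbilinear_on_mult bounded_cbilinear_on_fix_left[OF D c] bounded_cbilinear_on_fix_right[OF D d])
  note 2 = diag_integral_norm[OF this]
  have 3: "norm (correction \<phi> c * correction \<phi> d) \<le> (?y * K * \<delta> * norm c) * (?y * K * \<delta> * norm d)"
    using bounded_clinear_onD(3)[OF \<theta>] bounded_clinear_onD(1)[OF \<theta>] c d
    by (intro order_trans[OF norm_mult_ineq] mult_mono) auto
  have "norm (defect (newton_step \<phi>) c d) \<le> norm (diag_integral (defect \<phi>) * defect \<phi> c d)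
      + norm (diag_integral (\<lambda>a b. defect \<phi> c a * defect \<phi> b d)) + norm (correction \<phi> c * correction \<phi> d)"
    unfolding newton_step_defect[OF nh c d]
    by (intro order_trans[OF norm_triangle_ineq4] add_mono norm_triangle_ineq order_refl)
  also have "\<dots> \<le> (?y * \<delta>) * (\<delta> * (norm c * norm d)) + ?y * (\<delta> * norm c * (\<delta> * norm d))
      + (?y * K * \<delta> * norm c) * (?y * K * \<delta> * norm d)"
    by (intro add_mono 1 2 3)
  also have "\<dots> = (2 * ?y + ?y\<^sup>2 * K\<^sup>2) * \<delta>\<^sup>2 * (norm c * norm d)"
    by (simp add: power2_eq_square algebra_simps)
  finally show "norm (defect (newton_step \<phi>) c d) \<le> (2 * ?y + ?y\<^sup>2 * K\<^sup>2) * \<delta>\<^sup>2 * (norm c * norm d)" .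
qed

lemma near_homomorphism_mono:
  assumes "near_homomorphism N K \<delta> \<phi>" "K \<le> K'" "\<delta> \<le> \<delta>'"
  shows "near_homomorphism N K' \<delta>' \<phi>"
proof -
  have "norm (defect \<phi> x y) \<le> \<delta>' * (norm x * norm y)" if "x \<in> A" "y \<in> A" for x y
    using assms(1) that mult_right_mono[OF assms(3), of "norm x * norm y"]
    by (force simp: near_homomorphism_def)
  moreover have "norm (\<phi> x) \<le> K' * norm x" if "x \<in> A" for x
    using assms(1) that mult_right_mono[OF assms(2), of "norm x"]
    by (force simp: near_homomorphism_def bounded_clinear_on_def)
  ultimately show ?thesis
    using assms by (auto simp: near_homomorphism_def bounded_clinear_on_def)
qed

text \<open>The smallness condition is chosen so that each step at least halves the defect while the norm
  bounds do not exceed \<open>2 * K\<close>; these geometric bounds suffice for convergence.\<close>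

lemma newton_iterates:
  assumes nh: "near_homomorphism N K \<delta> \<phi>"
    and N: "csubalgebra N" and cl: "closedin wstar_topology N"
    and small: "(4 * diagonal_norm + 8 * K\<^sup>2 * diagonal_norm\<^sup>2) * \<delta> \<le> 1"
  shows "near_homomorphism N (K + 4 * K * diagonal_norm * \<delta> * (1 - 1 / 2 ^ n)) (\<delta> / 2 ^ n) ((newton_step ^^ n) \<phi>)"
    and "K + 4 * K * diagonal_norm * \<delta> * (1 - 1 / 2 ^ n) \<le> 2 * K"
proof -
  let ?y = diagonal_norm
  have K: "0 \<le> K" and \<delta>: "0 \<le> \<delta>" using nh by (auto simp: near_homomorphism_def bounded_clinear_on_def)
  note y = diagonal_norm_nonneg
  have y\<delta>: "4 * ?y * \<delta> \<le> 1"
  proof -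
    have "4 * ?y * \<delta> \<le> (4 * ?y + 8 * K\<^sup>2 * ?y\<^sup>2) * \<delta>" using \<delta> by (intro mult_right_mono) auto
    then show ?thesis using small by linarith
  qed
  define Kn where "Kn n = K + 4 * K * ?y * \<delta> * (1 - 1 / 2 ^ n)" for n :: nat
  have le2: "Kn n \<le> 2 * K" for n
  proof -
    have "K * (4 * ?y * \<delta> * (1 - 1 / 2 ^ n)) \<le> K * 1"
    proof (rule mult_left_mono[OF _ K])
      have "4 * ?y * \<delta> * (1 - 1 / 2 ^ n) \<le> 1 * 1" using y\<delta> y \<delta> by (intro mult_mono) auto
      then show "4 * ?y * \<delta> * (1 - 1 / 2 ^ n) \<le> 1" by simp
    qed
    then show ?thesis by (simp add: Kn_def mult_ac)
  qed
  then show "K + 4 * K * ?y * \<delta> * (1 - 1 / 2 ^ n) \<le> 2 * K" by (simp add: Kn_def)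
  have "near_homomorphism N (Kn n) (\<delta> / 2 ^ n) ((newton_step ^^ n) \<phi>)"
  proof (induction n)
    case 0
    then show ?case using nh by (simp add: Kn_def)
  next
    case (Suc n)
    have Kn0: "0 \<le> Kn n" using Suc by (auto simp: near_homomorphism_def bounded_clinear_on_def)
    have "near_homomorphism N (Kn n + ?y * Kn n * (\<delta> / 2 ^ n)) ((2 * ?y + ?y\<^sup>2 * (Kn n)\<^sup>2) * (\<delta> / 2 ^ n)\<^sup>2)
        (newton_step ((newton_step ^^ n) \<phi>))"
      by (rule newton_step_near_homomorphism[OF Suc N cl])
    moreover have "Kn n + ?y * Kn n * (\<delta> / 2 ^ n) \<le> Kn (Suc n)"
    proof -
      have "?y * Kn n * (\<delta> / 2 ^ n) \<le> ?y * (2 * K) * (\<delta> / 2 ^ n)"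
        using le2[of n] y \<delta> by (intro mult_right_mono mult_left_mono) auto
      also have "\<dots> = Kn (Suc n) - Kn n" by (simp add: Kn_def field_simps)
      finally show ?thesis by simp
    qed
    moreover have "(2 * ?y + ?y\<^sup>2 * (Kn n)\<^sup>2) * (\<delta> / 2 ^ n)\<^sup>2 \<le> \<delta> / 2 ^ Suc n"
    proof -
      have p1: "(1::real) \<le> 2 ^ n" by simp
      have "(2 * ?y + ?y\<^sup>2 * (Kn n)\<^sup>2) * \<delta> \<le> (2 * ?y + ?y\<^sup>2 * (2 * K)\<^sup>2) * \<delta>"
        using le2[of n] Kn0 \<delta> by (intro mult_right_mono add_left_mono mult_left_mono power_mono) auto
      also have "\<dots> = (4 * ?y + 8 * K\<^sup>2 * ?y\<^sup>2) * \<delta> / 2" by (simp add: power_mult_distrib algebra_simps)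
      also have "\<dots> \<le> 1 / 2" using small by simp
      finally have "(2 * ?y + ?y\<^sup>2 * (Kn n)\<^sup>2) * \<delta> * (\<delta> / (2 ^ n * 2 ^ n)) \<le> 1 / 2 * (\<delta> / (2 ^ n * 1))"
        using \<delta> p1 by (intro mult_mono divide_left_mono mult_left_mono) auto
      then show ?thesis by (simp add: power2_eq_square)
    qed
    ultimately show ?case by (simp add: near_homomorphism_mono)
  qed
  then show "near_homomorphism N (K + 4 * K * ?y * \<delta> * (1 - 1 / 2 ^ n)) (\<delta> / 2 ^ n) ((newton_step ^^ n) \<phi>)"
    by (simp add: Kn_def)
qed

text \<open>The corrections are dominated by \<open>2 * K * diagonal_norm * \<delta> / 2 ^ n\<close>, so the iterates converge
  pointwise, and their defects tend to \<open>0\<close>.\<close>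

lemma near_homomorphism_close_to_homomorphism:
  assumes nh: "near_homomorphism N K \<delta> \<phi>"
    and N: "csubalgebra N" and cl: "closedin wstar_topology N" and Ncl: "closed N"
    and small: "(4 * diagonal_norm + 8 * K\<^sup>2 * diagonal_norm\<^sup>2) * \<delta> \<le> 1"
  shows "\<exists>\<psi> K'. bounded_clinear_on A K' \<psi> \<and> \<psi> ` A \<subseteq> N \<and> (\<forall>x\<in>A. \<forall>y\<in>A. \<psi> (x * y) = \<psi> x * \<psi> y) \<and>
    (\<forall>x\<in>A. norm (\<psi> x - \<phi> x) \<le> 4 * K * diagonal_norm * \<delta> * norm x)"
proof -
  let ?y = diagonal_norm
  have K: "0 \<le> K" and \<delta>: "0 \<le> \<delta>" using nh by (auto simp: near_homomorphism_def bounded_clinear_on_def)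
  note y = diagonal_norm_nonneg
  define f where "f n = (newton_step ^^ n) \<phi>" for n
  have nhn: "near_homomorphism N (2 * K) (\<delta> / 2 ^ n) (f n)" for n
    unfolding f_def
    by (rule near_homomorphism_mono[OF newton_iterates[OF nh N cl small]]) simp
  have step: "norm (f (Suc n) x - f n x) \<le> 2 * K * ?y * \<delta> * norm x * (1 / 2) ^ n" if "x \<in> A" for n x
    using bounded_clinear_onD(3)[OF correction_clinear[OF nhn[of n]] that]
    by (simp add: f_def newton_step_def power_divide mult_ac)
  define \<psi> where "\<psi> x = \<phi> x + (\<Sum>n. f (Suc n) x - f n x)" for x
  have geo: "(\<lambda>n. 2 * K * ?y * \<delta> * norm x * (1 / 2) ^ n) sums (4 * K * ?y * \<delta> * norm x)" for x :: "'h bop"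
    using sums_mult[OF geometric_sums[of "1/2::real"], of "2 * K * ?y * \<delta> * norm x"] by (simp add: mult_ac)
  have bound: "norm (\<psi> x - \<phi> x) \<le> 4 * K * ?y * \<delta> * norm x" if "x \<in> A" for x
    using norm_suminf_le[OF step[OF that] sums_summable[OF geo]] sums_unique[OF geo[of x]] by (simp add: \<psi>_def)
  have lim: "(\<lambda>n. f n x) \<longlonglongrightarrow> \<psi> x" if x: "x \<in> A" for x
  proof -
    have "summable (\<lambda>n. f (Suc n) x - f n x)"
      by (rule summable_comparison_test[OF _ sums_summable[OF geo]]) (use step[OF x] in blast)
    then have "(\<lambda>n. \<Sum>k<n. f (Suc k) x - f k x) \<longlonglongrightarrow> (\<Sum>n. f (Suc n) x - f n x)"
      by (rule summable_LIMSEQ)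
    then have "(\<lambda>n. f n x - \<phi> x) \<longlonglongrightarrow> (\<Sum>n. f (Suc n) x - f n x)"
      unfolding sum_lessThan_telescope[of "\<lambda>n. f n x"] by (simp add: f_def[of 0])
    from tendsto_add[OF tendsto_const[of "\<phi> x"] this] show ?thesis by (simp add: \<psi>_def)
  qed
  have fn: "bounded_clinear_on A (2 * K) (f n)" "f n ` A \<subseteq> N" for n
    using nhn[of n] by (auto simp: near_homomorphism_def)
  have "clinear_on A \<psi>"
    unfolding clinear_on_def
  proof (intro conjI ballI allI)
    fix x z r assume x: "x \<in> A"
    have "(\<lambda>n. f n (r *\<^sub>C x)) \<longlonglongrightarrow> r *\<^sub>C \<psi> x"
      using bounded_linear.tendsto[OF bounded_linear_scaleC lim[OF x]] clinear_onD(2)[OF bounded_clinear_onD(2)[OF fn(1)] x]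
      by simp
    then show "\<psi> (r *\<^sub>C x) = r *\<^sub>C \<psi> x"
      by (rule LIMSEQ_unique[OF lim[OF csubspace_scaleC[OF subspace x]]])
    assume z: "z \<in> A"
    have "(\<lambda>n. f n (x + z)) \<longlonglongrightarrow> \<psi> x + \<psi> z"
      using tendsto_add[OF lim[OF x] lim[OF z]] clinear_onD(1)[OF bounded_clinear_onD(2)[OF fn(1)] x z] by simp
    then show "\<psi> (x + z) = \<psi> x + \<psi> z"
      by (rule LIMSEQ_unique[OF lim[OF csubspace_add[OF subspace x z]]])
  qed
  moreover have "norm (\<psi> x) \<le> 2 * K * norm x" if x: "x \<in> A" for x
    by (rule LIMSEQ_le_const2[OF tendsto_norm[OF lim[OF x]]]) (use bounded_clinear_onD(3)[OF fn(1) x] in blast)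
  ultimately have 1: "bounded_clinear_on A (2 * K) \<psi>" using K by (simp add: bounded_clinear_on_def)
  have 2: "\<psi> ` A \<subseteq> N"
    using closed_sequentially[OF Ncl _ lim] fn(2) by blast
  have 3: "\<psi> (x * z) = \<psi> x * \<psi> z" if x: "x \<in> A" and z: "z \<in> A" for x z
  proof -
    have "(\<lambda>n. defect (f n) x z) \<longlonglongrightarrow> \<psi> (x * z) - \<psi> x * \<psi> z"
      unfolding defect_def by (intro tendsto_intros lim x z mult_mem)
    moreover have "(\<lambda>n. defect (f n) x z) \<longlonglongrightarrow> 0"
    proof (rule Lim_null_comparison)
      show "\<forall>\<^sub>F n in sequentially. norm (defect (f n) x z) \<le> \<delta> * (norm x * norm z) * (1 / 2) ^ n"
        using nhn x z by (auto simp: near_homomorphism_def power_divide mult_ac)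
      show "(\<lambda>n. \<delta> * (norm x * norm z) * (1 / 2) ^ n) \<longlonglongrightarrow> 0"
        by (intro tendsto_mult_right_zero LIMSEQ_power_zero) simp
    qed
    ultimately have "\<psi> (x * z) - \<psi> x * \<psi> z = 0" by (rule LIMSEQ_unique)
    then show ?thesis by simp
  qed
  show ?thesis using 1 2 3 bound by blast
qed

text \<open>The commutation rule moves \<open>c\<close> from the left of the first factor to the right of the second.
  Since \<open>1\<close> is the integral of \<open>a * b\<close>, the difference \<open>S - 1\<close> is the integral of
  \<open>(\<psi> a - a) * b\<close>.\<close>

lemma intertwiner:
  assumes \<psi>: "bounded_clinear_on A K \<psi>" and hom: "\<forall>x\<in>A. \<forall>y\<in>A. \<psi> (x * y) = \<psi> x * \<psi> y"
    and close: "\<forall>x\<in>A. norm (\<psi> x - x) \<le> q * norm x" and q: "0 \<le> q"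
  defines "S \<equiv> diag_integral (\<lambda>a b. \<psi> a * b)"
  shows "c \<in> A \<Longrightarrow> \<psi> c * S = S * c" and "norm (S - 1) \<le> diagonal_norm * q"
    and "\<lbrakk>closedin wstar_topology M; csubalgebra M; A \<subseteq> M; \<psi> ` A \<subseteq> M\<rbrakk> \<Longrightarrow> S \<in> M"
proof -
  note b = bounded_cbilinear_on_mult[OF \<psi> bounded_clinear_on_id]
  show "\<psi> c * S = S * c" if c: "c \<in> A"
  proof -
    have "\<psi> c * S = diag_integral (\<lambda>a b. \<psi> c * (\<psi> a * b))"
      unfolding S_def by (rule diag_integral_mult_left[OF b, symmetric])
    also have "\<dots> = diag_integral (\<lambda>a b. \<psi> (c * a) * b)"
      by (intro diag_integral_cong) (simp add: hom c mult.assoc)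
    also have "\<dots> = diag_integral (\<lambda>a b. \<psi> a * (b * c))" by (rule diag_integral_shift[OF b c])
    also have "\<dots> = S * c"
      unfolding S_def using diag_integral_mult_right[OF b, of c] by (simp add: mult.assoc)
    finally show ?thesis .
  qed
  have "bounded_clinear_on A q (\<lambda>x. \<psi> x - x)"
    using bounded_clinear_onD(2)[OF \<psi>] close q
    by (auto simp: bounded_clinear_on_def clinear_on_def scaleC_diff_right)
  note bq = bounded_cbilinear_on_mult[OF this bounded_clinear_on_id]
  have "S - 1 = S - diag_integral (\<lambda>a b. a * b)" using diag_integral_product[OF bounded_clinear_on_id] by simp
  also have "\<dots> = diag_integral (\<lambda>a b. \<psi> a * b - a * b)"
    unfolding S_def
    by (rule diag_integral_diff[OF b bounded_cbilinear_on_mult[OF bounded_clinear_on_id bounded_clinear_on_id], symmetric])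
  also have "\<dots> = diag_integral (\<lambda>a b. (\<psi> a - a) * b)" by (simp add: left_diff_distrib)
  finally show "norm (S - 1) \<le> diagonal_norm * q" using diag_integral_norm[OF bq] by simp
  assume M: "closedin wstar_topology M" "csubalgebra M" "A \<subseteq> M" "\<psi> ` A \<subseteq> M"
  then show "S \<in> M"
    unfolding S_def by (intro diag_integral_mem_wstar_closed[OF b]) (auto simp: csubalgebra_def)
qed

lemma one_le_diagonal_norm:
  assumes "(1 :: 'h bop) \<noteq> 0"
  shows "1 \<le> diagonal_norm"
proof -
  have "norm (1 :: 'h bop) = norm (diag_integral (\<lambda>a b. a * b))"
    using diag_integral_product[OF bounded_clinear_on_id] by simp
  also have "\<dots> \<le> diagonal_norm * 1"
    using diag_integral_norm[OF bounded_cbilinear_on_mult[OF bounded_clinear_on_id bounded_clinear_on_id]] by simp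
  finally have "norm (1 :: 'h bop) \<le> diagonal_norm" by simp
  moreover have "1 \<le> norm (1 :: 'h bop)"
    using norm_mult_ineq[of "1 :: 'h bop" 1] assms by simp
  ultimately show ?thesis by linarith
qed

end

section \<open>Perturbation of an amenable subalgebra\<close>

text \<open>If \<open>n \<in> N\<close> is close to \<open>x\<close>, then \<open>P x - x = P (x - n) - (x - n)\<close>, because \<open>P n = n\<close>.\<close>

lemma projection_near_identity:
  assumes P: "bounded_projection_onto P N" and A: "csubspace A"
    and near: "near_inclusion A \<gamma> N" and x: "x \<in> A"
  shows "norm (P x - x) \<le> (1 + onorm P) * \<gamma> * norm x"
proof (cases "x = 0")
  case True
  have "bounded_linear P" using P by (simp add: bounded_projection_onto_def bounded_clinear_def)
  then show ?thesis using True by (simp add: linear_simps)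
next
  case False
  have bl: "bounded_linear P" and idem: "\<And>x. P (P x) = P x" and ran: "range P = N"
    using P by (auto simp: bounded_projection_onto_def bounded_clinear_def)
  define v where "v = inverse (norm x) *\<^sub>R x"
  have "v \<in> A" unfolding v_def scaleR_scaleC by (rule csubspace_scaleC[OF A x])
  moreover have "norm v \<le> 1" using False by (simp add: v_def)
  ultimately obtain n where n: "n \<in> N" "norm (v - n) \<le> \<gamma>" using near by (auto simp: near_inclusion_def)
  have "P n = n" using n(1) ran idem by auto
  then have "P v - v = P (v - n) - (v - n)" using bl by (simp add: linear_simps)
  also have "norm \<dots> \<le> norm (P (v - n)) + norm (v - n)" by (rule norm_triangle_ineq4)
  also have "\<dots> \<le> onorm P * norm (v - n) + norm (v - n)" using onorm[OF bl] by simp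
  also have "\<dots> = (1 + onorm P) * norm (v - n)" by (simp add: distrib_right)
  also have "\<dots> \<le> (1 + onorm P) * \<gamma>" using n(2) onorm_pos_le[OF bl] by (intro mult_left_mono) auto
  finally have "norm x * norm (P v - v) \<le> norm x * ((1 + onorm P) * \<gamma>)" by (intro mult_left_mono) auto
  moreover have "P x - x = norm x *\<^sub>R (P v - v)"
    using False bl by (simp add: v_def linear_simps scaleR_diff_right)
  ultimately show ?thesis by (simp add: mult_ac)
qed

theorem theorem4p1:
  fixes A N :: "'h::complex_hilbert_space bop set"
    and u :: "'h bop ptensor_bidual"
    and P :: "'h bop \<Rightarrow> 'h bop"
    and \<gamma> :: real
  assumes "unital_operator_subalgebra A"
    and "unital_operator_subalgebra N"
    and "virtual_diagonal A u"
    and "closedin wstar_topology N"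
    and "bounded_projection_onto P N"
    and "\<gamma> > 0"
    and "near_inclusion A \<gamma> N"
    and "\<gamma> < 1 / perturbation_bound (onorm P) (virtual_diagonal_norm A u)"
  shows "\<exists>S R. S \<in> wstar_closed_algebra_generated (A \<union> N) \<and> S * R = 1 \<and> R * S = 1 \<and>
    (\<lambda>a. S * a * R) ` A \<subseteq> N \<and>
    norm (S - 1) \<le> perturbation_bound (onorm P) (virtual_diagonal_norm A u) * \<gamma>"
proof -
  interpret algebra_with_virtual_diagonal A u
    using assms(1,3) by unfold_locales
  define x where "x = onorm P"
  define y where "y = virtual_diagonal_norm A u"
  define F where "F = perturbation_bound x y"
  have bl: "bounded_linear P" and Plin: "clinear_on UNIV P" and idem: "\<And>a. P (P a) = P a" and ran: "range P = N"
    using assms(5) by (auto simp: bounded_projection_onto_def bounded_clinear_def)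
  have N: "csubalgebra N" "1 \<in> N" "closed N" using assms(2) by (auto simp: unital_operator_subalgebra_def)
  have x0: "0 \<le> x" unfolding x_def by (rule onorm_pos_le[OF bl])
  have y0: "0 \<le> y" unfolding y_def by (rule diagonal_norm_nonneg)
  have P1: "P 1 = 1" using N(2) ran idem by (metis rangeE)
  show ?thesis
  \<comment> \<open>The norm bounds \<open>1 \<le> x\<close> and \<open>1 \<le> y\<close> can fail on the zero space, which is treated apart.\<close>
  proof (cases "(1 :: 'h bop) = 0")
    case True
    have zero: "a = 0" for a :: "'h bop" using mult_1_left[of a] True by simp
    have "(1 :: 'h bop) \<in> wstar_closed_algebra_generated (A \<union> N)"
      using N(2) hull_subset[of "A \<union> N"] unfolding wstar_closed_algebra_generated_def by blast
    moreover have "(\<lambda>a. 1 * a * 1) ` A \<subseteq> N" using N(2) zero by (metis image_subsetI)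
    moreover have "0 \<le> F * \<gamma>" using x0 y0 assms(6) by (simp add: F_def perturbation_bound_def)
    ultimately show ?thesis by (intro exI[of _ 1]) (simp add: F_def x_def y_def)
  next
    case False
    have y1: "1 \<le> y" unfolding y_def by (rule one_le_diagonal_norm[OF False])
    have "norm (1 :: 'h bop) \<le> x * norm (1 :: 'h bop)" using onorm[OF bl, of 1] by (simp add: P1 x_def)
    then have x1: "1 \<le> x" using False by simp
    define q where "q = (1 + x) * \<gamma>"
    define \<delta> where "\<delta> = (x + 2) * q"
    have q0: "0 \<le> q" and \<delta>0: "0 \<le> \<delta>" using x0 assms(6) by (auto simp: q_def \<delta>_def)
    have F: "F * \<gamma> = y * q + 4 * y\<^sup>2 * \<delta> + 8 * x\<^sup>2 * y ^ 3 * \<delta>"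
      unfolding F_def perturbation_bound_def q_def \<delta>_def by (simp add: algebra_simps)
    have "0 < F" unfolding F_def perturbation_bound_def using x0 y1 by (intro mult_pos_pos add_pos_nonneg) auto
    then have F1: "F * \<gamma> < 1" using assms(8) by (simp add: F_def x_def y_def field_simps)
    have near: "norm (P a - a) \<le> q * norm a" if "a \<in> A" for a
      using projection_near_identity[OF assms(5) subspace assms(7) that] by (simp add: q_def x_def)
    have Px: "norm (P a) \<le> x * norm a" for a unfolding x_def by (rule onorm[OF bl])
    have nh: "near_homomorphism N x \<delta> P"
      unfolding near_homomorphism_def
    proof (intro conjI ballI)
      show "bounded_clinear_on A x P" using x0 Px Plin by (auto simp: bounded_clinear_on_def clinear_on_def)
      show "P ` A \<subseteq> N" using ran by auto
      fix a b assume a: "a \<in> A" and b: "b \<in> A"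
      have "defect P a b = (P (a * b) - a * b) - (P a - a) * b - P a * (P b - b)"
        by (simp add: defect_def algebra_simps)
      also have "norm \<dots> \<le> norm (P (a * b) - a * b) + norm ((P a - a) * b) + norm (P a * (P b - b))"
        by (intro order_trans[OF norm_triangle_ineq4] add_mono norm_triangle_ineq4 order_refl)
      also have "\<dots> \<le> q * (norm a * norm b) + (q * norm a) * norm b + (x * norm a) * (q * norm b)"
      proof (intro add_mono)
        show "norm (P (a * b) - a * b) \<le> q * (norm a * norm b)"
          using near[OF mult_mem[OF a b]] mult_left_mono[OF norm_mult_ineq[of a b] q0] by linarith
        show "norm ((P a - a) * b) \<le> (q * norm a) * norm b"
          using near[OF a] by (intro order_trans[OF norm_mult_ineq] mult_right_mono) auto
        show "norm (P a * (P b - b)) \<le> (x * norm a) * (q * norm b)"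
          using near[OF b] Px[of a] x0 by (intro order_trans[OF norm_mult_ineq] mult_mono) auto
      qed
      also have "\<dots> = \<delta> * (norm a * norm b)" by (simp add: \<delta>_def algebra_simps)
      finally show "norm (defect P a b) \<le> \<delta> * (norm a * norm b)" .
    qed (use P1 \<delta>0 in auto)
    have small: "(4 * y + 8 * x\<^sup>2 * y\<^sup>2) * \<delta> \<le> 1"
    proof -
      \<comment> \<open>The two higher terms of \<open>F * \<gamma>\<close> are \<open>y\<close> times this quantity.\<close>
      have "1 * ((4 * y + 8 * x\<^sup>2 * y\<^sup>2) * \<delta>) \<le> y * ((4 * y + 8 * x\<^sup>2 * y\<^sup>2) * \<delta>)"
        using y1 \<delta>0 by (intro mult_right_mono) auto
      also have "\<dots> = F * \<gamma> - y * q" unfolding F by (simp add: power2_eq_square power3_eq_cube algebra_simps)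
      finally show ?thesis using F1 mult_nonneg_nonneg[OF y0 q0] by linarith
    qed
    obtain \<psi> K where \<psi>: "bounded_clinear_on A K \<psi>" "\<psi> ` A \<subseteq> N"
      "\<forall>a\<in>A. \<forall>b\<in>A. \<psi> (a * b) = \<psi> a * \<psi> b"
      "\<And>a. a \<in> A \<Longrightarrow> norm (\<psi> a - P a) \<le> 4 * x * y * \<delta> * norm a"
      using near_homomorphism_close_to_homomorphism[OF nh N(1) assms(4) N(3)] small unfolding y_def by blast
    define S where "S = diag_integral (\<lambda>a b. \<psi> a * b)"
    have close: "\<forall>a\<in>A. norm (\<psi> a - a) \<le> (4 * x * y * \<delta> + q) * norm a"
    proof
      fix a assume "a \<in> A"
      then show "norm (\<psi> a - a) \<le> (4 * x * y * \<delta> + q) * norm a"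
        using \<psi>(4) near norm_triangle_ineq[of "\<psi> a - P a" "P a - a"] by (fastforce simp: distrib_right)
    qed
    have q': "0 \<le> 4 * x * y * \<delta> + q" using x0 y0 \<delta>0 q0 by simp
    note I = intertwiner[OF \<psi>(1,3) close q', folded S_def]
    have "norm (S - 1) \<le> y * (4 * x * y * \<delta> + q)" using I(2) by (simp add: y_def)
    also have "\<dots> \<le> F * \<gamma>"
    proof -
      \<comment> \<open>The iteration costs \<open>4 * x * y\<^sup>2 * \<delta>\<close>, which the cubic term of \<open>F * \<gamma>\<close> dominates.\<close>
      have "x * y\<^sup>2 * \<delta> * 1 \<le> x * y\<^sup>2 * \<delta> * (x * y)"
        using x1 y1 \<delta>0 by (intro mult_left_mono) (auto intro: mult_ge1_I)
      moreover have "0 \<le> y\<^sup>2 * \<delta>" "0 \<le> x\<^sup>2 * y ^ 3 * \<delta>" using y0 \<delta>0 by auto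
      ultimately show ?thesis unfolding F by (simp add: power2_eq_square power3_eq_cube algebra_simps)
    qed
    finally have S1: "norm (S - 1) \<le> F * \<gamma>" .
    then obtain R where R: "S * R = 1" "R * S = 1" using F1 neumann_inverse[of S] by auto
    have "S * a * R \<in> N" if a: "a \<in> A" for a
    proof -
      have "S * a * R = \<psi> a * (S * R)" using I(1)[OF a] by (simp add: mult.assoc[symmetric])
      then show ?thesis using R(1) \<psi>(2) a by auto
    qed
    moreover have "S \<in> wstar_closed_algebra_generated (A \<union> N)"
      unfolding wstar_closed_algebra_generated_def hull_def using I(3) \<psi>(2) by blast
    ultimately show ?thesis using R S1 by (auto simp: F_def x_def y_def)
  qed
qed

end
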